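(* Let $(\mathcal A,\mathcal H,D)$ be a spectral triple with discrete simple dimension spectrum not containing $0$ and bounded above by $3$ (i.e. contained in $\{\mathrm{Re}\,z\le3\}$). Assume that $[F,a]$ is trace class for all $a\in\mathcal A$. Let $\tau_1(a_0,a_1)=\mathrm{Trace}(a_0[F,a_1])$. Then the local Chern character $(\varphi_1,\varphi_3)$ of $(\mathcal A,\mathcal H,D)$ is equal to $\tau_1+(b+B)\varphi$, i.e. $$\varphi_1=\tau_1+b\varphi_0+B\varphi_2,\qquad\varphi_3=b\varphi_2,$$ where $\varphi=(\varphi_0,\varphi_2)$ is the cochain given by $$\varphi_0(a)=\mathrm{Trace}(F\,a\,|D|^{-s})_{s=0},\qquad \varphi_2(a_0,a_1,a_2)=\tfrac1{24}\int\!\!\!\!\!\!-\,a_0\,\delta(a_1)\,\delta^2(a_2)\,F\,|D|^{-3}.$$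
   Context: A spectral triple $(\mathcal A,\mathcal H,D)$: a unital $*$-algebra $\mathcal A$ represented in the Hilbert space $\mathcal H$ and a self-adjoint operator $D$ with compact resolvent and $[D,a]$ bounded for $a\in\mathcal A$. $F=\mathrm{Sign}\,D$ (with values $\pm1$ chosen on the finite-dimensional kernel of $D$, so $F^2=1$). $\delta(T)=[|D|,T]$, $\nabla(T)=[D^2,T]$. In expressions involving powers of $|D|$, $|D|$ is replaced by an arbitrary positive constant on $\ker D$. Standing regularity assumption: $a$ and $[D,a]$ belong to $\bigcap_k\mathrm{Dom}\,\delta^k$ for all $a\in\mathcal A$. Let $\mathcal B$ be the algebra generated by all $\delta^k(a)$, $\delta^k([D,a])$, $a\in\mathcal A$, together with $F$. For $b\in\mathcal B$, $\zeta_b(z)=\mathrm{Trace}(b|D|^{-z})$, defined for $\mathrm{Re}\,z$ large. The dimension spectrum is the subset $\Sigma\subset\mathbb C$ of singularities of the analytic functions $\zeta_b$, $b\in\mathcal B$; discrete and simple means $\Sigma$ is discrete and all $\zeta_b$ extend to $\mathbb C\setminus\Sigma$ with at most simple poles at points of $\Sigma$. Write $\int\!\!\!\!\!-\,P=\mathrm{Res}_{z=0}\mathrm{Trace}(P|D|^{-z})$, and $\mathrm{Trace}(P|D|^{-s})_{s=0}$ for the value at $s=0$ of the analytic continuation. The local Chern character (up to the overall factor $(2i\pi)^{1/2}$) is the cocycle $(\varphi_1,\varphi_3)$: $$\varphi_1(a^0,a^1)=\int\!\!\!\!\!\!-\,a^0[D,a^1]|D|^{-1}-\tfrac14\int\!\!\!\!\!\!-\,a^0\nabla([D,a^1])|D|^{-3}+\tfrac18\int\!\!\!\!\!\!-\,a^0\nabla^2([D,a^1])|D|^{-5},$$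 $$\varphi_3(a^0,a^1,a^2,a^3)=\tfrac1{12}\int\!\!\!\!\!\!-\,a^0[D,a^1][D,a^2][D,a^3]|D|^{-3}.$$ Coboundaries: $(b\psi)(a^0,\dots,a^{m+1})=\sum_{j=0}^m(-1)^j\psi(a^0,\dots,a^ja^{j+1},\dots,a^{m+1})+(-1)^{m+1}\psi(a^{m+1}a^0,a^1,\dots,a^m)$; $B=A_{\mathrm{cyc}}B_0$, where for an $(m+1)$-linear form, $(B_0\varphi)(a^0,\dots,a^{m-1})=\varphi(1,a^0,\dots,a^{m-1})-(-1)^m\varphi(a^0,\dots,a^{m-1},1)$ and $(A_{\mathrm{cyc}}\psi)(a^0,\dots,a^{m-1})=\sum_{j=0}^{m-1}(-1)^{(m-1)j}\psi(a^j,a^{j+1},\dots,a^{j-1})$. *)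

theory Defs
  imports "HOL-Complex_Analysis.Complex_Analysis"
begin

class complex_vector = ab_group_add +
  fixes scaleC :: "complex \<Rightarrow> 'a \<Rightarrow> 'a"  (infixr "*\<^sub>C" 75)
  assumes scaleC_add_right: "c *\<^sub>C (x + y) = c *\<^sub>C x + c *\<^sub>C y"
    and scaleC_add_left: "(c + d) *\<^sub>C x = c *\<^sub>C x + d *\<^sub>C x"
    and scaleC_scaleC: "c *\<^sub>C d *\<^sub>C x = (c * d) *\<^sub>C x"
    and scaleC_one: "1 *\<^sub>C x = x"

text \<open>The inner product is antilinear in the first and linear in the second argument.\<close>

class complex_hilbert_space = complex_vector + banach +
  fixes cinner :: "'a \<Rightarrow> 'a \<Rightarrow> complex"
  assumes scaleR_scaleC: "r *\<^sub>R x = complex_of_real r *\<^sub>C x"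
    and cinner_commute: "cinner x y = cnj (cinner y x)"
    and cinner_add_right: "cinner x (y + z) = cinner x y + cinner x z"
    and cinner_scaleC_right: "cinner x (c *\<^sub>C y) = c * cinner x y"
    and cinner_self: "cinner x x = complex_of_real ((norm x)\<^sup>2)"

class complex_star_algebra = complex_vector + ring_1 +
  fixes star :: "'a \<Rightarrow> 'a"
  assumes scaleC_mult_left: "(c *\<^sub>C x) * y = c *\<^sub>C (x * y)"
    and scaleC_mult_right: "x * (c *\<^sub>C y) = c *\<^sub>C (x * y)"
    and star_add: "star (x + y) = star x + star y"
    and star_scaleC: "star (c *\<^sub>C x) = cnj c *\<^sub>C star x"
    and star_mult: "star (x * y) = star y * star x"
    and star_star: "star (star x) = x"


definition bounded_clinear :: "('h::complex_hilbert_space \<Rightarrow> 'h) \<Rightarrow> bool" where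
  "bounded_clinear T \<longleftrightarrow> bounded_linear T \<and> (\<forall>c x. T (c *\<^sub>C x) = c *\<^sub>C T x)"

definition compact_op :: "('h::complex_hilbert_space \<Rightarrow> 'h) \<Rightarrow> bool" where
  "compact_op T \<longleftrightarrow> bounded_clinear T \<and> compact (closure (T ` cball 0 1))"

definition is_onb :: "'h::complex_hilbert_space set \<Rightarrow> bool" where
  "is_onb E \<longleftrightarrow> (\<forall>e\<in>E. norm e = 1) \<and> (\<forall>e\<in>E. \<forall>f\<in>E. e \<noteq> f \<longrightarrow> cinner e f = 0)
     \<and> (\<forall>x. (\<forall>e\<in>E. cinner e x = 0) \<longrightarrow> x = 0)"

definition positive_op :: "('h::complex_hilbert_space \<Rightarrow> 'h) \<Rightarrow> bool" where
  "positive_op S \<longleftrightarrow> bounded_clinear S \<and> (\<forall>x. cinner x (S x) \<in> \<real> \<and> 0 \<le> Re (cinner x (S x)))"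

text \<open>\<open>S\<close> is the modulus of \<open>T\<close>, the positive square root of the product of the adjoint
  of \<open>T\<close> with \<open>T\<close>; this product is described by its matrix elements.\<close>

definition is_modulus :: "('h::complex_hilbert_space \<Rightarrow> 'h) \<Rightarrow> ('h \<Rightarrow> 'h) \<Rightarrow> bool" where
  "is_modulus T S \<longleftrightarrow> positive_op S \<and> (\<forall>x y. cinner x (S (S y)) = cinner (T x) (T y))"

definition trace_class :: "('h::complex_hilbert_space \<Rightarrow> 'h) \<Rightarrow> bool" where
  "trace_class T \<longleftrightarrow> bounded_clinear T \<and>
     (\<exists>S E. is_modulus T S \<and> is_onb E \<and> (\<lambda>e. Re (cinner e (S e))) summable_on E)"

text \<open>For trace class operators the value does not depend on the orthonormal basis.\<close>

definition op_trace :: "('h::complex_hilbert_space \<Rightarrow> 'h) \<Rightarrow> complex" where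
  "op_trace T = (\<Sum>\<^sub>\<infinity>e\<in>(SOME E. is_onb E). cinner e (T e))"


text \<open>An unbounded operator is a pair \<open>W\<close>, \<open>D\<close> of a domain and a function, whose values outside
  \<open>W\<close> are irrelevant. The last clause of the next definition says that the graph of the adjoint
  is the graph of \<open>D\<close>.\<close>

definition self_adjoint :: "'h::complex_hilbert_space set \<Rightarrow> ('h \<Rightarrow> 'h) \<Rightarrow> bool" where
  "self_adjoint W D \<longleftrightarrow>
     0 \<in> W \<and> (\<forall>x\<in>W. \<forall>y\<in>W. x + y \<in> W) \<and> (\<forall>c. \<forall>x\<in>W. c *\<^sub>C x \<in> W) \<and> closure W = UNIV
     \<and> (\<forall>x\<in>W. \<forall>y\<in>W. D (x + y) = D x + D y) \<and> (\<forall>c. \<forall>x\<in>W. D (c *\<^sub>C x) = c *\<^sub>C D x)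
     \<and> (\<forall>y w. (\<forall>x\<in>W. cinner (D x) y = cinner x w) \<longleftrightarrow> y \<in> W \<and> w = D y)"

definition is_resolvent ::
  "'h::complex_hilbert_space set \<Rightarrow> ('h \<Rightarrow> 'h) \<Rightarrow> complex \<Rightarrow> ('h \<Rightarrow> 'h) \<Rightarrow> bool" where
  "is_resolvent W D \<mu> R \<longleftrightarrow> bounded_clinear R
     \<and> (\<forall>x. R x \<in> W \<and> D (R x) - \<mu> *\<^sub>C R x = x) \<and> (\<forall>x\<in>W. R (D x - \<mu> *\<^sub>C x) = x)"

definition compact_resolvent :: "'h::complex_hilbert_space set \<Rightarrow> ('h \<Rightarrow> 'h) \<Rightarrow> bool" where
  "compact_resolvent W D \<longleftrightarrow> (\<exists>\<mu> R. is_resolvent W D \<mu> R \<and> compact_op R)"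

definition eigenspace ::
  "'h::complex_hilbert_space set \<Rightarrow> ('h \<Rightarrow> 'h) \<Rightarrow> real \<Rightarrow> 'h set" where
  "eigenspace W D l = {x \<in> W. D x = l *\<^sub>R x}"

definition eigenproj ::
  "'h::complex_hilbert_space set \<Rightarrow> ('h \<Rightarrow> 'h) \<Rightarrow> real \<Rightarrow> 'h \<Rightarrow> 'h" where
  "eigenproj W D l x =
     (THE y. y \<in> eigenspace W D l \<and> (\<forall>v\<in>eigenspace W D l. cinner v (x - y) = 0))"

text \<open>Functional calculus for a self-adjoint operator with compact resolvent: the Hilbert space is
  the orthogonal sum of the eigenspaces, and \<open>f(D)\<close> is multiplication by \<open>f l\<close> on the
  eigenspace of \<open>l\<close>, with its maximal domain.\<close>

definition fcalc_dom ::
  "'h::complex_hilbert_space set \<Rightarrow> ('h \<Rightarrow> 'h) \<Rightarrow> (real \<Rightarrow> complex) \<Rightarrow> 'h set" where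
  "fcalc_dom W D f = {x. (\<lambda>l. (norm (f l *\<^sub>C eigenproj W D l x))\<^sup>2) summable_on UNIV}"

definition fcalc ::
  "'h::complex_hilbert_space set \<Rightarrow> ('h \<Rightarrow> 'h) \<Rightarrow> (real \<Rightarrow> complex) \<Rightarrow> 'h \<Rightarrow> 'h" where
  "fcalc W D f x = (\<Sum>\<^sub>\<infinity>l. f l *\<^sub>C eigenproj W D l x)"

definition absD :: "'h::complex_hilbert_space set \<Rightarrow> ('h \<Rightarrow> 'h) \<Rightarrow> 'h \<Rightarrow> 'h" where
  "absD W D = fcalc W D (\<lambda>l. of_real \<bar>l\<bar>)"

definition absD_dom :: "'h::complex_hilbert_space set \<Rightarrow> ('h \<Rightarrow> 'h) \<Rightarrow> 'h set" where
  "absD_dom W D = fcalc_dom W D (\<lambda>l. of_real \<bar>l\<bar>)"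

text \<open>Complex powers of \<open>|D|\<close>, where \<open>|D|\<close> is replaced by the positive constant \<open>c\<close> on the
  kernel of \<open>D\<close>.\<close>

definition absD_powr ::
  "'h::complex_hilbert_space set \<Rightarrow> ('h \<Rightarrow> 'h) \<Rightarrow> real \<Rightarrow> complex \<Rightarrow> 'h \<Rightarrow> 'h" where
  "absD_powr W D c z = fcalc W D (\<lambda>l. of_real (if l = 0 then c else \<bar>l\<bar>) powr z)"

text \<open>\<open>F\<close> is the sign of \<open>D\<close>. On the kernel of \<open>D\<close> it may be any self-adjoint involution, that
  is, the values \<open>1\<close> and \<open>-1\<close> may be distributed arbitrarily there.\<close>

definition is_sign :: "'h::complex_hilbert_space set \<Rightarrow> ('h \<Rightarrow> 'h) \<Rightarrow> ('h \<Rightarrow> 'h) \<Rightarrow> bool" where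
  "is_sign W D F \<longleftrightarrow> bounded_clinear F \<and> (\<forall>x y. cinner (F x) y = cinner x (F y))
     \<and> (\<forall>x. F (F x) = x) \<and> (\<forall>l. l \<noteq> 0 \<longrightarrow> (\<forall>x\<in>eigenspace W D l. F x = sgn l *\<^sub>R x))"


definition commutator :: "('h::ab_group_add \<Rightarrow> 'h) \<Rightarrow> ('h \<Rightarrow> 'h) \<Rightarrow> 'h \<Rightarrow> 'h" where
  "commutator A T x = A (T x) - T (A x)"

text \<open>For an unbounded operator \<open>A\<close> with domain \<open>W\<close>, the commutator with \<open>T\<close> is bounded if
  \<open>T\<close> preserves \<open>W\<close> and the commutator extends from \<open>W\<close> to a bounded operator; by
  density of \<open>W\<close> the extension is unique.\<close>

definition bounded_comm ::
  "'h::complex_hilbert_space set \<Rightarrow> ('h \<Rightarrow> 'h) \<Rightarrow> ('h \<Rightarrow> 'h) \<Rightarrow> bool" where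
  "bounded_comm W A T \<longleftrightarrow> bounded_clinear T \<and> (\<forall>x\<in>W. T x \<in> W)
     \<and> (\<exists>S. bounded_clinear S \<and> (\<forall>x\<in>W. S x = commutator A T x))"

definition comm_ext ::
  "'h::complex_hilbert_space set \<Rightarrow> ('h \<Rightarrow> 'h) \<Rightarrow> ('h \<Rightarrow> 'h) \<Rightarrow> 'h \<Rightarrow> 'h" where
  "comm_ext W A T = (THE S. bounded_clinear S \<and> (\<forall>x\<in>W. S x = commutator A T x))"

definition \<delta> :: "'h::complex_hilbert_space set \<Rightarrow> ('h \<Rightarrow> 'h) \<Rightarrow> ('h \<Rightarrow> 'h) \<Rightarrow> 'h \<Rightarrow> 'h" where
  "\<delta> W D = comm_ext (absD_dom W D) (absD W D)"

fun Dom_\<delta> ::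
  "'h::complex_hilbert_space set \<Rightarrow> ('h \<Rightarrow> 'h) \<Rightarrow> nat \<Rightarrow> ('h \<Rightarrow> 'h) set" where
  "Dom_\<delta> W D 0 = {T. bounded_clinear T}"
| "Dom_\<delta> W D (Suc k) =
     {T. bounded_comm (absD_dom W D) (absD W D) T \<and> \<delta> W D T \<in> Dom_\<delta> W D k}"

text \<open>An unbounded operator: the formula is meaningful on the vectors to which all the products
  can be applied. Below it is only evaluated on such vectors.\<close>

definition nabla :: "('h::ab_group_add \<Rightarrow> 'h) \<Rightarrow> ('h \<Rightarrow> 'h) \<Rightarrow> 'h \<Rightarrow> 'h" where
  "nabla D T = commutator (D \<circ> D) T"


definition star_representation ::
  "('a::complex_star_algebra \<Rightarrow> 'h::complex_hilbert_space \<Rightarrow> 'h) \<Rightarrow> bool" where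
  "star_representation \<pi> \<longleftrightarrow> (\<forall>a. bounded_clinear (\<pi> a))
     \<and> (\<forall>a b x. \<pi> (a + b) x = \<pi> a x + \<pi> b x) \<and> (\<forall>c a x. \<pi> (c *\<^sub>C a) x = c *\<^sub>C \<pi> a x)
     \<and> (\<forall>a b x. \<pi> (a * b) x = \<pi> a (\<pi> b x)) \<and> (\<forall>x. \<pi> 1 x = x)
     \<and> (\<forall>a x y. cinner (\<pi> (star a) x) y = cinner x (\<pi> a y))"

locale spectral_triple =
  fixes \<pi> :: "'a::complex_star_algebra \<Rightarrow> 'h::complex_hilbert_space \<Rightarrow> 'h"
    and W :: "'h set" and D :: "'h \<Rightarrow> 'h"
  assumes representation: "star_representation \<pi>"
    and self_adjoint: "self_adjoint W D"
    and compact_resolvent: "compact_resolvent W D"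
    and bounded_comm: "bounded_comm W D (\<pi> a)"

definition regular ::
  "('a::complex_star_algebra \<Rightarrow> 'h::complex_hilbert_space \<Rightarrow> 'h) \<Rightarrow> 'h set \<Rightarrow> ('h \<Rightarrow> 'h) \<Rightarrow> bool"
  where
  "regular \<pi> W D \<longleftrightarrow>
     (\<forall>a. \<pi> a \<in> (\<Inter>k. Dom_\<delta> W D k) \<and> comm_ext W D (\<pi> a) \<in> (\<Inter>k. Dom_\<delta> W D k))"

inductive_set alg_B ::
  "('a::complex_star_algebra \<Rightarrow> 'h::complex_hilbert_space \<Rightarrow> 'h) \<Rightarrow> 'h set \<Rightarrow> ('h \<Rightarrow> 'h)
     \<Rightarrow> ('h \<Rightarrow> 'h) \<Rightarrow> ('h \<Rightarrow> 'h) set"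
  for \<pi> W D F where
  "(\<delta> W D ^^ k) (\<pi> a) \<in> alg_B \<pi> W D F"
| "(\<delta> W D ^^ k) (comm_ext W D (\<pi> a)) \<in> alg_B \<pi> W D F"
| "F \<in> alg_B \<pi> W D F"
| "S \<in> alg_B \<pi> W D F \<Longrightarrow> T \<in> alg_B \<pi> W D F \<Longrightarrow> (\<lambda>x. S x + T x) \<in> alg_B \<pi> W D F"
| "S \<in> alg_B \<pi> W D F \<Longrightarrow> (\<lambda>x. c *\<^sub>C S x) \<in> alg_B \<pi> W D F"
| "S \<in> alg_B \<pi> W D F \<Longrightarrow> T \<in> alg_B \<pi> W D F \<Longrightarrow> S \<circ> T \<in> alg_B \<pi> W D F"

definition zeta ::
  "'h::complex_hilbert_space set \<Rightarrow> ('h \<Rightarrow> 'h) \<Rightarrow> real \<Rightarrow> ('h \<Rightarrow> 'h) \<Rightarrow> complex \<Rightarrow> complex" where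
  "zeta W D c b z = op_trace (b \<circ> absD_powr W D c (-z))"

text \<open>\<open>f\<close> is the analytic continuation to the complement of the discrete set \<open>\<Sigma>\<close> of the function
  \<open>zeta W D c b\<close>, which is defined in some right half-plane.\<close>

definition zeta_extension ::
  "'h::complex_hilbert_space set \<Rightarrow> ('h \<Rightarrow> 'h) \<Rightarrow> real \<Rightarrow> ('h \<Rightarrow> 'h) \<Rightarrow> complex set
     \<Rightarrow> (complex \<Rightarrow> complex) \<Rightarrow> bool" where
  "zeta_extension W D c b \<Sigma> f \<longleftrightarrow> f holomorphic_on - \<Sigma>
     \<and> (\<exists>R. \<forall>z. Re z > R \<longrightarrow> trace_class (b \<circ> absD_powr W D c (-z)) \<and> f z = zeta W D c b z)"

text \<open>\<open>\<Sigma>\<close> is the dimension spectrum, and it is discrete and simple. A function that is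
  holomorphic in a punctured neighbourhood of \<open>s\<close> has at most a simple pole at \<open>s\<close> iff
  \<open>(z - s) f(z)\<close> has a limit at \<open>s\<close>, and it has a removable singularity at \<open>s\<close> iff it has
  a limit at \<open>s\<close> itself. By the last conjunct, every point of \<open>\<Sigma>\<close> is a singularity of some
  zeta function.\<close>

definition discrete_simple_dimension_spectrum ::
  "('a::complex_star_algebra \<Rightarrow> 'h::complex_hilbert_space \<Rightarrow> 'h) \<Rightarrow> 'h set \<Rightarrow> ('h \<Rightarrow> 'h)
     \<Rightarrow> ('h \<Rightarrow> 'h) \<Rightarrow> real \<Rightarrow> complex set \<Rightarrow> bool" where
  "discrete_simple_dimension_spectrum \<pi> W D F c \<Sigma> \<longleftrightarrow>
     (\<forall>z. \<not> z islimpt \<Sigma>)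
     \<and> (\<forall>b\<in>alg_B \<pi> W D F. \<exists>f. zeta_extension W D c b \<Sigma> f
          \<and> (\<forall>s\<in>\<Sigma>. \<exists>r. ((\<lambda>z. (z - s) * f z) \<longlongrightarrow> r) (at s)))
     \<and> (\<forall>s\<in>\<Sigma>. \<exists>b\<in>alg_B \<pi> W D F. \<exists>f. zeta_extension W D c b \<Sigma> f
          \<and> \<not> (\<exists>l. (f \<longlongrightarrow> l) (at s)))"


text \<open>The meromorphic continuation to the complex plane of a function given in some right
  half-plane. A nicely meromorphic function has no removable singularities, which
  makes the continuation unique as a total function.\<close>

definition mero_ext :: "(complex \<Rightarrow> complex) \<Rightarrow> complex \<Rightarrow> complex" where
  "mero_ext g =
     (THE f. f nicely_meromorphic_on UNIV \<and> (\<exists>R. \<forall>z. Re z > R \<longrightarrow> f z = g z))"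

definition ncint ::
  "'h::complex_hilbert_space set \<Rightarrow> ('h \<Rightarrow> 'h) \<Rightarrow> real \<Rightarrow> ('h \<Rightarrow> 'h) \<Rightarrow> complex" where
  "ncint W D c P = residue (mero_ext (zeta W D c P)) 0"

definition zeta_value0 ::
  "'h::complex_hilbert_space set \<Rightarrow> ('h \<Rightarrow> 'h) \<Rightarrow> real \<Rightarrow> ('h \<Rightarrow> 'h) \<Rightarrow> complex" where
  "zeta_value0 W D c P = mero_ext (zeta W D c P) 0"


text \<open>An \<open>(m+1)\<close>-linear form is a function on lists \<open>[a\<^sub>0, ..., a\<^sub>m]\<close> of length \<open>m + 1\<close>.\<close>

definition hochschild_b :: "('a::ring_1 list \<Rightarrow> complex) \<Rightarrow> 'a list \<Rightarrow> complex" where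
  "hochschild_b \<psi> as = (let m = length as - 2 in
     (\<Sum>j\<le>m. (-1) ^ j * \<psi> (take j as @ [as ! j * as ! (j + 1)] @ drop (j + 2) as))
     + (-1) ^ (m + 1) * \<psi> ((as ! (m + 1) * as ! 0) # take m (drop 1 as)))"

definition connes_B0 :: "('a::ring_1 list \<Rightarrow> complex) \<Rightarrow> 'a list \<Rightarrow> complex" where
  "connes_B0 \<phi> as = (let m = length as in \<phi> (1 # as) - (-1) ^ m * \<phi> (as @ [1]))"

definition A_cyc :: "('a list \<Rightarrow> complex) \<Rightarrow> 'a list \<Rightarrow> complex" where
  "A_cyc \<psi> as = (let m = length as in \<Sum>j<m. (-1) ^ ((m - 1) * j) * \<psi> (rotate j as))"

definition connes_B :: "('a::ring_1 list \<Rightarrow> complex) \<Rightarrow> 'a list \<Rightarrow> complex" where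
  "connes_B \<phi> = A_cyc (connes_B0 \<phi>)"

definition \<phi>\<^sub>1 ::
  "('a::complex_star_algebra \<Rightarrow> 'h::complex_hilbert_space \<Rightarrow> 'h) \<Rightarrow> 'h set \<Rightarrow> ('h \<Rightarrow> 'h) \<Rightarrow> real
     \<Rightarrow> 'a list \<Rightarrow> complex" where
  "\<phi>\<^sub>1 \<pi> W D c as = (let a0 = \<pi> (as ! 0); da1 = comm_ext W D (\<pi> (as ! 1)) in
     ncint W D c (a0 \<circ> da1 \<circ> absD_powr W D c (-1))
     - 1/4 * ncint W D c (a0 \<circ> nabla D da1 \<circ> absD_powr W D c (-3))
     + 1/8 * ncint W D c (a0 \<circ> nabla D (nabla D da1) \<circ> absD_powr W D c (-5)))"

definition \<phi>\<^sub>3 ::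
  "('a::complex_star_algebra \<Rightarrow> 'h::complex_hilbert_space \<Rightarrow> 'h) \<Rightarrow> 'h set \<Rightarrow> ('h \<Rightarrow> 'h) \<Rightarrow> real
     \<Rightarrow> 'a list \<Rightarrow> complex" where
  "\<phi>\<^sub>3 \<pi> W D c as =
     1/12 * ncint W D c (\<pi> (as ! 0) \<circ> comm_ext W D (\<pi> (as ! 1)) \<circ> comm_ext W D (\<pi> (as ! 2))
       \<circ> comm_ext W D (\<pi> (as ! 3)) \<circ> absD_powr W D c (-3))"

definition \<tau>\<^sub>1 ::
  "('a::complex_star_algebra \<Rightarrow> 'h::complex_hilbert_space \<Rightarrow> 'h) \<Rightarrow> ('h \<Rightarrow> 'h)
     \<Rightarrow> 'a list \<Rightarrow> complex" where
  "\<tau>\<^sub>1 \<pi> F as = op_trace (\<pi> (as ! 0) \<circ> commutator F (\<pi> (as ! 1)))"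

definition \<phi>\<^sub>0 ::
  "('a::complex_star_algebra \<Rightarrow> 'h::complex_hilbert_space \<Rightarrow> 'h) \<Rightarrow> 'h set \<Rightarrow> ('h \<Rightarrow> 'h)
     \<Rightarrow> ('h \<Rightarrow> 'h) \<Rightarrow> real \<Rightarrow> 'a list \<Rightarrow> complex" where
  "\<phi>\<^sub>0 \<pi> W D F c as = zeta_value0 W D c (F \<circ> \<pi> (as ! 0))"

definition \<phi>\<^sub>2 ::
  "('a::complex_star_algebra \<Rightarrow> 'h::complex_hilbert_space \<Rightarrow> 'h) \<Rightarrow> 'h set \<Rightarrow> ('h \<Rightarrow> 'h)
     \<Rightarrow> ('h \<Rightarrow> 'h) \<Rightarrow> real \<Rightarrow> 'a list \<Rightarrow> complex" where
  "\<phi>\<^sub>2 \<pi> W D F c as =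
     1/24 * ncint W D c (\<pi> (as ! 0) \<circ> \<delta> W D (\<pi> (as ! 1)) \<circ> \<delta> W D (\<delta> W D (\<pi> (as ! 2))) \<circ> F
       \<circ> absD_powr W D c (-3))"

end

theory Submission
  imports Defs
begin

text \<open>
  In an orthonormal basis of joint eigenvectors of \<open>D\<close> and \<open>F\<close>, with \<open>|D| e = p\<^sub>e e\<close>, everything
  becomes a statement about matrix elements: \<open>\<delta>\<close> multiplies the entry \<open>(e, f)\<close> by \<open>p\<^sub>e - p\<^sub>f\<close>, and
  \<open>Trace (b |D|\<^sup>-\<^sup>z)\<close> is a Dirichlet series in which only the diagonal of \<open>b\<close> occurs. So the residues
  of the zeta function of \<open>\<delta>(b)\<close> vanish identically, and \<open>\<delta>\<close> can be integrated by parts.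

  The entries of an operator in the domain of all powers of \<open>\<delta>\<close> decay faster than any power of
  \<open>|p\<^sub>e - p\<^sub>f|\<close>. Therefore the binomial expansion of \<open>p\<^sub>e\<^sup>-\<^sup>z\<close> around \<open>p\<^sub>f\<close> can be summed absolutely and
  gives \<open>Trace (X Y |D|\<^sup>-\<^sup>z) = (\<Sum>k<N. (-z gchoose k) Trace (Y \<delta>\<^sup>k(X) |D|\<^sup>-\<^sup>z\<^sup>-\<^sup>k)) + h(z)\<close> with \<open>h\<close>
  holomorphic on \<open>Re z > -1\<close> and \<open>h(0) = 0\<close>. Near \<open>z = 3\<close> only the term \<open>k = 0\<close> can be singular, so
  that the residue at \<open>3\<close> is a trace; at \<open>z = 0\<close> the formula computes \<open>b \<phi>\<^sub>0\<close> by residues.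

  Since \<open>[F, a]\<close> is trace class, the words containing \<open>[F, a]\<close> or \<open>[D, a] - F \<delta>(a) = [F, a] |D|\<close> have
  zero residues. Hence \<open>F\<close> may be commuted and \<open>[D, a]\<close> replaced by \<open>F \<delta>(a)\<close> under the residue, which
  reduces both identities to the Leibniz rule; for instance \<open>\<phi>\<^sub>1 - \<tau>\<^sub>1 - b \<phi>\<^sub>0\<close> is \<open>1/4 - 1/3 = -1/12\<close>
  times the residue of \<open>a\<^sub>0 F \<delta>\<^sup>3(a\<^sub>1) |D|\<^sup>-\<^sup>3\<close>.
\<close>


subsection \<open>Hilbert spaces\<close>

text \<open>Two obstacles shape the proof. First, the powers of \<open>|D|\<close> use the constant
  \<open>c\<close> on the kernel, whereas \<open>\<delta>\<close> and \<open>nabla\<close> see the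
  eigenvalue 0 there. The discrepancy lives on a finite-dimensional space and contributes only
  entire functions, so it never reaches a residue, but it must be carried along; hence the two
  eigenvalue functions \<open>p\<close> and \<open>m\<close>. Second, the trace property is
  available for the residue at 3 only. At 1 and 2, words are changed only by linearity on the
  diagonal, by integration by parts and by dropping words with \<open>[F, a]\<close>. Therefore the
  terms of \<open>\<phi>\<^sub>1\<close> are brought to the very form in which the expansion of a
  value at 0 delivers its terms, with every derivative on the last factor. The numbers:
  \<open>1/k\<close> is left when the simple zero at 0 of the binomial coefficient meets a simple
  pole at \<open>k\<close>. By \<open>[D^2, T] = 2 \<delta>(T) |D| + \<delta>^2(T)\<close> the
  weights 1, -1/4, 1/8 become 1 at the point 1, -2/4 at 2 and -1/4 + 4/8 at 3. The weight 1/24 of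
  \<open>\<phi>\<^sub>2\<close> counts twice, both in \<open>B\<close> and in
  \<open>b\<close>.\<close>

lemma scaleC_zero_left [simp]: "0 *\<^sub>C x = (0::'a::complex_vector)"
  using scaleC_add_left[of 0 0 x] by simp

lemma scaleC_zero_right [simp]: "c *\<^sub>C 0 = (0::'a::complex_vector)"
  using scaleC_add_right[of c 0 0] by simp

lemma scaleC_minus_left: "(- c) *\<^sub>C x = - (c *\<^sub>C (x::'a::complex_vector))"
  using scaleC_add_left[of "-c" c x] by (simp add: eq_neg_iff_add_eq_0)

lemma scaleC_minus_right: "c *\<^sub>C (- x) = - (c *\<^sub>C (x::'a::complex_vector))"
  using scaleC_add_right[of c "-x" x] by (simp add: eq_neg_iff_add_eq_0)

lemma scaleC_diff_right: "c *\<^sub>C (x - y) = c *\<^sub>C x - c *\<^sub>C (y::'a::complex_vector)"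
  using scaleC_add_right[of c x "-y"] by (simp add: scaleC_minus_right)

lemma scaleC_diff_left: "(c - d) *\<^sub>C x = c *\<^sub>C x - d *\<^sub>C (x::'a::complex_vector)"
  using scaleC_add_left[of c "-d" x] by (simp add: scaleC_minus_left)

lemma scaleC_sum_right: "c *\<^sub>C (\<Sum>i\<in>A. f i) = (\<Sum>i\<in>A. c *\<^sub>C (f i :: 'a::complex_vector))"
  by (induction A rule: infinite_finite_induct) (auto simp: scaleC_add_right)

lemma cinner_add_left: "cinner (x + y) (z::'h::complex_hilbert_space) = cinner x z + cinner y z"
  by (metis cinner_add_right cinner_commute complex_cnj_add)

lemma cinner_scaleC_left: "cinner (c *\<^sub>C x) (y::'h::complex_hilbert_space) = cnj c * cinner x y"
  by (metis cinner_commute cinner_scaleC_right complex_cnj_mult)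

lemma cinner_zero_right [simp]: "cinner x (0::'h::complex_hilbert_space) = 0"
  using cinner_add_right[of x 0 0] by simp

lemma cinner_zero_left [simp]: "cinner (0::'h::complex_hilbert_space) x = 0"
  using cinner_add_left[of 0 0 x] by simp

lemma cinner_minus_right: "cinner x (- y) = - cinner x (y::'h::complex_hilbert_space)"
  using cinner_add_right[of x y "-y"] by (simp add: eq_neg_iff_add_eq_0 add.commute)

lemma cinner_minus_left: "cinner (- x) y = - cinner x (y::'h::complex_hilbert_space)"
  using cinner_add_left[of x "-x" y] by (simp add: eq_neg_iff_add_eq_0 add.commute)

lemma cinner_diff_right: "cinner x (y - z) = cinner x y - cinner x (z::'h::complex_hilbert_space)"
  using cinner_add_right[of x y "-z"] by (simp add: cinner_minus_right)

lemma cinner_diff_left: "cinner (x - y) z = cinner x z - cinner y (z::'h::complex_hilbert_space)"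
  using cinner_add_left[of x "-y" z] by (simp add: cinner_minus_left)

lemma cinner_scaleR_right: "cinner x (r *\<^sub>R y) = of_real r * cinner x (y::'h::complex_hilbert_space)"
  by (simp add: scaleR_scaleC cinner_scaleC_right)

lemma cinner_scaleR_left: "cinner (r *\<^sub>R x) y = of_real r * cinner x (y::'h::complex_hilbert_space)"
  by (simp add: scaleR_scaleC cinner_scaleC_left)

lemma cinner_sum_right: "cinner x (\<Sum>i\<in>A. f i) = (\<Sum>i\<in>A. cinner x (f i :: 'h::complex_hilbert_space))"
  by (induction A rule: infinite_finite_induct) (auto simp: cinner_add_right)

lemma cinner_sum_left: "cinner (\<Sum>i\<in>A. f i) x = (\<Sum>i\<in>A. cinner (f i) (x :: 'h::complex_hilbert_space))"
  by (induction A rule: infinite_finite_induct) (auto simp: cinner_add_left)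

lemmas cinner_simps = cinner_add_left cinner_add_right cinner_diff_left cinner_diff_right
  cinner_minus_left cinner_minus_right cinner_scaleC_left cinner_scaleC_right
  cinner_scaleR_left cinner_scaleR_right

lemma Re_cinner_self: "Re (cinner x x) = (norm (x::'h::complex_hilbert_space))\<^sup>2"
  by (simp add: cinner_self)

lemma cinner_eq_0_self: "cinner x x = 0 \<longleftrightarrow> (x::'h::complex_hilbert_space) = 0"
  by (simp add: cinner_self)

lemma norm_scaleC: "norm (c *\<^sub>C x) = cmod c * norm (x::'h::complex_hilbert_space)"
proof -
  have c: "c * cnj c = of_real ((cmod c)\<^sup>2)"
    by (rule complex_norm_square[symmetric])
  have "cinner (c *\<^sub>C x) (c *\<^sub>C x) = (c * cnj c) * cinner x x"
    by (simp only: cinner_scaleC_left cinner_scaleC_right ac_simps)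
  then have "complex_of_real ((norm (c *\<^sub>C x))\<^sup>2) = complex_of_real ((cmod c * norm x)\<^sup>2)"
    by (simp only: c cinner_self of_real_mult[symmetric] power_mult_distrib)
  then have "(norm (c *\<^sub>C x))\<^sup>2 = (cmod c * norm x)\<^sup>2"
    by (simp only: of_real_eq_iff)
  then show ?thesis by simp
qed

lemma norm_add_square:
  "(norm (x + y))\<^sup>2 = (norm x)\<^sup>2 + (norm y)\<^sup>2 + 2 * Re (cinner x (y::'h::complex_hilbert_space))"
proof -
  have "Re (cinner y x) = Re (cinner x y)"
    by (subst cinner_commute) simp
  then show ?thesis
    unfolding Re_cinner_self[symmetric] by (simp add: cinner_simps)
qed

text \<open>Positivity is asked only on the complex line through \<open>y\<close> in direction
  \<open>x\<close>, since one of the forms to which this is applied is positive on a subspace only.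
  The expansion is a hypothesis so that inner products, \<open>\<langle>x, S y\<rangle>\<close> and
  a difference of two such forms are covered alike.\<close>

lemma psd_Cauchy_Schwarz:
  fixes q :: "'v::complex_vector \<Rightarrow> 'v \<Rightarrow> complex"
  assumes expand: "\<And>c. q (y + c *\<^sub>C x) (y + c *\<^sub>C x)
       = q y y + c * cnj (q x y) + cnj c * q x y + cnj c * c * q x x"
    and pos: "\<And>c. 0 \<le> Re (q (y + c *\<^sub>C x) (y + c *\<^sub>C x))"
    and x: "q x x \<in> \<real>" "0 \<le> Re (q x x)"
  shows "(cmod (q x y))\<^sup>2 \<le> Re (q x x) * Re (q y y)"
proof -
  define a where "a = Re (q x x)"
  have qa: "q x x = of_real a" using x(1) by (simp add: a_def of_real_Re)
  have a0: "a \<ge> 0" using x(2) by (simp add: a_def)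
  define n where "n = (cmod (q x y))\<^sup>2"
  have n: "q x y * cnj (q x y) = of_real n" by (simp add: n_def complex_norm_square del: of_real_power)
  \<comment> \<open>The choice \<open>c = r * q x y\<close> makes both cross terms equal to the real
    number \<open>r * n\<close>; what remains is a real quadratic in \<open>r\<close>.\<close>
  have *: "0 \<le> Re (q y y) + 2 * r * n + r\<^sup>2 * n * a" for r :: real
  proof -
    have "q (y + (of_real r * q x y) *\<^sub>C x) (y + (of_real r * q x y) *\<^sub>C x)
        = q y y + of_real r * (q x y * cnj (q x y)) + of_real r * (q x y * cnj (q x y))
          + of_real r * of_real r * (q x y * cnj (q x y)) * q x x"
      by (subst expand) (simp add: algebra_simps)
    also have "\<dots> = q y y + of_real (2 * r * n + r\<^sup>2 * n * a)"
      by (simp add: n qa algebra_simps power2_eq_square)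
    finally show ?thesis
      using pos[of "of_real r * q x y"] by simp
  qed
  show ?thesis
  proof (cases "a = 0")
    case True
    have "n \<le> 0"
    proof (rule ccontr)
      assume "\<not> n \<le> 0"
      then have "n > 0" by simp
      \<comment> \<open>For \<open>a = 0\<close> the quadratic is linear, and this \<open>r\<close>
        gives it the value -1.\<close>
      then show False
        using *[of "- (Re (q y y) + 1) / (2 * n)"] True by (simp add: field_simps)
    qed
    then show ?thesis using True by (simp add: a_def[symmetric] n_def)
  next
    case False
    then have "a > 0" using a0 by simp
    have "0 \<le> Re (q y y) - n / a"
      using *[of "- 1 / a"] \<open>a > 0\<close> by (simp add: power2_eq_square field_simps)
    then show ?thesis
      using \<open>a > 0\<close> by (simp add: a_def[symmetric] n_def[symmetric] field_simps)
  qed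
qed

lemma Cauchy_Schwarz_cinner: "cmod (cinner x y) \<le> norm x * norm (y::'h::complex_hilbert_space)"
proof -
  have c: "cinner y x = cnj (cinner x y)" by (rule cinner_commute)
  have "(cmod (cinner x y))\<^sup>2 \<le> Re (cinner x x) * Re (cinner y y)"
  proof (rule psd_Cauchy_Schwarz[where q = cinner])
    show "cinner (y + d *\<^sub>C x) (y + d *\<^sub>C x)
       = cinner y y + d * cnj (cinner x y) + cnj d * cinner x y + cnj d * d * cinner x x" for d
      unfolding cinner_add_left cinner_add_right cinner_scaleC_left cinner_scaleC_right c
      by (simp add: algebra_simps)
  qed (simp_all add: cinner_self cinner_add_right cinner_scaleC_right)
  then have "(cmod (cinner x y))\<^sup>2 \<le> (norm x * norm y)\<^sup>2"
    by (simp add: Re_cinner_self power_mult_distrib)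
  then show ?thesis
    by (rule power2_le_imp_le) simp
qed

lemma bounded_linear_cinner_right: "bounded_linear (cinner (x::'h::complex_hilbert_space))"
proof (rule bounded_linear_intro[where K = "norm x"])
  show "cmod (cinner x y) \<le> norm y * norm x" for y
    using Cauchy_Schwarz_cinner[of x y] by (simp add: mult.commute)
qed (auto simp: cinner_simps scaleR_conv_of_real)

lemma bounded_linear_scaleC: "bounded_linear ((*\<^sub>C) c :: 'h::complex_hilbert_space \<Rightarrow> 'h)"
proof (rule bounded_linear_intro[where K = "cmod c"])
  show "c *\<^sub>C r *\<^sub>R x = r *\<^sub>R c *\<^sub>C (x::'h)" for r x
    by (simp add: scaleR_scaleC scaleC_scaleC mult.commute)
qed (auto simp: scaleC_add_right norm_scaleC mult.commute)

lemma bounded_clinear_add: "bounded_clinear T \<Longrightarrow> T (x + y) = T x + T y"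
  by (simp add: bounded_clinear_def linear_simps)

lemma bounded_clinear_diff: "bounded_clinear T \<Longrightarrow> T (x - y) = T x - T y"
  by (simp add: bounded_clinear_def linear_simps)

lemma bounded_clinear_zero: "bounded_clinear T \<Longrightarrow> T 0 = 0"
  by (simp add: bounded_clinear_def linear_simps)

lemma bounded_clinear_scaleC: "bounded_clinear T \<Longrightarrow> T (c *\<^sub>C x) = c *\<^sub>C T x"
  by (simp add: bounded_clinear_def)

lemma bounded_clinear_scaleR: "bounded_clinear T \<Longrightarrow> T (r *\<^sub>R x) = r *\<^sub>R T x"
  by (simp add: bounded_clinear_def linear_simps)

lemma bounded_clinear_bound: "bounded_clinear T \<Longrightarrow> norm (T x) \<le> onorm T * norm x"
  by (simp add: bounded_clinear_def onorm)

lemma bounded_clinearI: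
  assumes "\<And>x y. T (x + y) = T x + T y" "\<And>c x. T (c *\<^sub>C x) = c *\<^sub>C T x" "\<And>x. norm (T x) \<le> K * norm x"
  shows "bounded_clinear T"
proof -
  have "T (r *\<^sub>R x) = r *\<^sub>R T x" for r x
    by (simp only: scaleR_scaleC assms(2))
  then have "bounded_linear T"
    using assms by (intro bounded_linear_intro[where K = K]) (simp_all add: mult.commute)
  then show ?thesis
    using assms(2) by (simp add: bounded_clinear_def)
qed

lemma bounded_clinear_id: "bounded_clinear (\<lambda>x. x)"
  by (rule bounded_clinearI[where K = 1]) auto

lemma bounded_clinear_const_0: "bounded_clinear (\<lambda>x. 0)"
  by (rule bounded_clinearI[where K = 1]) auto

lemma bounded_clinear_plus:
  "bounded_clinear S \<Longrightarrow> bounded_clinear T \<Longrightarrow> bounded_clinear (\<lambda>x. S x + T x)"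
  by (simp add: bounded_clinear_def bounded_linear_add scaleC_add_right)

lemma bounded_clinear_minus:
  "bounded_clinear S \<Longrightarrow> bounded_clinear T \<Longrightarrow> bounded_clinear (\<lambda>x. S x - T x)"
  by (simp add: bounded_clinear_def bounded_linear_sub scaleC_diff_right)

lemma bounded_clinear_compose:
  "bounded_clinear S \<Longrightarrow> bounded_clinear T \<Longrightarrow> bounded_clinear (\<lambda>x. S (T x))"
  by (simp add: bounded_clinear_def bounded_linear_compose)

lemma bounded_clinear_cmult: "bounded_clinear T \<Longrightarrow> bounded_clinear (\<lambda>x. c *\<^sub>C T x)"
  by (simp add: bounded_clinear_def bounded_linear_compose[OF bounded_linear_scaleC]
      scaleC_scaleC mult.commute)

section \<open>Orthonormal systems and bases\<close>

definition orthonormal :: "'h::complex_hilbert_space set \<Rightarrow> bool" where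
  "orthonormal E \<longleftrightarrow> (\<forall>e\<in>E. norm e = 1) \<and> (\<forall>e\<in>E. \<forall>f\<in>E. e \<noteq> f \<longrightarrow> cinner e f = 0)"

lemma orthonormal_cinner:
  "orthonormal E \<Longrightarrow> e \<in> E \<Longrightarrow> f \<in> E \<Longrightarrow> cinner e f = (if e = f then 1 else 0)"
  by (auto simp: orthonormal_def cinner_self)

lemma is_onb_iff: "is_onb E \<longleftrightarrow> orthonormal E \<and> (\<forall>x. (\<forall>e\<in>E. cinner e x = 0) \<longrightarrow> x = 0)"
  by (auto simp: is_onb_def orthonormal_def)

lemma is_onb_orthonormal: "is_onb E \<Longrightarrow> orthonormal E"
  by (simp add: is_onb_iff)

lemma onb_eqI:
  assumes "is_onb E" "\<And>e. e \<in> E \<Longrightarrow> cinner e x = cinner e y"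
  shows "x = y"
proof -
  have "x - y = 0"
    using assms unfolding is_onb_iff by (metis cinner_diff_right right_minus_eq)
  then show ?thesis by simp
qed

lemma norm_sum_orthogonal:
  fixes v :: "'i \<Rightarrow> 'h::complex_hilbert_space"
  assumes "finite A" "\<And>i j. i \<in> A \<Longrightarrow> j \<in> A \<Longrightarrow> i \<noteq> j \<Longrightarrow> cinner (v i) (v j) = 0"
  shows "(norm (\<Sum>i\<in>A. v i))\<^sup>2 = (\<Sum>i\<in>A. (norm (v i))\<^sup>2)"
  using assms
proof (induction A rule: finite_induct)
  case (insert a A)
  have "cinner (v a) (\<Sum>i\<in>A. v i) = 0"
    unfolding cinner_sum_right using insert by (intro sum.neutral) auto
  then show ?case
    using insert by (simp add: norm_add_square)
qed simp

text \<open>By Pythagoras the squared distance of two nested partial sums is a partial sum of the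
  numerical series, so the Cauchy criterion passes over. The vectors are not normalised because
  spectral projections of one vector are summed this way too.\<close>

lemma orthogonal_summable_on:
  fixes v :: "'i \<Rightarrow> 'h::complex_hilbert_space"
  assumes orth: "\<And>i j. i \<in> I \<Longrightarrow> j \<in> I \<Longrightarrow> i \<noteq> j \<Longrightarrow> cinner (v i) (v j) = 0"
    and sm: "(\<lambda>i. (norm (v i))\<^sup>2) summable_on I"
  shows "v summable_on I"
proof -
  let ?F = "filtermap (sum v) (finite_subsets_at_top I)"
  let ?n = "\<lambda>i. (norm (v i))\<^sup>2"
  have "cauchy_filter ?F"
    unfolding cauchy_filter_metric_filtermap
  proof (intro allI impI)
    fix \<epsilon> :: real assume "\<epsilon> > 0"
    from sm obtain S where S: "(?n has_sum S) I" by (auto simp: summable_on_def)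
    have "\<epsilon>\<^sup>2 / 8 > 0" using \<open>\<epsilon> > 0\<close> by simp
    then obtain F0 where F0: "finite F0" "F0 \<subseteq> I"
      and F0': "\<And>X. finite X \<Longrightarrow> F0 \<subseteq> X \<Longrightarrow> X \<subseteq> I \<Longrightarrow> dist (sum ?n X) S < \<epsilon>\<^sup>2 / 8"
      using S unfolding has_sum_def tendsto_iff eventually_finite_subsets_at_top by metis
    have near: "dist (sum v X) (sum v F0) < \<epsilon> / 2" if X: "finite X" "F0 \<subseteq> X" "X \<subseteq> I" for X
    proof -
      have "sum ?n X = sum ?n F0 + sum ?n (X - F0)"
        using X F0 by (simp add: sum.subset_diff)
      then have *: "sum ?n (X - F0) < \<epsilon>\<^sup>2 / 4"
        using F0'[OF X] F0'[OF F0(1) order.refl F0(2)] by (simp add: dist_real_def abs_if split: if_splits)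
      have "sum v X - sum v F0 = sum v (X - F0)"
        using X F0 by (simp add: sum_diff)
      then have "(dist (sum v X) (sum v F0))\<^sup>2 = sum ?n (X - F0)"
        unfolding dist_norm using X by (simp, subst norm_sum_orthogonal) (auto intro: orth)
      then have "(dist (sum v X) (sum v F0))\<^sup>2 < (\<epsilon> / 2)\<^sup>2"
        using * by (simp add: power_divide)
      then show ?thesis
        by (rule power2_less_imp_less) (use \<open>\<epsilon> > 0\<close> in simp)
    qed
    let ?P = "\<lambda>X. finite X \<and> F0 \<subseteq> X \<and> X \<subseteq> I"
    have "eventually ?P (finite_subsets_at_top I)"
      unfolding eventually_finite_subsets_at_top using F0 by blast
    moreover have "dist (sum v X) (sum v Y) < \<epsilon>" if "?P X" "?P Y" for X Y
      using near[of X] near[of Y] that dist_triangle_half_l by blast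
    ultimately show "\<exists>P. eventually P (finite_subsets_at_top I) \<and>
        (\<forall>x y. P x \<and> P y \<longrightarrow> dist (sum v x) (sum v y) < \<epsilon>)"
      by (intro exI[of _ ?P] conjI allI impI) auto
  qed
  then have "convergent_filter ?F"
    by (simp add: convergent_filter_iff_cauchy)
  then show ?thesis
    by (auto simp: convergent_filter_iff summable_on_def has_sum_def filterlim_def)
qed

lemma Bessel:
  assumes "orthonormal E"
  shows "(\<lambda>e. (cmod (cinner e x))\<^sup>2) summable_on E"
    and "finite A \<Longrightarrow> A \<subseteq> E \<Longrightarrow> (\<Sum>e\<in>A. (cmod (cinner e x))\<^sup>2) \<le> (norm x)\<^sup>2"
proof -
  have *: "(\<Sum>e\<in>A. (cmod (cinner e x))\<^sup>2) \<le> (norm x)\<^sup>2" if A: "finite A" "A \<subseteq> E" for A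
  proof -
    define p where "p = (\<Sum>e\<in>A. cinner e x *\<^sub>C e)"
    have n: "(norm p)\<^sup>2 = (\<Sum>e\<in>A. (cmod (cinner e x))\<^sup>2)"
      unfolding p_def
    proof (subst norm_sum_orthogonal)
      show "(\<Sum>i\<in>A. (norm (cinner i x *\<^sub>C i))\<^sup>2) = (\<Sum>e\<in>A. (cmod (cinner e x))\<^sup>2)"
        using A assms by (intro sum.cong) (auto simp: norm_scaleC orthonormal_def)
    qed (use A assms in \<open>auto simp: cinner_simps orthonormal_def subset_iff\<close>)
    have "cinner p x = (\<Sum>e\<in>A. of_real ((cmod (cinner e x))\<^sup>2))"
      unfolding p_def cinner_sum_left
      by (intro sum.cong refl) (simp add: cinner_simps complex_norm_square mult.commute del: of_real_power)
    then have px: "cinner p x = of_real ((norm p)\<^sup>2)"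
      by (simp add: n)
    have "cinner p (x - p) = 0" by (simp add: cinner_simps px cinner_self)
    then have "(norm (p + (x - p)))\<^sup>2 = (norm p)\<^sup>2 + (norm (x - p))\<^sup>2"
      by (simp only: norm_add_square) simp
    then show ?thesis by (simp add: n[symmetric])
  qed
  show "finite A \<Longrightarrow> A \<subseteq> E \<Longrightarrow> (\<Sum>e\<in>A. (cmod (cinner e x))\<^sup>2) \<le> (norm x)\<^sup>2" by fact
  show "(\<lambda>e. (cmod (cinner e x))\<^sup>2) summable_on E"
    by (rule nonneg_bdd_above_summable_on) (auto intro!: bdd_aboveI2[where M = "(norm x)\<^sup>2"] *)
qed

text \<open>Riesz-Fischer. The last part records what is orthogonal to the sum, as the lemma is also
  applied to incomplete systems such as a part of an eigenbasis.\<close>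

lemma l2_vector_exists:
  assumes E: "orthonormal E" and g: "(\<lambda>e. (cmod (g e))\<^sup>2) summable_on E"
  shows "(\<lambda>e. g e *\<^sub>C e) summable_on E"
    and "f \<in> E \<Longrightarrow> cinner f (\<Sum>\<^sub>\<infinity>e\<in>E. g e *\<^sub>C e) = g f"
    and "(\<And>e. e \<in> E \<Longrightarrow> cinner y e = 0) \<Longrightarrow> cinner y (\<Sum>\<^sub>\<infinity>e\<in>E. g e *\<^sub>C e) = 0"
proof -
  show s: "(\<lambda>e. g e *\<^sub>C e) summable_on E"
  proof (rule orthogonal_summable_on)
    show "(\<lambda>e. (norm (g e *\<^sub>C e))\<^sup>2) summable_on E"
      using g by (rule summable_on_cong[THEN iffD1, rotated])
        (use E in \<open>auto simp: norm_scaleC orthonormal_def\<close>)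
  qed (use E in \<open>auto simp: cinner_simps orthonormal_def\<close>)
  have h: "((\<lambda>e. cinner y (g e *\<^sub>C e)) has_sum cinner y (\<Sum>\<^sub>\<infinity>e\<in>E. g e *\<^sub>C e)) E" for y
    by (rule has_sum_bounded_linear[OF bounded_linear_cinner_right has_sum_infsum[OF s]])
  show "cinner f (\<Sum>\<^sub>\<infinity>e\<in>E. g e *\<^sub>C e) = g f" if "f \<in> E"
  proof (rule has_sum_unique[OF h])
    show "((\<lambda>e. cinner f (g e *\<^sub>C e)) has_sum g f) E"
      by (rule has_sum_finite_neutralI[where B = "{f}"])
        (use that E in \<open>auto simp: cinner_simps orthonormal_cinner\<close>)
  qed
  show "cinner y (\<Sum>\<^sub>\<infinity>e\<in>E. g e *\<^sub>C e) = 0" if "\<And>e. e \<in> E \<Longrightarrow> cinner y e = 0"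
  proof (rule has_sum_unique[OF h])
    show "((\<lambda>e. cinner y (g e *\<^sub>C e)) has_sum 0) E"
      by (rule has_sum_0) (use that in \<open>auto simp: cinner_simps\<close>)
  qed
qed

lemma onb_expansion:
  assumes "is_onb E"
  shows "((\<lambda>e. cinner e x *\<^sub>C e) has_sum x) E"
proof -
  note on = is_onb_orthonormal[OF assms]
  have "(\<Sum>\<^sub>\<infinity>e\<in>E. cinner e x *\<^sub>C e) = x"
    by (rule onb_eqI[OF assms]) (rule l2_vector_exists(2)[OF on Bessel(1)[OF on]])
  then show ?thesis
    using l2_vector_exists(1)[OF on Bessel(1)[OF on]] has_sum_infsum by metis
qed

lemma onb_expansion_map:
  fixes T :: "'h::complex_hilbert_space \<Rightarrow> 'h"
  assumes "is_onb E" "bounded_clinear T"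
  shows "((\<lambda>e. cinner e x *\<^sub>C T e) has_sum T x) E"
proof -
  have T: "bounded_linear T" "T (c *\<^sub>C y) = c *\<^sub>C T y" for c y
    using assms(2) by (simp_all add: bounded_clinear_def)
  show ?thesis
    using has_sum_bounded_linear[OF T(1) onb_expansion[OF assms(1), of x]] by (simp only: T(2))
qed

text \<open>With \<open>x\<close> replaced by \<open>T x\<close> this is multiplication of matrices,
  the bridge between operator products and sums over a basis.\<close>

lemma onb_matrix_product:
  fixes S :: "'h::complex_hilbert_space \<Rightarrow> 'h"
  assumes "is_onb E" "bounded_clinear S"
  shows "((\<lambda>e. cinner u (S e) * cinner e x) has_sum cinner u (S x)) E"
  using has_sum_bounded_linear[OF bounded_linear_cinner_right onb_expansion_map[OF assms, of x], of u]
  by (simp only: cinner_scaleC_right mult.commute)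

lemma onb_parseval: "is_onb E \<Longrightarrow> ((\<lambda>e. cinner u e * cinner e x) has_sum cinner u x) E"
  using onb_matrix_product[OF _ bounded_clinear_id] by blast

lemma onb_parseval_norm:
  assumes "is_onb E"
  shows "((\<lambda>e. (cmod (cinner e x))\<^sup>2) has_sum (norm x)\<^sup>2) E"
proof -
  have "((\<lambda>e. complex_of_real ((cmod (cinner e x))\<^sup>2)) has_sum complex_of_real ((norm x)\<^sup>2)) E"
    using onb_parseval[OF assms, of x x]
    unfolding cinner_self complex_norm_square
    by (simp only: cinner_commute[of _ x] complex_cnj_cnj mult.commute)
  then show ?thesis
    by (simp only: has_sum_of_real_iff)
qed

lemma onb_operator_eqI:
  assumes "is_onb E" "bounded_clinear S" "bounded_clinear T"
    and "\<And>e f. e \<in> E \<Longrightarrow> f \<in> E \<Longrightarrow> cinner e (S f) = cinner e (T f)"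
  shows "S = T"
proof (rule ext, rule has_sum_unique)
  show "((\<lambda>e. cinner e x *\<^sub>C S e) has_sum S x) E" for x
    by (intro onb_expansion_map assms)
  have "((\<lambda>e. cinner e x *\<^sub>C T e) has_sum T x) E" for x
    by (intro onb_expansion_map assms)
  moreover have "S f = T f" if "f \<in> E" for f
    using that assms by (intro onb_eqI[OF assms(1)]) auto
  ultimately show "((\<lambda>e. cinner e x *\<^sub>C S e) has_sum T x) E" for x
    by (simp cong: has_sum_cong)
qed

text \<open>Zorn's lemma inside a prescribed set of unit vectors. Maximality relative to
  \<open>J\<close> allows the basis vectors to be joint eigenvectors; that such a system is complete
  is a separate argument.\<close>

lemma maximal_orthonormal_subset:
  fixes J :: "'h::complex_hilbert_space set"
  assumes J: "\<And>v. v \<in> J \<Longrightarrow> norm v = 1"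
  obtains A where "A \<subseteq> J" "orthonormal A" "\<And>v. v \<in> J \<Longrightarrow> \<exists>a\<in>A. cinner a v \<noteq> 0"
proof -
  let ?S = "{A. A \<subseteq> J \<and> orthonormal A}"
  have "\<exists>M\<in>?S. \<forall>X\<in>?S. M \<subseteq> X \<longrightarrow> X = M"
  proof (rule subset_Zorn')
    fix C assume C: "subset.chain ?S C"
    have sub: "C \<subseteq> ?S" using C by (auto simp: subset.chain_def)
    have "orthonormal (\<Union>C)"
      unfolding orthonormal_def
    proof (intro conjI ballI impI)
      fix e f assume "e \<in> \<Union>C" "f \<in> \<Union>C" "e \<noteq> f"
      then obtain X Y where XY: "X \<in> C" "Y \<in> C" "e \<in> X" "f \<in> Y" by blast
      with C consider "X \<subseteq> Y" | "Y \<subseteq> X" unfolding subset.chain_def by blast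
      then obtain Z where "Z \<in> C" "e \<in> Z" "f \<in> Z"
        using XY by cases auto
      then have "orthonormal Z" "e \<in> Z" "f \<in> Z" using sub by auto
      then show "cinner e f = 0"
        using \<open>e \<noteq> f\<close> by (simp add: orthonormal_def)
    qed (use sub in \<open>auto simp: orthonormal_def\<close>)
    then show "\<Union>C \<in> ?S" using sub by blast
  qed
  then obtain A where A: "A \<subseteq> J" "orthonormal A"
    and max: "\<And>X. X \<subseteq> J \<Longrightarrow> orthonormal X \<Longrightarrow> A \<subseteq> X \<Longrightarrow> X = A"
    by auto
  have "\<exists>a\<in>A. cinner a v \<noteq> 0" if v: "v \<in> J" for v
  proof (rule ccontr)
    assume "\<not> ?thesis"
    then have 0: "cinner a v = 0" "cinner v a = 0" if "a \<in> A" for a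
      using that by (auto simp: cinner_commute[of v a])
    have "v \<notin> A"
      using 0(1)[of v] J[OF v] by (auto simp: cinner_self)
    moreover have "insert v A = A"
      using A v 0 J[OF v] by (intro max) (auto simp: orthonormal_def)
    ultimately show False by blast
  qed
  with A show ?thesis using that by blast
qed

subsection \<open>Diagonalisation of a self-adjoint operator with compact resolvent\<close>

lemma self_adjoint_graph:
  "self_adjoint W D \<Longrightarrow> (\<forall>x\<in>W. cinner (D x) y = cinner x w) \<longleftrightarrow> y \<in> W \<and> w = D y"
  unfolding self_adjoint_def by (elim conjE) (erule allE, erule allE)

lemma self_adjoint_symmetric:
  "self_adjoint W D \<Longrightarrow> x \<in> W \<Longrightarrow> y \<in> W \<Longrightarrow> cinner (D x) y = cinner x (D y)"
  using self_adjoint_graph[of W D y "D y"] by simp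

lemma self_adjoint_memI:
  assumes "self_adjoint W D" "\<And>x. x \<in> W \<Longrightarrow> cinner (D x) y = cinner x w"
  shows "y \<in> W" "D y = w"
  using self_adjoint_graph[OF assms(1), of y w] assms(2) by simp_all

lemma self_adjoint_add:
  "self_adjoint W D \<Longrightarrow> x \<in> W \<Longrightarrow> y \<in> W \<Longrightarrow> x + y \<in> W \<and> D (x + y) = D x + D y"
  by (simp add: self_adjoint_def)

lemma self_adjoint_scaleC:
  "self_adjoint W D \<Longrightarrow> x \<in> W \<Longrightarrow> a *\<^sub>C x \<in> W \<and> D (a *\<^sub>C x) = a *\<^sub>C D x"
  by (simp add: self_adjoint_def)

lemma self_adjoint_zero: "self_adjoint W D \<Longrightarrow> 0 \<in> W \<and> D 0 = 0"
  using self_adjoint_scaleC[of W D 0 0] by (simp add: self_adjoint_def)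

lemma self_adjoint_diff:
  "self_adjoint W D \<Longrightarrow> x \<in> W \<Longrightarrow> y \<in> W \<Longrightarrow> x - y \<in> W \<and> D (x - y) = D x - D y"
  using self_adjoint_add[of W D x "(-1) *\<^sub>C y"] self_adjoint_scaleC[of W D y "-1"]
  by (simp add: scaleC_minus_left scaleC_one)

lemma self_adjoint_scaleR:
  "self_adjoint W D \<Longrightarrow> x \<in> W \<Longrightarrow> r *\<^sub>R x \<in> W \<and> D (r *\<^sub>R x) = r *\<^sub>R D x"
  by (simp add: self_adjoint_scaleC scaleR_scaleC)

lemma eigenspace_diff:
  "self_adjoint W D \<Longrightarrow> x \<in> eigenspace W D l \<Longrightarrow> y \<in> eigenspace W D l \<Longrightarrow> x - y \<in> eigenspace W D l"
  by (simp add: eigenspace_def self_adjoint_diff scaleR_right_diff_distrib)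

lemma eigenspace_scaleR:
  "self_adjoint W D \<Longrightarrow> x \<in> eigenspace W D l \<Longrightarrow> r *\<^sub>R x \<in> eigenspace W D l"
  by (simp add: eigenspace_def self_adjoint_scaleR)

lemma eigenspaces_orthogonal:
  assumes "self_adjoint W D" "x \<in> eigenspace W D l" "y \<in> eigenspace W D k" "l \<noteq> k"
  shows "cinner x y = 0"
proof -
  have "cinner (D x) y = cinner x (D y)"
    using assms by (intro self_adjoint_symmetric) (auto simp: eigenspace_def)
  then have "of_real l * cinner x y = of_real k * cinner x y"
    using assms by (simp add: eigenspace_def cinner_simps)
  then show ?thesis using assms by simp
qed

text \<open>The conclusion is the stationarity condition for a maximiser of the norm of
  \<open>R x\<close> on the unit ball of \<open>M\<close>, in weak form, so that the adjoint of
  \<open>R\<close> is never formed. Compactness makes only the images of a maximising sequence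
  converge; the sequence itself needs an argument of its own.\<close>

lemma compact_attains_norm:
  fixes R :: "'h::complex_hilbert_space \<Rightarrow> 'h"
  assumes R: "compact_op R"
    and M: "\<And>x y. x \<in> M \<Longrightarrow> y \<in> M \<Longrightarrow> x + y \<in> M" "\<And>x c. x \<in> M \<Longrightarrow> c *\<^sub>C x \<in> M" "closed M"
    and x0: "x0 \<in> M" "R x0 \<noteq> 0"
  obtains v r where "v \<in> M" "r > 0" "v \<noteq> 0"
    "\<And>u. u \<in> M \<Longrightarrow> cinner (R v) (R u) = of_real (r\<^sup>2) * cinner v u"
proof -
  have bR: "bounded_clinear R" and cR: "compact (closure (R ` cball 0 1))"
    using R by (auto simp: compact_op_def)
  have Rtend: "(f \<longlongrightarrow> l) G \<Longrightarrow> ((\<lambda>n. R (f n)) \<longlongrightarrow> R l) G" for f l and G :: "nat filter"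
    using bR by (auto simp: bounded_clinear_def intro: bounded_linear.tendsto)
  have M_scaleR: "a *\<^sub>R x \<in> M" if "x \<in> M" for a x
    using M(2) that by (simp add: scaleR_scaleC)
  have M_diff: "x - y \<in> M" if "x \<in> M" "y \<in> M" for x y
    using M(1)[OF that(1) M(2)[OF that(2), of "-1"]] by (simp add: scaleC_minus_left scaleC_one)
  define U where "U = {x \<in> M. norm x \<le> 1}"
  define r where "r = (SUP x\<in>U. norm (R x))"
  have "norm (R x) \<le> onorm R" if "x \<in> U" for x
  proof -
    have "norm (R x) \<le> onorm R * norm x" using bR by (rule bounded_clinear_bound)
    also have "\<dots> \<le> onorm R * 1"
      using that bR by (intro mult_left_mono) (auto simp: U_def bounded_clinear_def onorm_pos_le)
    finally show ?thesis by simp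
  qed
  then have bdd: "bdd_above ((\<lambda>x. norm (R x)) ` U)"
    by (intro bdd_aboveI2)
  have ub: "norm (R x) \<le> r" if "x \<in> U" for x
    unfolding r_def using that by (intro cSUP_upper bdd)
  have x0': "x0 \<noteq> 0" using x0 bounded_clinear_zero[OF bR] by auto
  have "(1 / norm x0) *\<^sub>R x0 \<in> U" using x0 x0' by (simp add: U_def M_scaleR)
  from ub[OF this] have "norm (R x0) / norm x0 \<le> r"
    by (simp add: bounded_clinear_scaleR[OF bR])
  moreover have "norm (R x0) / norm x0 > 0" using x0 x0' by simp
  ultimately have r0: "r > 0" by linarith
  have Rr: "norm (R x) \<le> r * norm x" if "x \<in> M" for x
  proof (cases "x = 0")
    case True then show ?thesis using bounded_clinear_zero[OF bR] by simp
  next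
    case False
    then have "(1 / norm x) *\<^sub>R x \<in> U" using that by (simp add: U_def M_scaleR)
    from ub[OF this] False show ?thesis
      by (simp add: bounded_clinear_scaleR[OF bR] field_simps)
  qed
  \<comment> \<open>\<open>q\<close> measures the distance from being a maximiser: it is nonnegative
    on \<open>M\<close> and tends to 0 along a maximising sequence.\<close>
  define q where "q x = r\<^sup>2 * (norm x)\<^sup>2 - (norm (R x))\<^sup>2" for x
  have q0: "q x \<ge> 0" if "x \<in> M" for x
    using power_mono[OF Rr[OF that], of 2] by (simp add: q_def power_mult_distrib)
  have "\<exists>x\<in>U. norm (R x) > r - 1 / real (Suc n)" for n
  proof (rule ccontr)
    assume "\<not> ?thesis"
    then have "norm (R x) \<le> r - 1 / real (Suc n)" if "x \<in> U" for x using that by force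
    moreover have "U \<noteq> {}" using \<open>(1 / norm x0) *\<^sub>R x0 \<in> U\<close> by blast
    ultimately have "r \<le> r - 1 / real (Suc n)"
      unfolding r_def by (intro cSUP_least) auto
    then show False by (simp add: field_simps)
  qed
  then obtain X where X: "\<And>n. X n \<in> U" "\<And>n. norm (R (X n)) > r - 1 / real (Suc n)" by metis
  have "\<forall>n. (R \<circ> X) n \<in> closure (R ` cball 0 1)"
    using X(1) closure_subset[of "R ` cball 0 1"] by (auto simp: U_def)
  with cR obtain y \<sigma> where \<sigma>: "strict_mono \<sigma>" and y: "(R \<circ> X \<circ> \<sigma>) \<longlonglongrightarrow> y"
    unfolding compact_def by metis
  define Y where "Y n = X (\<sigma> n)" for n
  have YU: "Y n \<in> U" for n using X(1) by (simp add: Y_def)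
  have YM: "Y n \<in> M" for n using YU by (simp add: U_def)
  have RY: "(\<lambda>n. R (Y n)) \<longlonglongrightarrow> y" using y by (simp add: Y_def comp_def)
  have low: "r - 1 / real (Suc n) \<le> norm (R (Y n))" for n
  proof -
    have "1 / real (Suc (\<sigma> n)) \<le> 1 / real (Suc n)"
      using strict_mono_imp_increasing[OF \<sigma>, of n] by (simp add: field_simps)
    then show ?thesis using X(2)[of "\<sigma> n"] by (simp add: Y_def)
  qed
  have nRY: "(\<lambda>n. norm (R (Y n))) \<longlonglongrightarrow> r"
  proof (rule tendsto_sandwich)
    show "(\<lambda>n. r - 1 / real (Suc n)) \<longlonglongrightarrow> r"
      using tendsto_diff[OF tendsto_const LIMSEQ_inverse_real_of_nat, of r] by (simp add: inverse_eq_divide)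
    show "(\<lambda>n. r) \<longlonglongrightarrow> r" by simp
  qed (use low ub YU in auto)
  have qY: "(\<lambda>n. q (Y n)) \<longlonglongrightarrow> 0"
  proof (rule tendsto_sandwich)
    show "(\<lambda>n. 0) \<longlonglongrightarrow> (0::real)" by simp
    show "(\<lambda>n. r\<^sup>2 - (norm (R (Y n)))\<^sup>2) \<longlonglongrightarrow> 0"
      using tendsto_diff[OF tendsto_const tendsto_power[OF nRY, of 2], of "r\<^sup>2"] by simp
    have "q (Y n) \<le> r\<^sup>2 - (norm (R (Y n)))\<^sup>2" for n
    proof -
      have "(norm (Y n))\<^sup>2 \<le> 1" using YU[of n] by (simp add: U_def power_le_one)
      then have "r\<^sup>2 * (norm (Y n))\<^sup>2 \<le> r\<^sup>2" by (simp add: mult_left_le)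
      then show ?thesis by (simp add: q_def)
    qed
    then show "\<forall>\<^sub>F n in sequentially. q (Y n) \<le> r\<^sup>2 - (norm (R (Y n)))\<^sup>2" by simp
  qed (use q0 YM in auto)
  \<comment> \<open>The parallelogram law for \<open>q\<close> makes the maximising sequence a Cauchy sequence.\<close>
  have par: "r\<^sup>2 * (dist (Y m) (Y n))\<^sup>2 \<le> 2 * q (Y m) + 2 * q (Y n) + (dist (R (Y m)) (R (Y n)))\<^sup>2" for m n
  proof -
    have p: "(norm (a + b))\<^sup>2 + (norm (a - b))\<^sup>2 = 2 * (norm a)\<^sup>2 + 2 * (norm b)\<^sup>2" for a b :: 'h
      using norm_add_square[of a b] norm_add_square[of a "-b"] by (simp add: cinner_minus_right)
    have "q (Y m + Y n) + q (Y m - Y n)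
       = r\<^sup>2 * ((norm (Y m + Y n))\<^sup>2 + (norm (Y m - Y n))\<^sup>2)
         - ((norm (R (Y m) + R (Y n)))\<^sup>2 + (norm (R (Y m) - R (Y n)))\<^sup>2)"
      by (simp add: q_def bounded_clinear_add[OF bR] bounded_clinear_diff[OF bR] algebra_simps)
    also have "\<dots> = 2 * q (Y m) + 2 * q (Y n)"
      unfolding p by (simp add: q_def algebra_simps)
    finally have "q (Y m - Y n) \<le> 2 * q (Y m) + 2 * q (Y n)"
      using q0[OF M(1)[OF YM[of m] YM[of n]]] by linarith
    then show ?thesis
      by (simp add: q_def dist_norm bounded_clinear_diff[OF bR])
  qed
  have "Cauchy Y"
  proof (rule metric_CauchyI)
    fix \<epsilon> :: real assume "\<epsilon> > 0"
    \<comment> \<open>The estimate \<open>par\<close> bounds \<open>r^2\<close> times the squared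
      distance by \<open>2\<eta> + 2\<eta> + \<eta>\<close>.\<close>
    define \<eta> where "\<eta> = (r * \<epsilon>)\<^sup>2 / 5"
    have "\<eta> > 0" using \<open>\<epsilon> > 0\<close> r0 by (simp add: \<eta>_def)
    have "\<forall>\<^sub>F n in sequentially. q (Y n) < \<eta>"
      using order_tendstoD(2)[OF qY \<open>\<eta> > 0\<close>] .
    then obtain N1 where N1: "\<And>n. n \<ge> N1 \<Longrightarrow> q (Y n) < \<eta>"
      by (auto simp: eventually_sequentially)
    have "Cauchy (\<lambda>n. R (Y n))" using RY by (auto intro: LIMSEQ_imp_Cauchy)
    then obtain N2 where N2: "\<And>m n. m \<ge> N2 \<Longrightarrow> n \<ge> N2 \<Longrightarrow> dist (R (Y m)) (R (Y n)) < sqrt \<eta>"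
      using metric_CauchyD[of _ "sqrt \<eta>"] \<open>\<eta> > 0\<close> by (metis real_sqrt_gt_zero)
    have "dist (Y m) (Y n) < \<epsilon>" if "m \<ge> max N1 N2" "n \<ge> max N1 N2" for m n
    proof -
      have "(dist (R (Y m)) (R (Y n)))\<^sup>2 < \<eta>"
        using power_strict_mono[OF N2[of m n], of 2] that \<open>\<eta> > 0\<close> by simp
      then have "r\<^sup>2 * (dist (Y m) (Y n))\<^sup>2 < 5 * \<eta>"
        using par[of m n] N1[of m] N1[of n] that by simp
      then have "(r * dist (Y m) (Y n))\<^sup>2 < (r * \<epsilon>)\<^sup>2"
        by (simp add: \<eta>_def power_mult_distrib)
      then have "r * dist (Y m) (Y n) < r * \<epsilon>"
        by (rule power2_less_imp_less) (use r0 \<open>\<epsilon> > 0\<close> in simp)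
      then show ?thesis using r0 by simp
    qed
    then show "\<exists>N. \<forall>m\<ge>N. \<forall>n\<ge>N. dist (Y m) (Y n) < \<epsilon>" by blast
  qed
  then obtain v where v: "Y \<longlonglongrightarrow> v"
    using Cauchy_convergent_iff convergent_def by blast
  have vM: "v \<in> M"
    using M(3) YM v by (rule closed_sequentially)
  have "norm v \<le> 1"
    by (rule LIMSEQ_le_const2[OF tendsto_norm[OF v]]) (use YU in \<open>auto simp: U_def\<close>)
  have Rv: "norm (R v) = r"
    using LIMSEQ_unique[OF tendsto_norm[OF Rtend[OF v]] nRY] .
  have "q v \<le> 0"
  proof -
    have "(norm v)\<^sup>2 \<le> 1" using \<open>norm v \<le> 1\<close> by (simp add: power_le_one)
    then show ?thesis by (simp add: q_def Rv mult_left_le)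
  qed
  then have qv: "q v = 0" using q0[OF vM] by simp
  \<comment> \<open>\<open>b\<close> is the sesquilinear form of \<open>q\<close>. Since
    \<open>q v = 0\<close>, Cauchy-Schwarz puts \<open>v\<close> into its null space, and that is
    the claim.\<close>
  define b where "b x u = of_real (r\<^sup>2) * cinner x u - cinner (R x) (R u)" for x u
  have bb: "b x x = of_real (q x)" for x
    by (simp add: b_def q_def cinner_self)
  have "cinner (R v) (R u) = of_real (r\<^sup>2) * cinner v u" if u: "u \<in> M" for u
  proof -
    have "(cmod (b v u))\<^sup>2 \<le> Re (b v v) * Re (b u u)"
    proof (rule psd_Cauchy_Schwarz[where q = b])
      fix d
      have c: "cinner u v = cnj (cinner v u)" "cinner (R u) (R v) = cnj (cinner (R v) (R u))"
        by (rule cinner_commute)+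
      show "b (u + d *\<^sub>C v) (u + d *\<^sub>C v) = b u u + d * cnj (b v u) + cnj d * b v u + cnj d * d * b v v"
        unfolding b_def bounded_clinear_add[OF bR] bounded_clinear_scaleC[OF bR]
          cinner_add_left cinner_add_right cinner_scaleC_left cinner_scaleC_right c
        by (simp add: algebra_simps)
      show "0 \<le> Re (b (u + d *\<^sub>C v) (u + d *\<^sub>C v))"
        using q0[OF M(1)[OF u M(2)[OF vM]]] by (simp add: bb)
    qed (use q0[OF vM] in \<open>auto simp: bb\<close>)
    then have "b v u = 0" by (simp add: bb qv)
    then show ?thesis by (simp add: b_def)
  qed
  moreover have "v \<noteq> 0" using Rv r0 bounded_clinear_zero[OF bR] by auto
  ultimately show ?thesis using that[of v r] vM r0 by blast
qed

text \<open>A maximiser \<open>v\<close> of \<open>\<parallel>R x\<parallel>\<close> in the complement, for a resolvent \<open>R\<close> at \<open>\<mu>\<close>, satisfies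
  \<open>(D - Re \<mu>)\<^sup>2 v = s v\<close> for a real \<open>s \<ge> 0\<close>, whether or not \<open>\<mu>\<close> is real; factoring the square yields
  an eigenvector of \<open>D\<close>.\<close>

lemma eigenvector_in_orthogonal_complement:
  fixes D :: "'h::complex_hilbert_space \<Rightarrow> 'h"
  assumes sa: "self_adjoint W D" and cr: "compact_resolvent W D"
    and A: "orthonormal A" "\<And>a. a \<in> A \<Longrightarrow> \<exists>l. a \<in> eigenspace W D l"
    and x0: "x0 \<noteq> 0" "\<And>a. a \<in> A \<Longrightarrow> cinner a x0 = 0"
  obtains v l where "norm v = 1" "v \<in> eigenspace W D l" "\<And>a. a \<in> A \<Longrightarrow> cinner a v = 0"
proof -
  obtain \<mu> R where res: "is_resolvent W D \<mu> R" and R: "compact_op R"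
    using cr by (auto simp: compact_resolvent_def)
  have bR: "bounded_clinear R" and RW: "\<And>x. R x \<in> W" and DR: "\<And>x. D (R x) - \<mu> *\<^sub>C R x = x"
    and RD: "\<And>x. x \<in> W \<Longrightarrow> R (D x - \<mu> *\<^sub>C x) = x"
    using res by (auto simp: is_resolvent_def)
  define M where "M = {x. \<forall>a\<in>A. cinner a x = 0}"
  have A': "\<exists>k. k \<noteq> 0 \<and> D a = (k + \<mu>) *\<^sub>C a \<and> cnj (k + \<mu>) = k + \<mu> \<and> a \<in> W \<and> k *\<^sub>C R a = a" if a: "a \<in> A" for a
  proof -
    obtain l where "a \<in> eigenspace W D l" using A(2)[OF a] by blast
    then have aW: "a \<in> W" and Da: "D a = of_real l *\<^sub>C a" by (auto simp: eigenspace_def scaleR_scaleC)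
    define k where "k = of_real l - \<mu>"
    have "D a - \<mu> *\<^sub>C a = k *\<^sub>C a" by (simp add: Da k_def scaleC_diff_left)
    then have "k *\<^sub>C R a = a" using RD[OF aW] bounded_clinear_scaleC[OF bR] by simp
    moreover from this have "k \<noteq> 0" using A(1) a by (auto simp: orthonormal_def)
    ultimately show ?thesis using aW Da by (intro exI[of _ k]) (simp add: k_def)
  qed
  have RM: "R x \<in> M" if x: "x \<in> M" for x
    unfolding M_def
  proof safe
    fix a assume a: "a \<in> A"
    obtain k where k: "k \<noteq> 0" "D a = (k + \<mu>) *\<^sub>C a" "cnj (k + \<mu>) = k + \<mu>" "a \<in> W"
      using A'[OF a] by blast
    have "0 = cinner a (D (R x) - \<mu> *\<^sub>C R x)" using x a by (simp add: DR M_def)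
    also have "\<dots> = cinner (D a) (R x) - \<mu> * cinner a (R x)"
      by (simp add: cinner_simps self_adjoint_symmetric[OF sa k(4) RW])
    also have "\<dots> = k * cinner a (R x)"
      unfolding k(2) cinner_scaleC_left k(3) by (simp add: algebra_simps)
    finally show "cinner a (R x) = 0" using k(1) by simp
  qed
  have Madd: "x + y \<in> M" if "x \<in> M" "y \<in> M" for x y using that by (simp add: M_def cinner_simps)
  have Mscale: "c *\<^sub>C x \<in> M" if "x \<in> M" for x c using that by (simp add: M_def cinner_simps)
  have "closed M"
  proof -
    have "M = (\<Inter>a\<in>A. {x. cinner a x = 0})" by (auto simp: M_def)
    moreover have "closed {x. cinner a x = 0}" for a :: 'h
      by (rule closed_Collect_eq)
        (auto intro: bounded_linear.continuous_on[OF bounded_linear_cinner_right] continuous_intros)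
    ultimately show ?thesis by auto
  qed
  have "x0 \<in> M" using x0 by (simp add: M_def)
  moreover have "R x0 \<noteq> 0" using DR[of x0] x0(1) self_adjoint_zero[OF sa] by auto
  ultimately obtain v r where v: "v \<in> M" "r > 0" "v \<noteq> 0"
    and vu': "\<And>u. u \<in> M \<Longrightarrow> cinner (R v) (R u) = of_real (r\<^sup>2) * cinner v u"
    using compact_attains_norm[OF R Madd Mscale \<open>closed M\<close>] by blast
  \<comment> \<open>The equation is extended from \<open>M\<close> to all \<open>u\<close>. On the
    closed span of \<open>A\<close> both sides vanish, because \<open>v\<close> and
    \<open>R v\<close> lie in \<open>M\<close> while \<open>R\<close> maps each \<open>a\<close> to
    a multiple of itself.\<close>
  have vu: "cinner (R v) (R u) = of_real (r\<^sup>2) * cinner v u" for u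
  proof -
    define p where "p = (\<Sum>\<^sub>\<infinity>a\<in>A. cinner a u *\<^sub>C a)"
    note l2 = l2_vector_exists[OF A(1) Bessel(1)[OF A(1), of u], folded p_def]
    have "u - p \<in> M" using l2(2) by (simp add: M_def cinner_simps)
    moreover have "cinner v p = 0"
    proof (rule l2(3))
      show "cinner v a = 0" if "a \<in> A" for a
        using v(1) that by (subst cinner_commute) (simp add: M_def)
    qed
    moreover have "cinner (R v) (R p) = 0"
    proof -
      have "cinner (R v) (R a) = 0" if a: "a \<in> A" for a
      proof -
        obtain k where k: "k \<noteq> 0" "k *\<^sub>C R a = a" using A'[OF a] by blast
        have "k * cinner (R v) (R a) = cinner (R v) a" by (metis cinner_scaleC_right k(2))
        also have "\<dots> = 0" using RM[OF v(1)] a by (subst cinner_commute) (simp add: M_def)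
        finally show ?thesis using k by simp
      qed
      moreover have "((\<lambda>a. cinner (R v) (R (cinner a u *\<^sub>C a))) has_sum cinner (R v) (R p)) A"
        using bR unfolding p_def
        by (intro has_sum_bounded_linear[OF bounded_linear_cinner_right]
            has_sum_bounded_linear[where h = R] has_sum_infsum l2(1)) (simp add: bounded_clinear_def)
      ultimately have "((\<lambda>a. 0) has_sum cinner (R v) (R p)) A"
        by (simp add: bounded_clinear_scaleC[OF bR] cinner_simps cong: has_sum_cong)
      then show ?thesis by (rule has_sum_unique) simp
    qed
    ultimately show ?thesis
      using vu'[of "u - p"] by (simp add: bounded_clinear_diff[OF bR] cinner_simps)
  qed
  define y where "y = (1 / r\<^sup>2) *\<^sub>R R v"
  have vW: "v \<in> W" and Dv: "D v = y + cnj \<mu> *\<^sub>C v"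
  proof -
    \<comment> \<open>Tested at \<open>(D - \<mu>) w\<close>, from which \<open>R\<close> recovers
      \<open>w\<close>, the equation becomes the adjointness relation that places \<open>v\<close>
      in the domain.\<close>
    have "cinner (D w) v = cinner w (y + cnj \<mu> *\<^sub>C v)" if w: "w \<in> W" for w
    proof -
      have "cinner (R v) w = of_real (r\<^sup>2) * cinner v (D w - \<mu> *\<^sub>C w)"
        using vu[of "D w - \<mu> *\<^sub>C w"] RD[OF w] by simp
      then have "cnj (cinner (R v) w) = cnj (of_real (r\<^sup>2) * cinner v (D w - \<mu> *\<^sub>C w))" by simp
      then have "cinner w (R v) = of_real (r\<^sup>2) * cinner (D w - \<mu> *\<^sub>C w) v"
        by (simp add: cinner_commute[symmetric])
      then show ?thesis
        using v(2) by (simp add: y_def cinner_simps field_simps)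
    qed
    from self_adjoint_memI[OF sa this] show "v \<in> W" "D v = y + cnj \<mu> *\<^sub>C v" by auto
  qed
  have yW: "y \<in> W" and Dy: "D y = (1 / r\<^sup>2) *\<^sub>R v + \<mu> *\<^sub>C y"
  proof -
    have "D (R v) = v + \<mu> *\<^sub>C R v" using DR[of v] by (simp add: algebra_simps)
    then show "y \<in> W" "D y = (1 / r\<^sup>2) *\<^sub>R v + \<mu> *\<^sub>C y"
      using self_adjoint_scaleR[OF sa RW, of "1 / r\<^sup>2" v]
      by (simp_all add: y_def scaleR_scaleC scaleC_add_right scaleC_scaleC mult.commute)
  qed
  define m where "m = Re \<mu>"
  define x where "x = D v - m *\<^sub>R v"
  have x_y: "x = y - (\<i> * Im \<mu>) *\<^sub>C v"
  proof -
    have "cnj \<mu> = of_real m - \<i> * Im \<mu>" by (simp add: m_def complex_eq_iff)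
    then show ?thesis by (simp add: x_def Dv scaleC_diff_left scaleR_scaleC)
  qed
  have vW': "(\<i> * Im \<mu>) *\<^sub>C v \<in> W" and Dv': "D ((\<i> * Im \<mu>) *\<^sub>C v) = (\<i> * Im \<mu>) *\<^sub>C D v"
    using self_adjoint_scaleC[OF sa vW] by simp_all
  have xW: "x \<in> W"
    unfolding x_y by (rule conjunct1[OF self_adjoint_diff[OF sa yW vW']])
  have xM: "x \<in> M"
    using RM[OF v(1)] v(1) by (simp add: x_y y_def M_def cinner_simps)
  \<comment> \<open>Now \<open>(D - cnj \<mu>) v = y\<close> and
    \<open>(D - \<mu>) y = v / r^2\<close>. The product of the two factors is
    \<open>(D - m)^2 + (Im \<mu>)^2\<close>, which leaves this constant.\<close>
  define s where "s = 1 / r\<^sup>2 - (Im \<mu>)\<^sup>2"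
  have Dx: "D x - m *\<^sub>R x = s *\<^sub>R v"
  proof -
    have mu: "\<mu> = of_real m + \<i> * Im \<mu>" by (simp add: m_def complex_eq_iff)
    have "D x = D y - (\<i> * Im \<mu>) *\<^sub>C D v"
      unfolding x_y by (simp only: conjunct2[OF self_adjoint_diff[OF sa yW vW']] Dv')
    also have "\<dots> = (1 / r\<^sup>2) *\<^sub>R v + \<mu> *\<^sub>C y - (\<i> * Im \<mu>) *\<^sub>C (x + m *\<^sub>R v)"
      by (simp add: Dy x_def)
    also have "y = x + (\<i> * Im \<mu>) *\<^sub>C v" by (simp add: x_y)
    also have "\<mu> *\<^sub>C (x + (\<i> * Im \<mu>) *\<^sub>C v)
        = m *\<^sub>R x + (\<i> * Im \<mu>) *\<^sub>C x + (\<i> * Im \<mu>) *\<^sub>C (m *\<^sub>R v) + (\<i> * Im \<mu> * (\<i> * Im \<mu>)) *\<^sub>C v"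
      by (subst mu) (simp add: scaleC_add_left scaleC_diff_left scaleC_minus_left scaleC_add_right
          scaleC_scaleC scaleR_scaleC algebra_simps)
    also have "(\<i> * Im \<mu> * (\<i> * Im \<mu>)) *\<^sub>C v = (- ((Im \<mu>)\<^sup>2)) *\<^sub>R v"
    proof -
      have "\<i> * Im \<mu> * (\<i> * Im \<mu>) = of_real (- ((Im \<mu>)\<^sup>2))"
        by (simp add: complex_eq_iff power2_eq_square)
      then show ?thesis by (simp only: scaleR_scaleC)
    qed
    finally show ?thesis
      by (simp add: s_def scaleC_add_right scaleR_left_diff_distrib algebra_simps)
  qed
  have "of_real s * cinner v v = cinner v (D x - m *\<^sub>R x)"
    by (simp add: Dx cinner_simps)
  also have "\<dots> = cinner (D v - m *\<^sub>R v) x"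
    by (simp add: cinner_simps self_adjoint_symmetric[OF sa vW xW])
  also have "\<dots> = cinner x x"
    by (simp only: x_def)
  finally have "s * (norm v)\<^sup>2 = (norm x)\<^sup>2"
    by (metis Re_cinner_self Re_complex_of_real cinner_self of_real_mult)
  then have s0: "s \<ge> 0" using v(3)
    by (metis mult_neg_pos not_le norm_eq_zero zero_le_power2 zero_less_power2)
  define \<sigma> where "\<sigma> = sqrt s"
  have \<sigma>: "\<sigma> * \<sigma> = s" using s0 by (simp add: \<sigma>_def)
  \<comment> \<open>\<open>D - m - \<sigma>\<close> annihilates \<open>x + \<sigma> v\<close>. If
    this vector is 0, then \<open>x = - \<sigma> v\<close>, and \<open>v\<close> itself is an
    eigenvector for \<open>m - \<sigma>\<close>.\<close>
  have "\<exists>w l. w \<noteq> 0 \<and> w \<in> M \<and> w \<in> eigenspace W D l"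
  proof (cases "x + \<sigma> *\<^sub>R v = 0")
    case False
    let ?w = "x + \<sigma> *\<^sub>R v"
    have "?w \<in> M" using xM v(1) by (simp add: Madd Mscale scaleR_scaleC)
    moreover have "?w \<in> W \<and> D ?w = D x + \<sigma> *\<^sub>R D v"
      using self_adjoint_add[OF sa xW] self_adjoint_scaleR[OF sa vW] by metis
    moreover have "D x + \<sigma> *\<^sub>R D v = (m + \<sigma>) *\<^sub>R ?w"
    proof -
      have "D x = s *\<^sub>R v + m *\<^sub>R x" using Dx by (simp add: algebra_simps)
      moreover have "D v = x + m *\<^sub>R v" by (simp add: x_def)
      ultimately show ?thesis by (simp add: \<sigma>[symmetric] algebra_simps)
    qed
    ultimately show ?thesis using False by (auto simp: eigenspace_def)
  next
    case True
    then have "D v = (m - \<sigma>) *\<^sub>R v" by (simp add: x_def algebra_simps)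
    then show ?thesis using v vW by (auto simp: eigenspace_def)
  qed
  then obtain w l where w: "w \<noteq> 0" "w \<in> M" "w \<in> eigenspace W D l" by blast
  show ?thesis
  proof (rule that)
    show "norm ((1 / norm w) *\<^sub>R w) = 1" using w by simp
    show "(1 / norm w) *\<^sub>R w \<in> eigenspace W D l" using w sa by (simp add: eigenspace_scaleR)
    show "cinner a ((1 / norm w) *\<^sub>R w) = 0" if "a \<in> A" for a
      using w that by (simp add: M_def cinner_simps)
  qed
qed

text \<open>Self-adjointness makes the domain as large as possible: it suffices to exhibit a vector
  with the coordinates that \<open>D y\<close> would have. From here on, membership in
  \<open>W\<close> is decided by coordinates.\<close>

lemma eigenbasis_memI:
  assumes sa: "self_adjoint W D" and E: "is_onb E" "\<And>e. e \<in> E \<Longrightarrow> e \<in> W \<and> D e = lam e *\<^sub>R e"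
    and w: "\<And>e. e \<in> E \<Longrightarrow> cinner e w = of_real (lam e) * cinner e y"
  shows "y \<in> W" "D y = w"
proof -
  have "cinner (D x) y = cinner x w" if x: "x \<in> W" for x
  proof (rule has_sum_unique)
    show "((\<lambda>e. cinner (D x) e * cinner e y) has_sum cinner (D x) y) E"
      by (rule onb_parseval[OF E(1)])
    have "cinner (D x) e * cinner e y = cinner x e * cinner e w" if "e \<in> E" for e
      using self_adjoint_symmetric[OF sa x, of e] E(2)[OF that] w[OF that] by (simp add: cinner_simps)
    then show "((\<lambda>e. cinner (D x) e * cinner e y) has_sum cinner x w) E"
      using onb_parseval[OF E(1), of x w] by (simp cong: has_sum_cong)
  qed
  from self_adjoint_memI[OF sa this] show "y \<in> W" "D y = w" by auto
qed

text \<open>The last hypothesis is an exchange property: an eigenvector orthogonal to a part of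
  \<open>J\<close> can be traded for one in \<open>J\<close>. The lemma is used for all unit
  eigenvectors and then for those that are also eigenvectors of \<open>F\<close>.\<close>

lemma eigenbasis_within:
  fixes D :: "'h::complex_hilbert_space \<Rightarrow> 'h"
  assumes sa: "self_adjoint W D" and cr: "compact_resolvent W D"
    and J: "\<And>v. v \<in> J \<Longrightarrow> norm v = 1 \<and> (\<exists>l. v \<in> eigenspace W D l)"
    and ex: "\<And>A v l. A \<subseteq> J \<Longrightarrow> norm v = 1 \<Longrightarrow> v \<in> eigenspace W D l \<Longrightarrow>
      (\<And>a. a \<in> A \<Longrightarrow> cinner a v = 0) \<Longrightarrow> \<exists>w\<in>J. \<forall>a\<in>A. cinner a w = 0"
  obtains E where "is_onb E" "E \<subseteq> J"
proof -
  obtain A where A: "A \<subseteq> J" "orthonormal A" "\<And>v. v \<in> J \<Longrightarrow> \<exists>a\<in>A. cinner a v \<noteq> 0"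
    by (rule maximal_orthonormal_subset[of J]) (use J in auto)
  have "y = 0" if y: "\<And>a. a \<in> A \<Longrightarrow> cinner a y = 0" for y
  proof (rule ccontr)
    assume "y \<noteq> 0"
    have "\<exists>l. a \<in> eigenspace W D l" if "a \<in> A" for a using A(1) J that by blast
    then obtain v l where "norm v = 1" "v \<in> eigenspace W D l" "\<And>a. a \<in> A \<Longrightarrow> cinner a v = 0"
      using eigenvector_in_orthogonal_complement[OF sa cr A(2) _ \<open>y \<noteq> 0\<close> y] by metis
    then show False using ex[OF A(1)] A(3) by metis
  qed
  then show ?thesis using that[of A] A by (auto simp: is_onb_iff)
qed

text \<open>\<open>F\<close> is arbitrary on the kernel of \<open>D\<close>, so it has to be
  diagonalised there as well. A preliminary eigenbasis of \<open>D\<close> alone shows that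
  \<open>F\<close> preserves the kernel. The sign \<open>eps\<close> extends the sign of the
  eigenvalue to the kernel, which makes \<open>lam e = eps e * \<bar>lam e\<bar>\<close> hold
  throughout.\<close>

lemma joint_eigenbasis:
  fixes D :: "'h::complex_hilbert_space \<Rightarrow> 'h"
  assumes sa: "self_adjoint W D" and cr: "compact_resolvent W D" and F: "is_sign W D F"
  obtains E lam eps where "is_onb E"
    "\<And>e. e \<in> E \<Longrightarrow> e \<in> W \<and> D e = lam e *\<^sub>R e"
    "\<And>e. e \<in> E \<Longrightarrow> F e = eps e *\<^sub>R e"
    "\<And>e. e \<in> E \<Longrightarrow> eps e * eps e = (1::real)" "\<And>e. e \<in> E \<Longrightarrow> lam e = eps e * \<bar>lam e\<bar>"
proof -
  have bF: "bounded_clinear F" and Fsym: "\<And>x y. cinner (F x) y = cinner x (F y)"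
    and FF: "\<And>x. F (F x) = x" and Fsgn: "\<And>l x. l \<noteq> 0 \<Longrightarrow> x \<in> eigenspace W D l \<Longrightarrow> F x = sgn l *\<^sub>R x"
    using F by (auto simp: is_sign_def)
  obtain E1 where E1: "is_onb E1" "E1 \<subseteq> {v. norm v = 1 \<and> (\<exists>l. v \<in> eigenspace W D l)}"
    by (rule eigenbasis_within[OF sa cr, of "{v. norm v = 1 \<and> (\<exists>l. v \<in> eigenspace W D l)}"]) auto
  then have "\<forall>e\<in>E1. \<exists>l. e \<in> eigenspace W D l" by blast
  then obtain k where k: "\<And>e. e \<in> E1 \<Longrightarrow> e \<in> eigenspace W D (k e)" by metis
  have Fker: "F v \<in> eigenspace W D 0" if v: "v \<in> eigenspace W D 0" for v
  proof -
    have "cinner e 0 = of_real (k e) * cinner e (F v)" if e: "e \<in> E1" for e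
    proof (cases "k e = 0")
      case False
      have "cinner e (F v) = sgn (k e) * cinner e v"
        by (simp add: Fsym[symmetric] Fsgn[OF False k[OF e]] cinner_simps)
      then show ?thesis
        using eigenspaces_orthogonal[OF sa k[OF e] v False] by simp
    qed simp
    from eigenbasis_memI[OF sa E1(1) _ this] show ?thesis
      using k by (auto simp: eigenspace_def)
  qed
  define J where "J = {v. norm v = 1 \<and> (\<exists>l s. v \<in> eigenspace W D l \<and> F v = s *\<^sub>R v \<and> s * s = 1 \<and> l = s * \<bar>l\<bar>)}"
  have exJ: "\<exists>w\<in>J. \<forall>a\<in>A. cinner a w = 0"
    if A: "A \<subseteq> J" "norm v = 1" "v \<in> eigenspace W D l" "\<And>a. a \<in> A \<Longrightarrow> cinner a v = 0" for A v l
  proof (cases "l = 0")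
    case False
    then have "F v = sgn l *\<^sub>R v \<and> sgn l * sgn l = 1 \<and> l = sgn l * \<bar>l\<bar>"
      using Fsgn[OF False A(3)] by (auto simp: sgn_if)
    then have "v \<in> J" unfolding J_def using A by blast
    then show ?thesis using A by blast
  next
    case True
    have Fv: "cinner a (F v) = 0" if a: "a \<in> A" for a
    proof -
      obtain s where "F a = s *\<^sub>R a" using A(1) a by (auto simp: J_def)
      then show ?thesis using A(4)[OF a] by (simp add: Fsym[symmetric] cinner_simps)
    qed
    \<comment> \<open>An involution splits the kernel: either \<open>v\<close> is fixed by
      \<open>F\<close>, or \<open>v - F v\<close> is a nonzero eigenvector for -1. Both are
      orthogonal to \<open>A\<close>, because \<open>F\<close> is symmetric and diagonal on
      \<open>A\<close>.\<close>
    have "\<exists>w s. w \<noteq> 0 \<and> w \<in> eigenspace W D 0 \<and> F w = s *\<^sub>R w \<and> s * s = 1 \<and> (\<forall>a\<in>A. cinner a w = 0)"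
    proof (cases "F v = v")
      case True
      then show ?thesis using A \<open>l = 0\<close> by (intro exI[of _ v] exI[of _ 1]) auto
    next
      case False
      have "v - F v \<in> eigenspace W D 0"
        using A(3) True Fker by (intro eigenspace_diff[OF sa]) auto
      then show ?thesis using False A(4) Fv
        by (intro exI[of _ "v - F v"] exI[of _ "-1"])
          (simp add: bounded_clinear_diff[OF bF] FF cinner_simps)
    qed
    then obtain w s where w: "w \<noteq> 0" "w \<in> eigenspace W D 0" "F w = s *\<^sub>R w" "s * s = 1"
      "\<And>a. a \<in> A \<Longrightarrow> cinner a w = 0" by blast
    define u where "u = (1 / norm w) *\<^sub>R w"
    have "norm u = 1" "u \<in> eigenspace W D 0" "F u = s *\<^sub>R u"
      using w sa by (simp_all add: u_def eigenspace_scaleR bounded_clinear_scaleR[OF bF])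
    then have "u \<in> J" unfolding J_def using w(4)
      by (intro CollectI conjI exI[of _ 0] exI[of _ s]) auto
    moreover have "\<forall>a\<in>A. cinner a u = 0" using w(5) by (simp add: u_def cinner_simps)
    ultimately show ?thesis by blast
  qed
  have "norm v = 1 \<and> (\<exists>l. v \<in> eigenspace W D l)" if "v \<in> J" for v
    using that by (auto simp: J_def)
  then obtain E where E: "is_onb E" "E \<subseteq> J"
    using exJ by (rule eigenbasis_within[OF sa cr])
  then have "\<forall>e\<in>E. \<exists>l s. e \<in> eigenspace W D l \<and> F e = s *\<^sub>R e \<and> s * s = 1 \<and> l = s * \<bar>l\<bar>"
    by (auto simp: J_def)
  then obtain lam eps where
    "\<And>e. e \<in> E \<Longrightarrow> e \<in> eigenspace W D (lam e) \<and> F e = eps e *\<^sub>R e \<and> eps e * eps e = 1 \<and> lam e = eps e * \<bar>lam e\<bar>"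
    by metis
  then show ?thesis using that[of E lam eps] E(1) by (auto simp: eigenspace_def)
qed

subsection \<open>Trace class operators\<close>

lemma Bessel_pair:
  fixes u v :: "'h::complex_hilbert_space"
  assumes E: "orthonormal E"
  shows "(\<lambda>e. cmod (cinner u e * cinner e v)) summable_on E"
    and "(\<Sum>\<^sub>\<infinity>e\<in>E. cmod (cinner u e * cinner e v)) \<le> norm u * norm v"
proof -
  have *: "(\<Sum>e\<in>A. cmod (cinner u e * cinner e v)) \<le> norm u * norm v" if A: "finite A" "A \<subseteq> E" for A
  proof -
    have c: "cmod (cinner u e) = cmod (cinner e u)" for e
      by (subst cinner_commute) simp
    have "(\<Sum>e\<in>A. cmod (cinner u e * cinner e v))\<^sup>2
        \<le> (\<Sum>e\<in>A. (cmod (cinner e u))\<^sup>2) * (\<Sum>e\<in>A. (cmod (cinner e v))\<^sup>2)"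
      unfolding norm_mult c by (rule Cauchy_Schwarz_ineq_sum)
    also have "\<dots> \<le> (norm u)\<^sup>2 * (norm v)\<^sup>2"
      by (intro mult_mono Bessel(2)[OF E A] sum_nonneg) auto
    finally have "(\<Sum>e\<in>A. cmod (cinner u e * cinner e v))\<^sup>2 \<le> (norm u * norm v)\<^sup>2"
      by (simp add: power_mult_distrib)
    then show ?thesis by (rule power2_le_imp_le) simp
  qed
  show s: "(\<lambda>e. cmod (cinner u e * cinner e v)) summable_on E"
    by (rule nonneg_bdd_above_summable_on) (auto intro!: bdd_aboveI2[where M = "norm u * norm v"] *)
  show "(\<Sum>\<^sub>\<infinity>e\<in>E. cmod (cinner u e * cinner e v)) \<le> norm u * norm v"
    by (rule infsum_le_finite_sums[OF s]) (rule *)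
qed

text \<open>Fubini for the double sum over \<open>i\<close> and \<open>e\<close>, whose absolute
  convergence is the Bessel estimate for pairs. The value does not mention \<open>E\<close>, which
  removes the choice of a basis from \<open>op_trace\<close>.\<close>

lemma nuclear_trace:
  fixes T :: "'h::complex_hilbert_space \<Rightarrow> 'h"
  assumes E: "is_onb E"
    and T: "\<And>x. ((\<lambda>i. cinner (u i) x *\<^sub>C v i) has_sum T x) I"
    and s: "(\<lambda>i. norm (u i) * norm (v i)) summable_on I"
  shows "((\<lambda>e. cinner e (T e)) has_sum (\<Sum>\<^sub>\<infinity>i\<in>I. cinner (u i) (v i))) E"
proof -
  note on = is_onb_orthonormal[OF E]
  let ?f = "\<lambda>(i, e). cinner (u i) e * cinner e (v i)"
  have "(\<lambda>x. norm (?f x)) summable_on (I \<times> E)"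
    unfolding Infinite_Sum.abs_summable_on_Sigma_iff
  proof
    show "\<forall>i\<in>I. (\<lambda>e. norm (?f (i, e))) summable_on E"
      using Bessel_pair(1)[OF on] by simp
    show "(\<lambda>i. norm (\<Sum>\<^sub>\<infinity>e\<in>E. cmod (?f (i, e)))) summable_on I"
    proof (rule Infinite_Sum.abs_summable_on_comparison_test'[OF s])
      show "norm (\<Sum>\<^sub>\<infinity>e\<in>E. cmod (?f (i, e))) \<le> norm (u i) * norm (v i)" for i
        using Bessel_pair(2)[OF on, of "u i" "v i"] by (simp add: infsum_nonneg)
    qed
  qed
  then have sm: "?f summable_on (I \<times> E)" by (rule Infinite_Sum.abs_summable_summable)
  then obtain S where S: "(?f has_sum S) (I \<times> E)" by (auto simp: summable_on_def)
  have "((\<lambda>i. cinner (u i) (v i)) has_sum S) I"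
    by (rule has_sum_SigmaD[OF S]) (simp add: onb_parseval[OF E])
  then have "S = (\<Sum>\<^sub>\<infinity>i\<in>I. cinner (u i) (v i))" by (simp add: infsumI)
  moreover have "((\<lambda>e. cinner e (T e)) has_sum S) E"
  proof (rule has_sum_SigmaD)
    show "((\<lambda>(e, i). ?f (i, e)) has_sum S) (E \<times> I)"
      using S by (subst (asm) has_sum_swap)
    show "((\<lambda>i. (\<lambda>(e, i). ?f (i, e)) (e, i)) has_sum cinner e (T e)) I" for e
      using has_sum_bounded_linear[OF bounded_linear_cinner_right T, of e e]
      by (simp add: cinner_scaleC_right)
  qed
  ultimately show ?thesis by simp
qed

lemma op_trace_nuclear:
  fixes T :: "'h::complex_hilbert_space \<Rightarrow> 'h"
  assumes "is_onb (E :: 'h set)" "\<And>x. ((\<lambda>i. cinner (u i) x *\<^sub>C v i) has_sum T x) I"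
    "(\<lambda>i. norm (u i) * norm (v i)) summable_on I"
  shows "op_trace T = (\<Sum>\<^sub>\<infinity>i\<in>I. cinner (u i) (v i))"
proof -
  have "is_onb (SOME E :: 'h set. is_onb E)" using assms(1) by (rule someI)
  from nuclear_trace[OF this assms(2,3)] show ?thesis
    unfolding op_trace_def by (rule infsumI)
qed

text \<open>Polarisation: that the quadratic form is real at \<open>x + y\<close> and at
  \<open>x + \<i> y\<close> gives the imaginary and the real part.\<close>

lemma positive_op_symmetric:
  assumes "positive_op S"
  shows "cinner (S x) y = cinner x (S y)"
proof -
  have bS: "bounded_clinear S" and re: "\<And>z. Im (cinner z (S z)) = 0"
    using assms by (auto simp: positive_op_def complex_is_Real_iff)
  have "Im (cinner x (S y)) + Im (cinner y (S x)) = 0"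
    using re[of "x + y"] by (simp add: bounded_clinear_add[OF bS] cinner_simps re)
  moreover have "Re (cinner x (S y)) - Re (cinner y (S x)) = 0"
    using re[of "x + \<i> *\<^sub>C y"]
    by (simp add: bounded_clinear_add[OF bS] bounded_clinear_scaleC[OF bS] cinner_simps re)
  ultimately have "cinner x (S y) = cnj (cinner y (S x))"
    by (simp add: complex_eq_iff)
  then show ?thesis by (simp add: cinner_commute[of "S x" y])
qed

lemma positive_op_real: "positive_op S \<Longrightarrow> cinner x (S x) = of_real (Re (cinner x (S x)))"
  by (simp add: positive_op_def of_real_Re)

lemma positive_op_Cauchy_Schwarz:
  assumes S: "positive_op S"
  shows "(cmod (cinner x (S y)))\<^sup>2 \<le> Re (cinner x (S x)) * Re (cinner y (S y))"
proof -
  have bS: "bounded_clinear S" using S by (simp add: positive_op_def)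
  show ?thesis
  proof (rule psd_Cauchy_Schwarz[where q = "\<lambda>x y. cinner x (S y)"])
    fix d
    have c: "cinner y (S x) = cnj (cinner x (S y))"
      by (metis positive_op_symmetric[OF S] cinner_commute)
    show "cinner (y + d *\<^sub>C x) (S (y + d *\<^sub>C x)) = cinner y (S y) + d * cnj (cinner x (S y))
        + cnj d * cinner x (S y) + cnj d * d * cinner x (S x)"
      unfolding bounded_clinear_add[OF bS] bounded_clinear_scaleC[OF bS]
        cinner_add_left cinner_add_right cinner_scaleC_left cinner_scaleC_right c
      by (simp add: algebra_simps)
  qed (use S in \<open>simp_all add: positive_op_def\<close>)
qed

lemma positive_op_eq_0:
  assumes S: "positive_op S" and x: "Re (cinner x (S x)) = 0"
  shows "S x = 0"
proof -
  have "(cmod (cinner (S x) (S x)))\<^sup>2 \<le> 0"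
    using positive_op_Cauchy_Schwarz[OF S, of "S x" x] x by simp
  then show ?thesis by (simp add: cinner_eq_0_self)
qed

text \<open>Subtracting pivots, a positive operator \<open>S\<close> with finite trace is decomposed into operators
  \<open>x \<mapsto> \<langle>u\<^sub>n, x\<rangle> u\<^sub>n\<close> with \<open>u\<^sub>n = S w\<^sub>n\<close>. If \<open>S\<close> is the modulus of \<open>T\<close>, the vectors \<open>T w\<^sub>n\<close> then decompose
  \<open>T\<close>; this replaces the spectral theorem for \<open>S\<close> and the polar decomposition. If a pivot vanishes,
  then so does the vector it divides, and \<open>1 / 0 = 0\<close> is harmless.\<close>

definition cholesky_vec :: "('h::complex_hilbert_space \<Rightarrow> 'h) \<Rightarrow> 'h \<Rightarrow> 'h" where
  "cholesky_vec S x = (1 / sqrt (Re (cinner x (S x)))) *\<^sub>R S x"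

primrec cholesky :: "('h::complex_hilbert_space \<Rightarrow> 'h) \<Rightarrow> (nat \<Rightarrow> 'h) \<Rightarrow> nat \<Rightarrow> 'h \<Rightarrow> 'h" where
  "cholesky S e 0 = S"
| "cholesky S e (Suc n) = (\<lambda>x. cholesky S e n x
     - cinner (cholesky_vec (cholesky S e n) (e n)) x *\<^sub>C cholesky_vec (cholesky S e n) (e n))"

text \<open>One elimination step. The remainder stays positive by Cauchy-Schwarz for the form of
  \<open>S\<close>. It annihilates the pivot, and by the last part the vectors annihilated before
  remain so.\<close>

lemma cholesky_step:
  fixes S :: "'h::complex_hilbert_space \<Rightarrow> 'h" and e :: 'h
  assumes S: "positive_op S"
  defines "u \<equiv> cholesky_vec S e"
  shows "positive_op (\<lambda>x. S x - cinner u x *\<^sub>C u)" and "S e - cinner u e *\<^sub>C u = 0"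
    and "S y = 0 \<Longrightarrow> cinner u y = 0"
proof -
  have bS: "bounded_clinear S" using S by (simp add: positive_op_def)
  define a where "a = Re (cinner e (S e))"
  have a0: "a \<ge> 0" using S by (simp add: positive_op_def a_def)
  have u: "u = (1 / sqrt a) *\<^sub>R S e" by (simp add: u_def cholesky_vec_def a_def)
  have ux: "cinner u x = of_real (1 / sqrt a) * cinner e (S x)" for x
    by (simp add: u cinner_simps positive_op_symmetric[OF S])
  show "S y = 0 \<Longrightarrow> cinner u y = 0" by (simp add: ux)
  show "S e - cinner u e *\<^sub>C u = 0"
  proof (cases "a = 0")
    case True
    then show ?thesis using positive_op_eq_0[OF S, of e] by (simp add: a_def[symmetric] u)
  next
    case False
    have "cinner e (S e) = of_real a" unfolding a_def by (rule positive_op_real[OF S])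
    then have "cinner u e *\<^sub>C u = (of_real (1 / sqrt a) * of_real a) *\<^sub>C (of_real (1 / sqrt a) *\<^sub>C S e)"
      by (simp only: ux) (simp only: u scaleR_scaleC)
    also have "\<dots> = of_real (1 / sqrt a * a * (1 / sqrt a)) *\<^sub>C S e"
      by (simp only: scaleC_scaleC of_real_mult)
    also have "1 / sqrt a * a * (1 / sqrt a) = 1" using False a0 by (simp add: field_simps)
    finally show ?thesis by (simp add: scaleC_one)
  qed
  have form: "cinner x (S x - cinner u x *\<^sub>C u) = of_real (Re (cinner x (S x)) - (cmod (cinner u x))\<^sup>2)" for x
  proof -
    have "cinner u x * cinner x u = of_real ((cmod (cinner u x))\<^sup>2)"
      unfolding complex_norm_square by (simp only: cinner_commute[symmetric])
    then have "cinner x (S x - cinner u x *\<^sub>C u) = cinner x (S x) - of_real ((cmod (cinner u x))\<^sup>2)"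
      by (simp add: cinner_simps)
    then show ?thesis
      by (simp only: of_real_diff positive_op_real[OF S, symmetric])
  qed
  have bound: "(cmod (cinner u x))\<^sup>2 \<le> Re (cinner x (S x))" for x
  proof (cases "a = 0")
    case True
    then show ?thesis using S by (simp add: ux positive_op_def)
  next
    case False
    have "(cmod (cinner u x))\<^sup>2 = (cmod (cinner e (S x)))\<^sup>2 / a"
      using a0 by (simp add: ux norm_mult norm_divide power_mult_distrib power_divide)
    also have "\<dots> \<le> (a * Re (cinner x (S x))) / a"
      using a0 by (intro divide_right_mono) (auto simp: a_def positive_op_Cauchy_Schwarz[OF S])
    finally show ?thesis using False by simp
  qed
  have "bounded_clinear (\<lambda>x. cinner u x *\<^sub>C u)"
  proof (rule bounded_clinearI[where K = "norm u * norm u"])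
    show "norm (cinner u x *\<^sub>C u) \<le> norm u * norm u * norm x" for x
      using mult_right_mono[OF Cauchy_Schwarz_cinner[of u x] norm_ge_zero[of u]]
      by (simp add: norm_scaleC ac_simps)
  qed (simp_all add: cinner_simps scaleC_add_left scaleC_scaleC)
  then show "positive_op (\<lambda>x. S x - cinner u x *\<^sub>C u)"
    unfolding positive_op_def form using bound bounded_clinear_minus[OF bS] by auto
qed

lemma trace_class_decomposition:
  fixes T :: "'h::complex_hilbert_space \<Rightarrow> 'h"
  assumes T: "trace_class T"
  obtains u v :: "nat \<Rightarrow> 'h" where
    "\<And>x. ((\<lambda>n. cinner (u n) x *\<^sub>C v n) has_sum T x) UNIV"
    "(\<lambda>n. norm (u n) * norm (v n)) summable_on UNIV"
proof -
  obtain S E where bT: "bounded_clinear T" and md: "is_modulus T S" and E: "is_onb E"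
    and sm: "(\<lambda>e. Re (cinner e (S e))) summable_on E"
    using T by (auto simp: trace_class_def)
  have S: "positive_op S" using md by (simp add: is_modulus_def)
  then have bS: "bounded_clinear S" by (simp add: positive_op_def)
  have nTS: "norm (T x) = norm (S x)" for x
  proof -
    have "cinner (S x) (S x) = cinner (T x) (T x)"
      using md by (simp add: is_modulus_def positive_op_symmetric[OF S])
    then have "(norm (S x))\<^sup>2 = (norm (T x))\<^sup>2"
      by (simp only: cinner_self of_real_eq_iff)
    then show ?thesis by simp
  qed
  define A where "A = {f\<in>E. Re (cinner f (S f)) \<noteq> 0}"
  have "countable A" unfolding A_def using sm by (rule summable_countable_real)
  \<comment> \<open>Only countably many diagonal entries are nonzero. The extra vector 0 keeps the
    enumerated set nonempty; 0 and repeated pivots produce \<open>u n = 0\<close>.\<close>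
  define e where "e = from_nat_into (insert 0 A)"
  have e: "range e = insert 0 A"
    unfolding e_def using \<open>countable A\<close> by (intro range_from_nat_into) auto
  define C where "C = cholesky S e"
  define u where "u n = cholesky_vec (C n) (e n)" for n
  have C0: "C 0 = S" and CS: "\<And>n. C (Suc n) = (\<lambda>x. C n x - cinner (u n) x *\<^sub>C u n)"
    by (simp_all add: C_def u_def)
  have Cpos: "positive_op (C n)" for n
    by (induction n) (simp_all add: C0 S CS u_def cholesky_step(1))
  have Ce: "C n (e j) = 0" if "j < n" for j n
    using that
  proof (induction n)
    case (Suc n)
    show ?case
    proof (cases "j = n")
      case True
      then show ?thesis using cholesky_step(2)[OF Cpos[of n], of "e n"] by (simp add: CS u_def)
    next
      case False
      then have "C n (e j) = 0" using Suc by simp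
      then show ?thesis
        using cholesky_step(3)[OF Cpos[of n]] by (simp add: CS u_def)
    qed
  qed simp
  have ue: "cinner (u n) (e j) = 0" if "j < n" for n j
    unfolding u_def by (rule cholesky_step(3)[OF Cpos]) (rule Ce[OF that])
  have Csum: "C n x = S x - (\<Sum>k<n. cinner (u k) x *\<^sub>C u k)" for n x
    by (induction n) (simp_all add: C0 CS)
  \<comment> \<open>Each \<open>u n\<close> needs a preimage under \<open>S\<close>, because
    \<open>T\<close> is reached from \<open>S\<close> only through arguments: both have the same
    norm at every vector.\<close>
  have range_S: "\<exists>w. u n = S w" for n
  proof (induction n rule: less_induct)
    case (less n)
    then obtain w where w: "\<And>k. k < n \<Longrightarrow> u k = S (w k)" by metis
    have "linear S" using bS by (simp add: bounded_clinear_def bounded_linear.linear)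
    have "C n (e n) = S (e n - (\<Sum>k<n. cinner (u k) (e n) *\<^sub>C w k))"
      unfolding Csum bounded_clinear_diff[OF bS] linear_sum[OF \<open>linear S\<close>]
      by (simp add: w bounded_clinear_scaleC[OF bS])
    then have "u n = S ((1 / sqrt (Re (cinner (e n) (C n (e n))))) *\<^sub>R
        (e n - (\<Sum>k<n. cinner (u k) (e n) *\<^sub>C w k)))"
      unfolding bounded_clinear_scaleR[OF bS] by (simp add: u_def cholesky_vec_def)
    then show ?case ..
  qed
  then obtain w where w: "\<And>n. u n = S (w n)" by metis
  define v where "v n = T (w n)" for n
  have nv: "norm (v n) = norm (u n)" for n by (simp add: v_def nTS w)
  have usum: "(\<Sum>k<n. (cmod (cinner (u k) x))\<^sup>2) \<le> Re (cinner x (S x))" for n x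
  proof -
    have "cinner x (C n x) = cinner x (S x) - (\<Sum>k<n. of_real ((cmod (cinner (u k) x))\<^sup>2))"
      unfolding Csum cinner_diff_right cinner_sum_right cinner_scaleC_right complex_norm_square
      by (simp only: cinner_commute[symmetric])
    then have "Re (cinner x (C n x)) = Re (cinner x (S x)) - (\<Sum>k<n. (cmod (cinner (u k) x))\<^sup>2)"
      by simp
    moreover have "Re (cinner x (C n x)) \<ge> 0" using Cpos by (simp add: positive_op_def)
    ultimately show ?thesis by simp
  qed
  define \<tau> where "\<tau> = (\<Sum>\<^sub>\<infinity>f\<in>E. Re (cinner f (S f)))"
  \<comment> \<open>Summing \<open>usum\<close> over the basis, the squared norms of the
    \<open>u k\<close> are dominated by the trace of \<open>S\<close>.\<close>
  have "(\<Sum>k<n. (norm (u k))\<^sup>2) \<le> \<tau>" for n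
  proof (rule has_sum_mono)
    show "((\<lambda>f. \<Sum>k<n. (cmod (cinner f (u k)))\<^sup>2) has_sum (\<Sum>k<n. (norm (u k))\<^sup>2)) E"
      by (induction n) (auto intro!: has_sum_add onb_parseval_norm E)
    show "((\<lambda>f. Re (cinner f (S f))) has_sum \<tau>) E"
      unfolding \<tau>_def using sm by (rule has_sum_infsum)
    show "(\<Sum>k<n. (cmod (cinner f (u k)))\<^sup>2) \<le> Re (cinner f (S f))" for f
      using usum[of f n] by (subst cinner_commute) simp
  qed
  then have us: "(\<lambda>n. norm (u n) * norm (v n)) summable_on UNIV"
    by (intro summable_nonneg_imp_summable_on summableI_nonneg_bounded[where x = \<tau>])
      (auto simp: nv power2_eq_square)
  have Tsm: "(\<lambda>n. norm (cinner (u n) x *\<^sub>C v n)) summable_on UNIV"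
    and nb: "norm (cinner (u n) x *\<^sub>C v n) \<le> norm (u n) * norm (v n) * norm x" for x n
  proof -
    show nb: "norm (cinner (u n) x *\<^sub>C v n) \<le> norm (u n) * norm (v n) * norm x" for n
      using mult_right_mono[OF Cauchy_Schwarz_cinner[of "u n" x] norm_ge_zero[of "v n"]]
      by (simp add: norm_scaleC ac_simps)
    show "(\<lambda>n. norm (cinner (u n) x *\<^sub>C v n)) summable_on UNIV"
      by (rule Infinite_Sum.abs_summable_on_comparison_test'[OF summable_on_cmult_left[OF us, of "norm x"]]) (rule nb)
  qed
  define T' where "T' x = (\<Sum>\<^sub>\<infinity>n. cinner (u n) x *\<^sub>C v n)" for x
  have T': "((\<lambda>n. cinner (u n) x *\<^sub>C v n) has_sum T' x) UNIV" for x
    unfolding T'_def by (rule has_sum_infsum[OF Infinite_Sum.abs_summable_summable[OF Tsm]])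
  have bT': "bounded_clinear T'"
  proof (rule bounded_clinearI)
    show "T' (x + y) = T' x + T' y" for x y
      by (rule has_sum_unique[OF T'])
        (use has_sum_add[OF T'[of x] T'[of y]] in \<open>simp add: cinner_simps scaleC_add_left\<close>)
    show "T' (c *\<^sub>C x) = c *\<^sub>C T' x" for c x
      by (rule has_sum_unique[OF T'])
        (use has_sum_bounded_linear[OF bounded_linear_scaleC T'[of x], of c]
          in \<open>simp add: cinner_simps scaleC_scaleC\<close>)
    show "norm (T' x) \<le> (\<Sum>\<^sub>\<infinity>n. norm (u n) * norm (v n)) * norm x" for x
    proof -
      have "norm (T' x) \<le> (\<Sum>\<^sub>\<infinity>n. norm (u n) * norm (v n) * norm x)"
        unfolding T'_def
        by (rule norm_infsum_le[OF T'[unfolded T'_def] has_sum_infsum[OF summable_on_cmult_left[OF us, of "norm x"]]])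
          (rule nb)
      also have "\<dots> = (\<Sum>\<^sub>\<infinity>n. norm (u n) * norm (v n)) * norm x"
        by (rule infsum_cmult_left) (use us in simp)
      finally show ?thesis .
    qed
  qed
  \<comment> \<open>For a pivot the expansion breaks off, and what is left of \<open>f\<close> after
    subtracting the preimages is annihilated by \<open>S\<close>, hence by \<open>T\<close>. For a
    vanishing diagonal entry both sides are 0.\<close>
  have "T f = T' f" if f: "f \<in> E" for f
  proof (cases "f \<in> A")
    case True
    then obtain j where j: "e j = f" using e by (metis insertI2 imageE)
    have "((\<lambda>n. cinner (u n) f *\<^sub>C v n) has_sum (\<Sum>n<Suc j. cinner (u n) f *\<^sub>C v n)) UNIV"
      by (rule has_sum_finite_neutralI[where B = "{..<Suc j}"]) (auto simp: j[symmetric] ue)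
    then have T'f: "T' f = (\<Sum>n<Suc j. cinner (u n) f *\<^sub>C v n)"
      using has_sum_unique[OF T'] by blast
    let ?y = "f - (\<Sum>n<Suc j. cinner (u n) f *\<^sub>C w n)"
    have lin: "linear S" "linear T"
      using bS bT by (simp_all add: bounded_clinear_def bounded_linear.linear)
    have "S ?y = C (Suc j) f"
      unfolding Csum bounded_clinear_diff[OF bS] linear_sum[OF lin(1)]
      by (simp only: w bounded_clinear_scaleC[OF bS])
    also have "\<dots> = 0" using Ce[of j "Suc j"] j by simp
    finally have "T ?y = 0" using nTS[of ?y] by simp
    moreover have "T ?y = T f - (\<Sum>n<Suc j. cinner (u n) f *\<^sub>C v n)"
      unfolding bounded_clinear_diff[OF bT] linear_sum[OF lin(2)]
      by (simp only: v_def bounded_clinear_scaleC[OF bT])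
    ultimately show ?thesis
      unfolding T'f by simp
  next
    case False
    then have 0: "Re (cinner f (S f)) = 0" using f by (simp add: A_def)
    then have "T f = 0" using positive_op_eq_0[OF S 0] nTS[of f] by simp
    have "cinner (u n) f = 0" for n
    proof -
      have "(cmod (cinner (u n) f))\<^sup>2 \<le> (\<Sum>k<Suc n. (cmod (cinner (u k) f))\<^sup>2)"
        by (simp add: sum_nonneg)
      also have "\<dots> \<le> 0" using usum[where n = "Suc n" and x = f] 0 by simp
      finally show ?thesis by simp
    qed
    then show ?thesis using \<open>T f = 0\<close> by (simp add: T'_def)
  qed
  then have "T = T'" by (intro onb_operator_eqI[OF E bT bT']) simp
  then show ?thesis using that[of u v] T' us by simp
qed

text \<open>A nuclear decomposition survives composition with a bounded operator, so
  \<open>X \<circ> T\<close> has a basis independent trace without its modulus being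
  considered.\<close>

lemma trace_class_has_sum:
  fixes T X :: "'h::complex_hilbert_space \<Rightarrow> 'h"
  assumes "trace_class T" "bounded_clinear X" "is_onb E"
  shows "((\<lambda>e. cinner e (X (T e))) has_sum op_trace (X \<circ> T)) E"
proof -
  obtain u v :: "nat \<Rightarrow> 'h" where T: "\<And>x. ((\<lambda>n. cinner (u n) x *\<^sub>C v n) has_sum T x) UNIV"
    and s: "(\<lambda>n. norm (u n) * norm (v n)) summable_on UNIV"
    using trace_class_decomposition[OF assms(1)] by blast
  have bX: "bounded_linear X" using assms(2) by (simp add: bounded_clinear_def)
  have XT: "((\<lambda>n. cinner (u n) x *\<^sub>C X (v n)) has_sum (X \<circ> T) x) UNIV" for x
    using has_sum_bounded_linear[OF bX T[of x]]
    by (simp add: bounded_clinear_scaleC[OF assms(2)])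
  have s': "(\<lambda>n. norm (u n) * norm (X (v n))) summable_on UNIV"
  proof (rule summable_on_comparison_test[OF summable_on_cmult_left[OF s, of "onorm X"]])
    show "norm (u n) * norm (X (v n)) \<le> norm (u n) * norm (v n) * onorm X" for n
      using mult_left_mono[OF bounded_clinear_bound[OF assms(2), of "v n"] norm_ge_zero[of "u n"]]
      by (simp add: ac_simps)
  qed simp
  show ?thesis
    using nuclear_trace[OF assms(3) XT s'] op_trace_nuclear[OF assms(3) XT s'] by (simp add: comp_def)
qed

subsection \<open>Operators in an eigenbasis\<close>

locale eigenbasis =
  fixes W :: "'h::complex_hilbert_space set" and D F :: "'h \<Rightarrow> 'h" and c :: real
    and E :: "'h set" and lam eps :: "'h \<Rightarrow> real"
  assumes sa: "self_adjoint W D" and c: "c > 0" and bF: "bounded_clinear F"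
    and onb: "is_onb E"
    and eig: "e \<in> E \<Longrightarrow> e \<in> W \<and> D e = lam e *\<^sub>R e"
    and F_eig: "e \<in> E \<Longrightarrow> F e = eps e *\<^sub>R e"
    and eps_sq: "e \<in> E \<Longrightarrow> eps e * eps e = 1"
    and lam_eps: "e \<in> E \<Longrightarrow> lam e = eps e * \<bar>lam e\<bar>"
    and FF: "F (F x) = x"
begin

text \<open>\<open>p\<close> is the eigenvalue of \<open>|D|\<close> that enters
  \<open>\<delta>\<close>, and \<open>m\<close> the one that enters the powers. They differ only on
  the kernel.\<close>

definition p :: "'h \<Rightarrow> real" where "p e = \<bar>lam e\<bar>"

definition m :: "'h \<Rightarrow> real" where "m e = (if lam e = 0 then c else \<bar>lam e\<bar>)"

lemma m_pos: "m e > 0" using c by (simp add: m_def)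

lemma p_nonneg: "p e \<ge> 0" by (simp add: p_def)

lemma p_le_m: "p e \<le> m e" using c by (simp add: p_def m_def)

lemmas on = is_onb_orthonormal[OF onb]

lemma E_norm: "e \<in> E \<Longrightarrow> norm e = 1"
  using on by (simp add: orthonormal_def)

lemma lam_p: "e \<in> E \<Longrightarrow> lam e = eps e * p e"
  using lam_eps by (simp add: p_def)

lemma cinner_D:
  assumes "e \<in> E" "x \<in> W"
  shows "cinner e (D x) = of_real (lam e) * cinner e x"
  using self_adjoint_symmetric[OF sa _ assms(2), of e] eig[OF assms(1)] by (simp add: cinner_simps)

lemma cinner_F:
  assumes e: "e \<in> E"
  shows "cinner e (F x) = of_real (eps e) * cinner e x"
proof (rule has_sum_unique)
  show "((\<lambda>f. cinner e (F f) * cinner f x) has_sum cinner e (F x)) E"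
    by (rule onb_matrix_product[OF onb bF])
  show "((\<lambda>f. cinner e (F f) * cinner f x) has_sum of_real (eps e) * cinner e x) E"
    by (rule has_sum_finite_neutralI[where B = "{e}"])
      (use e on in \<open>auto simp: F_eig cinner_simps orthonormal_cinner\<close>)
qed

lemma W_memI:
  assumes "\<And>e. e \<in> E \<Longrightarrow> cinner e w = of_real (lam e) * cinner e y"
  shows "y \<in> W" "D y = w"
  using eigenbasis_memI[OF sa onb eig assms] by auto

text \<open>\<open>eigenproj\<close> is a definite description, so the projection has to be
  constructed first, as the sum over the basis vectors with eigenvalue \<open>l\<close>.\<close>

lemma eigenproj_properties:
  shows eigenproj_mem: "eigenproj W D l x \<in> eigenspace W D l"
    and cinner_eigenproj: "e \<in> E \<Longrightarrow> cinner e (eigenproj W D l x) = (if lam e = l then cinner e x else 0)"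
proof -
  define A where "A = {e\<in>E. lam e = l}"
  have A: "orthonormal A" using on by (auto simp: A_def orthonormal_def)
  define y where "y = (\<Sum>\<^sub>\<infinity>e\<in>A. cinner e x *\<^sub>C e)"
  note l2 = l2_vector_exists[OF A Bessel(1)[OF A, of x], folded y_def]
  have y: "cinner e y = (if lam e = l then cinner e x else 0)" if e: "e \<in> E" for e
  proof (cases "lam e = l")
    case True
    then show ?thesis using e l2(2)[of e] by (simp add: A_def)
  next
    case False
    then have "cinner e f = 0" if "f \<in> A" for f
      using that e on by (auto simp: A_def orthonormal_def)
    then show ?thesis using l2(3)[of e] False by simp
  qed
  have yl: "y \<in> eigenspace W D l"
    using W_memI[of "l *\<^sub>R y" y] by (auto simp: eigenspace_def y cinner_simps)
  have orth: "cinner v (x - y) = 0" if v: "v \<in> eigenspace W D l" for v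
  proof (rule has_sum_unique[OF onb_parseval[OF onb]])
    have "cinner v e * cinner e (x - y) = 0" if e: "e \<in> E" for e
    proof (cases "lam e = l")
      case False
      then have "cinner v e = 0"
        using eigenspaces_orthogonal[OF sa v, of e "lam e"] eig[OF e] by (auto simp: eigenspace_def)
      then show ?thesis by simp
    qed (simp add: y e cinner_simps)
    then show "((\<lambda>e. cinner v e * cinner e (x - y)) has_sum 0) E"
      by (intro has_sum_0) auto
  qed
  have "eigenproj W D l x = y"
    unfolding eigenproj_def
  proof (rule the_equality)
    show "y \<in> eigenspace W D l \<and> (\<forall>v\<in>eigenspace W D l. cinner v (x - y) = 0)" using yl orth by blast
  next
    fix z assume z: "z \<in> eigenspace W D l \<and> (\<forall>v\<in>eigenspace W D l. cinner v (x - z) = 0)"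
    have d: "z - y \<in> eigenspace W D l" using z yl eigenspace_diff[OF sa] by blast
    have "cinner (z - y) ((x - y) - (x - z)) = 0"
      unfolding cinner_diff_right[of "z - y" "x - y"] using orth[OF d] z d by simp
    then have "cinner (z - y) (z - y) = 0" by simp
    then show "z = y" by (simp add: cinner_eq_0_self)
  qed
  then show "eigenproj W D l x \<in> eigenspace W D l"
    and "e \<in> E \<Longrightarrow> cinner e (eigenproj W D l x) = (if lam e = l then cinner e x else 0)"
    using yl y by auto
qed

lemma cinner_fcalc:
  assumes x: "x \<in> fcalc_dom W D f" and e: "e \<in> E"
  shows "cinner e (fcalc W D f x) = f (lam e) * cinner e x"
proof -
  have "cinner (eigenproj W D l x) (eigenproj W D k x) = 0" if "l \<noteq> k" for l k
    using eigenspaces_orthogonal[OF sa eigenproj_mem eigenproj_mem that] .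
  then have s: "(\<lambda>l. f l *\<^sub>C eigenproj W D l x) summable_on UNIV"
    by (intro orthogonal_summable_on) (use x in \<open>simp_all add: fcalc_dom_def cinner_simps\<close>)
  show ?thesis
  proof (rule has_sum_unique)
    show "((\<lambda>l. cinner e (f l *\<^sub>C eigenproj W D l x)) has_sum cinner e (fcalc W D f x)) UNIV"
      unfolding fcalc_def
      by (rule has_sum_bounded_linear[OF bounded_linear_cinner_right has_sum_infsum[OF s]])
    show "((\<lambda>l. cinner e (f l *\<^sub>C eigenproj W D l x)) has_sum f (lam e) * cinner e x) UNIV"
      by (rule has_sum_finite_neutralI[where B = "{lam e}"])
        (auto simp: cinner_simps cinner_eigenproj[OF e])
  qed
qed

lemma eigenproj_basis: "e \<in> E \<Longrightarrow> eigenproj W D l e = (if lam e = l then e else 0)"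
  by (rule onb_eqI[OF onb]) (use on in \<open>auto simp: cinner_eigenproj orthonormal_cinner\<close>)

lemma basis_in_fcalc_dom: "e \<in> E \<Longrightarrow> e \<in> fcalc_dom W D f"
  unfolding fcalc_dom_def mem_Collect_eq
  by (rule finite_nonzero_values_imp_summable_on, rule finite_subset[of _ "{lam e}"])
    (auto simp: eigenproj_basis)

lemma fcalc_basis: "e \<in> E \<Longrightarrow> fcalc W D f e = f (lam e) *\<^sub>C e"
  by (rule onb_eqI[OF onb])
    (use on in \<open>auto simp: cinner_fcalc[OF basis_in_fcalc_dom] cinner_simps orthonormal_cinner\<close>)

lemma fcalc_dom_bounded:
  assumes f: "\<And>e. e \<in> E \<Longrightarrow> cmod (f (lam e)) \<le> K"
  shows "x \<in> fcalc_dom W D f"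
  unfolding fcalc_dom_def mem_Collect_eq
proof (rule nonneg_bdd_above_summable_on)
  show "bdd_above (sum (\<lambda>l. (norm (f l *\<^sub>C eigenproj W D l x))\<^sup>2) ` {A. A \<subseteq> UNIV \<and> finite A})"
  proof (rule bdd_aboveI2)
    fix L :: "real set" assume "L \<in> {A. A \<subseteq> UNIV \<and> finite A}"
    then have L: "finite L" by simp
    \<comment> \<open>The projections of \<open>x\<close> onto finitely many eigenspaces add up to a
      vector of norm at most that of \<open>x\<close>; this bounds all partial sums.\<close>
    define y where "y = (\<Sum>l\<in>L. eigenproj W D l x)"
    have "cinner e y = (if lam e \<in> L then cinner e x else 0)" if e: "e \<in> E" for e
      unfolding y_def cinner_sum_right using L by (simp add: cinner_eigenproj[OF e])
    then have "((\<lambda>e. cinner y e * cinner e (x - y)) has_sum 0) E"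
      by (intro has_sum_0) (auto simp: cinner_simps cinner_commute[of y])
    then have "cinner y (x - y) = 0" using has_sum_unique[OF onb_parseval[OF onb]] by blast
    then have "(norm (y + (x - y)))\<^sup>2 = (norm y)\<^sup>2 + (norm (x - y))\<^sup>2"
      by (simp only: norm_add_square) simp
    then have yx: "(norm y)\<^sup>2 \<le> (norm x)\<^sup>2" by simp
    have "norm (f l *\<^sub>C eigenproj W D l x) \<le> K * norm (eigenproj W D l x)" for l
    proof (cases "\<exists>e\<in>E. lam e = l")
      case True
      then show ?thesis using f by (auto simp: norm_scaleC intro: mult_right_mono)
    next
      case False
      then have "eigenproj W D l x = 0"
        by (intro onb_eqI[OF onb]) (auto simp: cinner_eigenproj)
      then show ?thesis by simp
    qed
    then have "(\<Sum>l\<in>L. (norm (f l *\<^sub>C eigenproj W D l x))\<^sup>2) \<le> (\<Sum>l\<in>L. (K * norm (eigenproj W D l x))\<^sup>2)"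
      by (intro sum_mono power_mono) auto
    also have "\<dots> = K\<^sup>2 * (\<Sum>l\<in>L. (norm (eigenproj W D l x))\<^sup>2)"
      by (simp add: power_mult_distrib sum_distrib_left)
    also have "(\<Sum>l\<in>L. (norm (eigenproj W D l x))\<^sup>2) = (norm y)\<^sup>2"
      unfolding y_def
      by (rule norm_sum_orthogonal[symmetric, OF L]) (rule eigenspaces_orthogonal[OF sa eigenproj_mem eigenproj_mem])
    finally show "(\<Sum>l\<in>L. (norm (f l *\<^sub>C eigenproj W D l x))\<^sup>2) \<le> K\<^sup>2 * (norm x)\<^sup>2"
      using yx by (meson mult_left_mono order_trans zero_le_power2)
  qed
qed simp

text \<open>Used in place of functions of \<open>D\<close>: as \<open>g\<close> depends on the basis
  vector, factors made of \<open>p\<close> and of \<open>m\<close> can be combined freely, and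
  bounded \<open>g\<close> raise no domain questions.\<close>

definition diag_op :: "('h \<Rightarrow> complex) \<Rightarrow> 'h \<Rightarrow> 'h" where
  "diag_op g x = (\<Sum>\<^sub>\<infinity>e\<in>E. (g e * cinner e x) *\<^sub>C e)"

lemma diag_op_has_sum:
  assumes g: "\<And>e. e \<in> E \<Longrightarrow> cmod (g e) \<le> K"
  shows "((\<lambda>e. cinner e x *\<^sub>C g e *\<^sub>C e) has_sum diag_op g x) E"
    and "e \<in> E \<Longrightarrow> cinner e (diag_op g x) = g e * cinner e x"
    and "norm (diag_op g x) \<le> \<bar>K\<bar> * norm x"
proof -
  have g2: "(cmod (g e * cinner e x))\<^sup>2 \<le> K\<^sup>2 * (cmod (cinner e x))\<^sup>2" if "e \<in> E" for e
    using power_mono[OF g[OF that], of 2] by (simp add: norm_mult power_mult_distrib mult_right_mono)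
  then have "(\<lambda>e. (cmod (g e * cinner e x))\<^sup>2) summable_on E"
    by (intro summable_on_comparison_test[OF summable_on_cmult_right[OF Bessel(1)[OF on, of x], of "K\<^sup>2"]]) auto
  note l2 = l2_vector_exists[OF on this, folded diag_op_def]
  have "((\<lambda>e. (g e * cinner e x) *\<^sub>C e) has_sum diag_op g x) E"
    unfolding diag_op_def by (rule has_sum_infsum[OF l2(1)])
  then show "((\<lambda>e. cinner e x *\<^sub>C g e *\<^sub>C e) has_sum diag_op g x) E"
    by (simp add: scaleC_scaleC mult.commute)
  show "e \<in> E \<Longrightarrow> cinner e (diag_op g x) = g e * cinner e x" by (rule l2(2))
  have "(norm (diag_op g x))\<^sup>2 \<le> K\<^sup>2 * (norm x)\<^sup>2"
  proof (rule has_sum_mono)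
    show "((\<lambda>e. (cmod (cinner e (diag_op g x)))\<^sup>2) has_sum (norm (diag_op g x))\<^sup>2) E"
      by (rule onb_parseval_norm[OF onb])
    show "((\<lambda>e. K\<^sup>2 * (cmod (cinner e x))\<^sup>2) has_sum K\<^sup>2 * (norm x)\<^sup>2) E"
      by (intro has_sum_cmult_right onb_parseval_norm[OF onb])
  qed (use g2 l2(2) in auto)
  then have "(norm (diag_op g x))\<^sup>2 \<le> (\<bar>K\<bar> * norm x)\<^sup>2" by (simp add: power_mult_distrib)
  then show "norm (diag_op g x) \<le> \<bar>K\<bar> * norm x" by (rule power2_le_imp_le) simp
qed

lemma diag_op_eqI:
  assumes "\<And>e. e \<in> E \<Longrightarrow> cmod (g e) \<le> K" "\<And>e. e \<in> E \<Longrightarrow> cinner e y = g e * cinner e x"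
  shows "y = diag_op g x"
proof (rule onb_eqI[OF onb])
  fix e assume "e \<in> E"
  then show "cinner e y = cinner e (diag_op g x)"
    by (subst diag_op_has_sum(2)[where K = K]) (use assms in auto)
qed

lemma op_trace_basis:
  assumes "\<And>x. ((\<lambda>e. cinner e x *\<^sub>C v e) has_sum T x) E" "(\<lambda>e. norm (v e)) summable_on E"
  shows "op_trace T = (\<Sum>\<^sub>\<infinity>e\<in>E. cinner e (v e))"
proof (rule op_trace_nuclear[OF onb assms(1)])
  show "(\<lambda>e. norm e * norm (v e)) summable_on E"
    using assms(2) by (simp add: E_norm cong: summable_on_cong)
qed

text \<open>The matrix elements of \<open>T'\<close> are those of the commutator of \<open>|D|\<close> with \<open>T\<close>; no domains
  are involved in this relation.\<close>

definition der :: "('h \<Rightarrow> 'h) \<Rightarrow> ('h \<Rightarrow> 'h) \<Rightarrow> bool" where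
  "der T T' \<longleftrightarrow> bounded_clinear T \<and> bounded_clinear T'
     \<and> (\<forall>e\<in>E. \<forall>f\<in>E. cinner e (T' f) = of_real (p e - p f) * cinner e (T f))"

section \<open>The derivation on matrix elements\<close>

lemma derD: "der T T' \<Longrightarrow> e \<in> E \<Longrightarrow> f \<in> E \<Longrightarrow> cinner e (T' f) = of_real (p e - p f) * cinner e (T f)"
  by (simp add: der_def)

lemma der_unique: "der T A \<Longrightarrow> der T B \<Longrightarrow> A = B"
  by (rule onb_operator_eqI[OF onb]) (auto simp: der_def)

text \<open>\<open>E\<close> takes the role of the dense domain: two bounded operators that agree on
  a basis are equal, which is what the definite description requires.\<close>

lemma comm_ext_unique:
  assumes "bounded_comm V A T" "E \<subseteq> V"
  shows "bounded_clinear (comm_ext V A T)" "x \<in> V \<Longrightarrow> comm_ext V A T x = A (T x) - T (A x)"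
proof -
  obtain S where S: "bounded_clinear S" "\<And>x. x \<in> V \<Longrightarrow> S x = commutator A T x"
    using assms(1) by (auto simp: bounded_comm_def)
  have "comm_ext V A T = S"
    unfolding comm_ext_def
  proof (rule the_equality)
    fix S' assume S': "bounded_clinear S' \<and> (\<forall>x\<in>V. S' x = commutator A T x)"
    show "S' = S"
      by (rule onb_operator_eqI[OF onb]) (use S' S assms(2) in auto)
  qed (use S in auto)
  then show "bounded_clinear (comm_ext V A T)" "x \<in> V \<Longrightarrow> comm_ext V A T x = A (T x) - T (A x)"
    using S by (auto simp: commutator_def)
qed

lemma der_delta:
  assumes "bounded_comm (absD_dom W D) (absD W D) T"
  shows "der T (\<delta> W D T)"
  unfolding der_def
proof (intro conjI ballI)
  have E: "E \<subseteq> absD_dom W D" by (auto simp: absD_dom_def intro: basis_in_fcalc_dom)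
  note ce = comm_ext_unique[OF assms E, folded \<delta>_def]
  show bT: "bounded_clinear T" using assms by (simp add: bounded_comm_def)
  show "bounded_clinear (\<delta> W D T)" by (rule ce)
  fix e f assume ef: "e \<in> E" "f \<in> E"
  have "T f \<in> absD_dom W D" using assms ef E by (auto simp: bounded_comm_def)
  then have "cinner e (absD W D (T f)) = of_real (p e) * cinner e (T f)"
    using cinner_fcalc ef by (simp add: absD_def absD_dom_def p_def)
  moreover have "absD W D f = of_real (p f) *\<^sub>C f"
    using fcalc_basis[OF ef(2)] by (simp add: absD_def p_def)
  ultimately have "cinner e (absD W D (T f) - T (absD W D f)) = of_real (p e - p f) * cinner e (T f)"
    by (simp add: cinner_simps bounded_clinear_scaleC[OF bT] algebra_simps)
  then show "cinner e (\<delta> W D T f) = of_real (p e - p f) * cinner e (T f)"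
    using ce(2)[of f] ef E by auto
qed

lemma cinner_comm_ext:
  assumes "bounded_comm W D T"
  shows "bounded_clinear (comm_ext W D T)"
    and "e \<in> E \<Longrightarrow> f \<in> E \<Longrightarrow> cinner e (comm_ext W D T f) = of_real (lam e - lam f) * cinner e (T f)"
proof -
  have EW: "E \<subseteq> W" using eig by blast
  note ce = comm_ext_unique[OF assms EW]
  have bT: "bounded_clinear T" using assms by (simp add: bounded_comm_def)
  show "bounded_clinear (comm_ext W D T)" by (rule ce)
  assume ef: "e \<in> E" "f \<in> E"
  have "T f \<in> W" using assms ef EW by (auto simp: bounded_comm_def)
  then show "cinner e (comm_ext W D T f) = of_real (lam e - lam f) * cinner e (T f)"
    using ef eig[OF ef(2)] EW
    by (subst ce(2)) (auto simp: cinner_D cinner_simps bounded_clinear_scaleR[OF bT] algebra_simps)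
qed

lemma der_add:
  assumes "der S S'" "der T T'"
  shows "der (\<lambda>x. S x + T x) (\<lambda>x. S' x + T' x)"
  unfolding der_def
proof (intro conjI ballI)
  show "bounded_clinear (\<lambda>x. S x + T x)" "bounded_clinear (\<lambda>x. S' x + T' x)"
    using assms by (simp_all add: der_def bounded_clinear_plus)
qed (simp only: cinner_add_right distrib_left derD[OF assms(1)] derD[OF assms(2)])

lemma der_scale:
  assumes "der S S'"
  shows "der (\<lambda>x. a *\<^sub>C S x) (\<lambda>x. a *\<^sub>C S' x)"
  unfolding der_def
proof (intro conjI ballI)
  show "bounded_clinear (\<lambda>x. a *\<^sub>C S x)" "bounded_clinear (\<lambda>x. a *\<^sub>C S' x)"
    using assms by (simp_all add: der_def bounded_clinear_cmult)
qed (simp only: cinner_scaleC_right derD[OF assms] mult.left_commute)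

lemma der_F: "der F (\<lambda>x. 0)"
  using bF on by (auto simp: der_def bounded_clinear_const_0 F_eig cinner_simps orthonormal_cinner)

lemma der_id: "der (\<lambda>x. x) (\<lambda>x. 0)"
  using on by (auto simp: der_def bounded_clinear_id bounded_clinear_const_0 orthonormal_cinner)

lemma der_zero: "der (\<lambda>x. 0) (\<lambda>x. 0)"
  by (auto simp: der_def bounded_clinear_const_0)

text \<open>The Leibniz rule is \<open>p e - p f = (p e - p g) + (p g - p f)\<close>, inserted into
  the sum over the intermediate index \<open>g\<close>.\<close>

lemma der_comp:
  assumes S: "der S S'" and T: "der T T'"
  shows "der (\<lambda>x. S (T x)) (\<lambda>x. S' (T x) + S (T' x))"
  unfolding der_def
proof (intro conjI ballI)
  have b: "bounded_clinear S" "bounded_clinear S'" "bounded_clinear T" "bounded_clinear T'"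
    using S T by (auto simp: der_def)
  show "bounded_clinear (\<lambda>x. S (T x))"
    by (rule bounded_clinear_compose[OF b(1,3)])
  show "bounded_clinear (\<lambda>x. S' (T x) + S (T' x))"
    by (rule bounded_clinear_plus[OF bounded_clinear_compose[OF b(2,3)] bounded_clinear_compose[OF b(1,4)]])
  fix e f assume ef: "e \<in> E" "f \<in> E"
  have "((\<lambda>g. of_real (p e - p f) * (cinner e (S g) * cinner g (T f))) has_sum
      of_real (p e - p f) * cinner e (S (T f))) E"
    by (rule has_sum_cmult_right[OF onb_matrix_product[OF onb b(1)]])
  moreover have "((\<lambda>g. cinner e (S' g) * cinner g (T f) + cinner e (S g) * cinner g (T' f)) has_sum
      cinner e (S' (T f)) + cinner e (S (T' f))) E"
    by (rule has_sum_add[OF onb_matrix_product[OF onb b(2)] onb_matrix_product[OF onb b(1)]])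
  then have "((\<lambda>g. of_real (p e - p f) * (cinner e (S g) * cinner g (T f))) has_sum
      cinner e (S' (T f)) + cinner e (S (T' f))) E"
    by (rule has_sum_cong[THEN iffD1, rotated])
      (use ef in \<open>simp add: derD[OF S] derD[OF T] algebra_simps\<close>)
  ultimately show "cinner e (S' (T f) + S (T' f)) = of_real (p e - p f) * cinner e (S (T f))"
    by (simp add: cinner_simps has_sum_unique)
qed

lemma matrix_bound:
  assumes "bounded_clinear T" "e \<in> E" "f \<in> E"
  shows "cmod (cinner e (T f)) \<le> onorm T"
  using Cauchy_Schwarz_cinner[of e "T f"] bounded_clinear_bound[OF assms(1), of f]
  by (simp add: E_norm assms)

end

subsection \<open>Meromorphic continuation from a right half-plane\<close>

text \<open>Values at poles are left open, which makes the notion stable under sums; functions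
  normalised at their poles are not, since poles may cancel. Holomorphy on the half-plane ensures
  that removing singularities does not change the values there.\<close>

definition mero_cont :: "(complex \<Rightarrow> complex) \<Rightarrow> (complex \<Rightarrow> complex) \<Rightarrow> bool" where
  "mero_cont g f \<longleftrightarrow> f meromorphic_on UNIV
     \<and> (\<exists>R. f holomorphic_on {z. Re z > R} \<and> (\<forall>z. Re z > R \<longrightarrow> f z = g z))"

lemma open_Re_gt: "open {z. Re z > a}"
  by (rule open_halfspace_Re_gt)

lemma connected_Re_gt: "connected {z. Re z > a}"
  by (intro convex_connected convex_halfspace_Re_gt)

text \<open>The identity theorem in a form that also reaches poles: on punctured neighbourhoods, the
  difference vanishes near every point or is nonzero near every point.\<close>

lemma meromorphic_identity:
  assumes f: "f meromorphic_on A" and h: "h meromorphic_on A" and A: "open A" "connected A"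
    and w: "w \<in> A" "eventually (\<lambda>z. f z = h z) (at w)" and v: "v \<in> A"
  shows "eventually (\<lambda>z. f z = h z) (at v)"
proof -
  have "(\<lambda>z. f z - h z) meromorphic_on A" by (intro meromorphic_intros f h)
  from meromorphic_imp_constant_or_avoid[OF this A, of 0]
  consider "\<forall>x\<in>A. eventually (\<lambda>z. f z - h z = 0) (at x)" | "\<forall>x\<in>A. eventually (\<lambda>z. f z - h z \<noteq> 0) (at x)"
    by (auto simp: eventually_cosparse_open_eq[OF A(1)])
  then show ?thesis
  proof cases
    case 1
    then show ?thesis using v by simp
  next
    case 2
    then have "eventually (\<lambda>z. f z - h z \<noteq> 0) (at w)" using w(1) by blast
    with w(2) have "eventually (\<lambda>z. False) (at w)" by eventually_elim simp
    then show ?thesis by simp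
  qed
qed

lemma holomorphic_imp_meromorphic_on: "f holomorphic_on A \<Longrightarrow> open A \<Longrightarrow> f meromorphic_on A"
  by (intro analytic_on_imp_meromorphic_on) (simp add: analytic_on_open)

text \<open>This turns convergence of a series further to the left into absence of poles of the
  continuation.\<close>

lemma mero_cont_eq_holomorphic:
  assumes f: "mero_cont g f" and h: "h holomorphic_on {z. Re z > a}" "\<And>z. Re z > R \<Longrightarrow> h z = g z"
    and w: "Re w > a"
  shows "eventually (\<lambda>z. f z = h z) (at w)"
proof -
  obtain R' where R': "\<And>z. Re z > R' \<Longrightarrow> f z = g z" using f by (auto simp: mero_cont_def)
  define u where "u = complex_of_real (max a (max R R') + 1)"
  have "eventually (\<lambda>z. z \<in> {z. Re z > max R R'}) (at u)"
    by (rule eventually_at_in_open'[OF open_Re_gt]) (simp add: u_def max_def)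
  then have "eventually (\<lambda>z. f z = h z) (at u)"
    by eventually_elim (simp add: R' h)
  then show ?thesis
    by (rule meromorphic_identity[where A = "{z. Re z > a}", rotated 5])
      (use f w in \<open>auto simp: mero_cont_def u_def open_Re_gt connected_Re_gt
         intro: meromorphic_on_subset holomorphic_imp_meromorphic_on[OF h(1)]\<close>)
qed

lemma mero_cont_unique:
  assumes f: "mero_cont g f" and h: "mero_cont g h"
  shows "eventually (\<lambda>z. f z = h z) (at w)"
proof -
  obtain R where R: "h holomorphic_on {z. Re z > R}" "\<And>z. Re z > R \<Longrightarrow> h z = g z"
    using h by (auto simp: mero_cont_def)
  have "eventually (\<lambda>z. f z = h z) (at (complex_of_real (R + 1)))"
    by (rule mero_cont_eq_holomorphic[OF f R]) auto
  then show ?thesis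
    by (rule meromorphic_identity[where A = UNIV, rotated 5]) (use f h in \<open>auto simp: mero_cont_def\<close>)
qed

lemma mero_ext_eq:
  assumes f: "mero_cont g f"
  shows "mero_ext g = remove_sings f"
  unfolding mero_ext_def
proof (rule the_equality)
  obtain R where R: "f holomorphic_on {z. Re z > R}" "\<And>z. Re z > R \<Longrightarrow> f z = g z"
    and fm: "f meromorphic_on UNIV"
    using f by (auto simp: mero_cont_def)
  have eq: "remove_sings f z = g z" if z: "Re z > R" for z
  proof -
    have "f analytic_on {z}"
      using R(1) z open_Re_gt by (auto simp: analytic_at)
    then show ?thesis using R(2)[OF z] by simp
  qed
  then show "remove_sings f nicely_meromorphic_on UNIV \<and> (\<exists>R. \<forall>z. Re z > R \<longrightarrow> remove_sings f z = g z)"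
    using remove_sings_nicely_meromorphic[OF fm] by blast
  fix h assume "h nicely_meromorphic_on UNIV \<and> (\<exists>R. \<forall>z. Re z > R \<longrightarrow> h z = g z)"
  then obtain R' where h: "h nicely_meromorphic_on UNIV" and R': "\<And>z. Re z > R' \<Longrightarrow> h z = g z" by blast
  have r: "remove_sings f nicely_meromorphic_on UNIV" by (rule remove_sings_nicely_meromorphic[OF fm])
  define u where "u = complex_of_real (max R R' + 1)"
  have "eventually (\<lambda>z. z \<in> {z. Re z > max R R'}) (at u)"
    by (rule eventually_at_in_open'[OF open_Re_gt]) (simp add: u_def max_def)
  then have "eventually (\<lambda>z. h z = remove_sings f z) (at u)"
    by eventually_elim (simp add: R' eq)
  then have ev: "eventually (\<lambda>z. h z = remove_sings f z) (at w)" for w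
    by (rule meromorphic_identity[where A = UNIV, rotated 5])
      (use h r in \<open>auto simp: nicely_meromorphic_on_def\<close>)
  \<comment> \<open>Agreement on punctured neighbourhoods fixes the values: at a pole both are 0,
    elsewhere both are the common limit.\<close>
  show "h = remove_sings f"
  proof
    fix w
    have "is_pole h w \<longleftrightarrow> is_pole (remove_sings f) w" by (intro is_pole_cong ev refl)
    moreover have "(h \<longlongrightarrow> c) (at w) \<longleftrightarrow> (remove_sings f \<longlongrightarrow> c) (at w)" for c
      by (intro filterlim_cong refl ev)
    moreover have "(is_pole h w \<and> h w = 0) \<or> (h \<longlongrightarrow> h w) (at w)"
      "(is_pole (remove_sings f) w \<and> remove_sings f w = 0) \<or> (remove_sings f \<longlongrightarrow> remove_sings f w) (at w)"
      using h r by (auto simp: nicely_meromorphic_on_def)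
    moreover have "\<not> (is_pole h w \<and> (h \<longlongrightarrow> c) (at w))" for c
      using not_tendsto_and_filterlim_at_infinity[of "at w" h c] by (auto simp: is_pole_def)
    ultimately show "h w = remove_sings f w"
      using LIM_unique[of h] by metis
  qed
qed

lemma residue_mero_ext:
  assumes f: "mero_cont g f" and lim: "((\<lambda>z. z * f z) \<longlongrightarrow> r) (at 0)"
  shows "residue (mero_ext g) 0 = r"
proof -
  have "f meromorphic_on UNIV" using f by (simp add: mero_cont_def)
  then have iso: "isolated_singularity_at f 0" by (simp add: meromorphic_on_altdef)
  then obtain e where e: "e > 0" "f analytic_on ball 0 e - {0}"
    by (auto simp: isolated_singularity_at_def)
  have "residue f 0 = r"
    by (rule residue_simple'[of "ball 0 e"]) (use e lim in \<open>auto simp: analytic_imp_holomorphic mult.commute\<close>)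
  moreover have "residue (remove_sings f) 0 = residue f 0"
    using \<open>f meromorphic_on UNIV\<close> by (intro residue_remove_sings) (auto simp: meromorphic_on_altdef)
  ultimately show ?thesis by (simp add: mero_ext_eq[OF f])
qed

lemma value_mero_ext:
  assumes f: "mero_cont g f" and lim: "(f \<longlongrightarrow> v) (at 0)"
  shows "mero_ext g 0 = v"
  unfolding mero_ext_eq[OF f] using lim by (rule remove_sings_eqI)

lemma mero_cont_cong:
  assumes "mero_cont g f" "\<And>z. Re z > R \<Longrightarrow> g z = h z"
  shows "mero_cont h f"
proof -
  obtain R' where R': "f holomorphic_on {z. Re z > R'}" "\<And>z. Re z > R' \<Longrightarrow> f z = g z"
    using assms(1) by (auto simp: mero_cont_def)
  have "f holomorphic_on {z. Re z > max R R'}"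
    by (rule holomorphic_on_subset[OF R'(1)]) auto
  then show ?thesis
    using assms R'(2) unfolding mero_cont_def by (intro conjI exI[of _ "max R R'"]) auto
qed

lemma mero_cont_add:
  assumes "mero_cont g f" "mero_cont g' f'"
  shows "mero_cont (\<lambda>z. g z + g' z) (\<lambda>z. f z + f' z)"
proof -
  obtain R where R: "f holomorphic_on {z. Re z > R}" "\<And>z. Re z > R \<Longrightarrow> f z = g z"
    using assms(1) by (auto simp: mero_cont_def)
  obtain R' where R': "f' holomorphic_on {z. Re z > R'}" "\<And>z. Re z > R' \<Longrightarrow> f' z = g' z"
    using assms(2) by (auto simp: mero_cont_def)
  have "f holomorphic_on {z. Re z > max R R'}" "f' holomorphic_on {z. Re z > max R R'}"
    by (rule holomorphic_on_subset[OF R(1)] holomorphic_on_subset[OF R'(1)]; auto)+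
  then show ?thesis
    using assms R(2) R'(2) unfolding mero_cont_def
    by (intro conjI exI[of _ "max R R'"] meromorphic_intros holomorphic_intros) auto
qed

lemma mero_cont_mult_entire:
  assumes "mero_cont g f" "q holomorphic_on UNIV"
  shows "mero_cont (\<lambda>z. q z * g z) (\<lambda>z. q z * f z)"
proof -
  obtain R where R: "f holomorphic_on {z. Re z > R}" "\<And>z. Re z > R \<Longrightarrow> f z = g z"
    using assms(1) by (auto simp: mero_cont_def)
  have "q holomorphic_on {z. Re z > R}" by (rule holomorphic_on_subset[OF assms(2)]) simp
  then have "(\<lambda>z. q z * f z) holomorphic_on {z. Re z > R}" by (rule holomorphic_on_mult[OF _ R(1)])
  moreover have "(\<lambda>z. q z * f z) meromorphic_on UNIV"
    using assms(1) by (intro meromorphic_on_mult[OF holomorphic_imp_meromorphic_on[OF assms(2) open_UNIV]])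
      (simp add: mero_cont_def)
  ultimately show ?thesis
    using R(2) unfolding mero_cont_def by auto
qed

lemma mero_cont_entire: "q holomorphic_on UNIV \<Longrightarrow> mero_cont q q"
  unfolding mero_cont_def
  by (intro conjI exI[of _ 0] holomorphic_imp_meromorphic_on) (auto intro: holomorphic_on_subset)

lemma mero_cont_shift:
  assumes "mero_cont g f"
  shows "mero_cont (\<lambda>z. g (z + a)) (\<lambda>z. f (z + a))"
proof -
  obtain R where R: "f holomorphic_on {z. Re z > R}" "\<And>z. Re z > R \<Longrightarrow> f z = g z"
    and m: "f meromorphic_on UNIV"
    using assms(1) by (auto simp: mero_cont_def)
  have "(\<lambda>z. f (z + a)) holomorphic_on {z. Re z > R - Re a}"
    by (rule holomorphic_on_compose_gen[OF _ R(1), unfolded comp_def]) (auto intro!: holomorphic_intros)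
  moreover have "(\<lambda>z. f (z + a)) meromorphic_on UNIV"
    by (rule meromorphic_on_compose[OF m]) (auto intro!: analytic_intros)
  ultimately show ?thesis
    unfolding mero_cont_def using R(2) by (intro conjI exI[of _ "R - Re a"]) auto
qed

text \<open>Near a point of \<open>S\<close> the product \<open>(z - s) f(z)\<close> has a limit, so
  its isolated singularity is not essential; division by \<open>z - s\<close> keeps
  meromorphy.\<close>

lemma meromorphic_on_simple_poles:
  assumes f: "f holomorphic_on - S" and S: "\<And>z. \<not> z islimpt S"
    and p: "\<And>s. s \<in> S \<Longrightarrow> \<exists>r. ((\<lambda>z. (z - s) * f z) \<longlongrightarrow> r) (at s)"
  shows "f meromorphic_on UNIV"
proof -
  have cl: "closed (S - {s})" for s
    unfolding closed_limpt using S islimpt_subset[of _ "S - {s}" S] by blast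
  have "f meromorphic_on {s}" for s
  proof (cases "s \<in> S")
    case False
    then have "f analytic_on {s}"
      using f cl[of s] by (subst analytic_at) (auto intro!: exI[of _ "- S"])
    then show ?thesis by (rule analytic_on_imp_meromorphic_on)
  next
    case True
    then obtain r where r: "((\<lambda>z. (z - s) * f z) \<longlongrightarrow> r) (at s)" using p by blast
    define h where "h z = (z - s) * f z" for z
    have "open (- (S - {s}))" by (rule open_Compl[OF cl])
    then obtain e where e: "e > 0" "ball s e \<subseteq> - (S - {s})"
      by (metis Compl_iff Diff_iff insertI1 openE)
    have fh: "f holomorphic_on ball s e - {s}"
      by (rule holomorphic_on_subset[OF f]) (use e in auto)
    have "h analytic_on ball s e - {s}"
      unfolding h_def by (subst analytic_on_open) (auto intro!: holomorphic_intros fh)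
    then have "isolated_singularity_at h s"
      unfolding isolated_singularity_at_def using e by blast
    moreover have "not_essential h s"
      using r unfolding not_essential_def h_def by blast
    ultimately have "h meromorphic_on {s}" by (simp add: meromorphic_at_iff)
    then have "(\<lambda>z. h z / (z - s)) meromorphic_on {s}" by (intro meromorphic_intros)
    moreover have "eventually (\<lambda>z. h z / (z - s) = f z) (at s)"
      by (auto simp: eventually_at_filter h_def)
    ultimately show ?thesis
      by (subst (asm) meromorphic_on_cong[where g = f and B = "{s}"]) auto
  qed
  then show ?thesis by (subst meromorphic_on_meromorphic_at) simp
qed

text \<open>The Weierstrass test for unordered sums: the tail of \<open>B\<close> bounds all tails,
  uniformly on \<open>K\<close>.\<close>

lemma uniform_limit_infsum:
  fixes f :: "'i \<Rightarrow> 'a \<Rightarrow> complex"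
  assumes B: "B summable_on I" and f: "\<And>i z. i \<in> I \<Longrightarrow> z \<in> K \<Longrightarrow> cmod (f i z) \<le> B i"
  shows "uniform_limit K (\<lambda>X z. \<Sum>i\<in>X. f i z) (\<lambda>z. \<Sum>\<^sub>\<infinity>i\<in>I. f i z) (finite_subsets_at_top I)"
proof (rule uniform_limitI)
  fix \<epsilon> :: real assume "\<epsilon> > 0"
  have B': "(sum B \<longlongrightarrow> (\<Sum>\<^sub>\<infinity>i\<in>I. B i)) (finite_subsets_at_top I)"
    by (rule infsum_tendsto[OF B])
  then have "eventually (\<lambda>X. dist (sum B X) (\<Sum>\<^sub>\<infinity>i\<in>I. B i) < \<epsilon>) (finite_subsets_at_top I)"
    using \<open>\<epsilon> > 0\<close> by (rule tendstoD)
  moreover have "eventually (\<lambda>X. finite X \<and> X \<subseteq> I) (finite_subsets_at_top I)"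
    by (rule eventually_finite_subsets_at_top_weakI) auto
  ultimately show "eventually (\<lambda>X. \<forall>z\<in>K. dist (\<Sum>i\<in>X. f i z) (\<Sum>\<^sub>\<infinity>i\<in>I. f i z) < \<epsilon>) (finite_subsets_at_top I)"
  proof eventually_elim
    case (elim X)
    then have X: "finite X" "X \<subseteq> I" by auto
    show ?case
    proof
      fix z assume z: "z \<in> K"
      have BI: "(B has_sum ((\<Sum>\<^sub>\<infinity>i\<in>I. B i) - sum B X)) (I - X)"
        using X B by (intro has_sum_Diff has_sum_infsum) auto
      have "(\<lambda>i. f i z) summable_on I"
        by (rule Infinite_Sum.abs_summable_summable, rule Infinite_Sum.abs_summable_on_comparison_test'[OF B f]) (use z in auto)
      then have fI: "((\<lambda>i. f i z) has_sum ((\<Sum>\<^sub>\<infinity>i\<in>I. f i z) - (\<Sum>i\<in>X. f i z))) (I - X)"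
        using X by (intro has_sum_Diff has_sum_infsum) auto
      have "cmod ((\<Sum>\<^sub>\<infinity>i\<in>I. f i z) - (\<Sum>i\<in>X. f i z)) \<le> (\<Sum>\<^sub>\<infinity>i\<in>I. B i) - sum B X"
        by (rule norm_infsum_le[OF fI BI]) (use f z in auto)
      then show "dist (\<Sum>i\<in>X. f i z) (\<Sum>\<^sub>\<infinity>i\<in>I. f i z) < \<epsilon>"
        using elim by (simp add: dist_norm norm_minus_commute)
    qed
  qed
qed

lemma continuous_on_infsum:
  fixes f :: "'i \<Rightarrow> 'a::topological_space \<Rightarrow> complex"
  assumes "B summable_on I" "\<And>i z. i \<in> I \<Longrightarrow> z \<in> K \<Longrightarrow> cmod (f i z) \<le> B i"
    and f: "\<And>i. i \<in> I \<Longrightarrow> continuous_on K (f i)"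
  shows "continuous_on K (\<lambda>z. \<Sum>\<^sub>\<infinity>i\<in>I. f i z)"
proof (rule uniform_limit_theorem[OF _ uniform_limit_infsum[OF assms(1,2)]])
  show "\<forall>\<^sub>F X in finite_subsets_at_top I. continuous_on K (\<lambda>z. \<Sum>i\<in>X. f i z)"
    by (rule eventually_finite_subsets_at_top_weakI) (auto intro!: continuous_on_sum f)
qed auto

lemma holomorphic_on_infsum:
  fixes f :: "'i \<Rightarrow> complex \<Rightarrow> complex"
  assumes U: "open U" and f: "\<And>i. i \<in> I \<Longrightarrow> f i holomorphic_on U"
    and bd: "\<And>z. z \<in> U \<Longrightarrow> \<exists>r>0. \<exists>B. cball z r \<subseteq> U \<and> B summable_on I \<and> (\<forall>i\<in>I. \<forall>w\<in>cball z r. cmod (f i w) \<le> B i)"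
  shows "(\<lambda>z. \<Sum>\<^sub>\<infinity>i\<in>I. f i z) holomorphic_on U"
proof -
  have "\<exists>r>0. (\<lambda>z. \<Sum>\<^sub>\<infinity>i\<in>I. f i z) holomorphic_on ball z r" if z: "z \<in> U" for z
  proof -
    obtain r B where r: "r > 0" "cball z r \<subseteq> U" "B summable_on I"
      "\<And>i w. i \<in> I \<Longrightarrow> w \<in> cball z r \<Longrightarrow> cmod (f i w) \<le> B i"
      using bd[OF z] by blast
    have "eventually (\<lambda>X. continuous_on (cball z r) (\<lambda>w. \<Sum>i\<in>X. f i w) \<and> (\<lambda>w. \<Sum>i\<in>X. f i w) holomorphic_on ball z r)
        (finite_subsets_at_top I)"
    proof (rule eventually_finite_subsets_at_top_weakI)
      fix X assume X: "finite X" "X \<subseteq> I"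
      then have "(\<lambda>w. \<Sum>i\<in>X. f i w) holomorphic_on cball z r"
        by (intro holomorphic_intros) (use f r in \<open>auto intro: holomorphic_on_subset\<close>)
      then show "continuous_on (cball z r) (\<lambda>w. \<Sum>i\<in>X. f i w) \<and> (\<lambda>w. \<Sum>i\<in>X. f i w) holomorphic_on ball z r"
        by (auto intro: holomorphic_on_imp_continuous_on holomorphic_on_subset)
    qed
    from holomorphic_uniform_limit[OF this uniform_limit_infsum[OF r(3,4)]]
    show ?thesis using r(1) by auto
  qed
  then show ?thesis
    using U by (metis analytic_on_def analytic_on_open)
qed

subsection \<open>The remainder of the binomial expansion\<close>

lemma pochhammer_ge_0: "\<rho> \<ge> 0 \<Longrightarrow> pochhammer (\<rho>::real) k \<ge> 0"
  by (induction k) (simp_all add: pochhammer_Suc)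

text \<open>Factor by factor \<open>cmod (z + k) \<le> \<rho> + k\<close>, so the bound is uniform
  in the disc.\<close>

lemma norm_gbinomial_le:
  fixes z :: complex
  assumes "cmod z \<le> \<rho>"
  shows "cmod ((- z) gchoose k) \<le> pochhammer \<rho> k / fact k"
proof -
  have "cmod (pochhammer z k) \<le> pochhammer \<rho> k"
  proof (induction k)
    case (Suc k)
    have "cmod (z + of_nat k) \<le> \<rho> + of_nat k"
      using norm_triangle_ineq[of z "of_nat k"] assms by simp
    moreover have "\<rho> \<ge> 0" using assms norm_ge_zero[of z] by linarith
    ultimately show ?case
      using Suc by (auto simp: pochhammer_Suc norm_mult pochhammer_ge_0 intro!: mult_mono)
  qed simp
  then show ?thesis
    by (simp add: gbinomial_pochhammer norm_mult norm_divide norm_power divide_right_mono)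
qed

text \<open>This is the binomial series of exponent \<open>- \<rho>\<close> at \<open>-1/2\<close>,
  where the signs of coefficient and power cancel.\<close>

lemma summable_pochhammer_half:
  "summable (\<lambda>k. pochhammer (\<rho>::real) k / fact k * (1/2) ^ k)"
proof -
  have "(\<lambda>k. ((- \<rho>) gchoose k) * (- (1/2)) ^ k) sums (1 + - (1/2)) powr (- \<rho>)"
    by (rule gen_binomial_real) simp
  moreover have "((- \<rho>) gchoose k) * (- (1/2)) ^ k = pochhammer \<rho> k / fact k * (1/2) ^ k" for k
  proof -
    have "((- \<rho>) gchoose k) * (- (1/2)) ^ k = pochhammer \<rho> k / fact k * ((-1) ^ k * (- (1/2)) ^ k)"
      by (simp add: gbinomial_pochhammer)
    also have "(-1) ^ k * (- (1/2)) ^ k = ((1/2) ^ k :: real)"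
      by (simp add: power_mult_distrib[symmetric])
    finally show ?thesis .
  qed
  ultimately show ?thesis by (simp add: sums_iff)
qed

lemma binomial_remainder:
  fixes N :: nat and \<rho> :: real
  obtains C where "C \<ge> 0" "\<And>z w. cmod z \<le> \<rho> \<Longrightarrow> cmod w \<le> 1/2 \<Longrightarrow>
    cmod ((1 + w) powr (- z) - (\<Sum>k<N. ((- z) gchoose k) * w ^ k)) \<le> C * cmod w ^ N"
proof (cases "\<rho> \<ge> 0")
  case False
  then have "\<not> cmod z \<le> \<rho>" for z using norm_ge_zero[of z] by linarith
  then show ?thesis using that[of 0] by blast
next
  case True
  define b where "b k = pochhammer \<rho> k / fact k" for k
  have b0: "b k \<ge> 0" for k using True by (simp add: b_def pochhammer_ge_0)
  have sb: "summable (\<lambda>k. b k * (1/2) ^ k)"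
    unfolding b_def by (rule summable_pochhammer_half)
  define S where "S = (\<Sum>k. b k * (1/2) ^ k)"
  have "S \<ge> 0" unfolding S_def by (intro suminf_nonneg sb) (simp add: b0)
  show ?thesis
  \<comment> \<open>Since \<open>|w|^(k+N) \<le> |w|^N (1/2)^k\<close>, pulling out
    \<open>|w|^N\<close> costs a factor \<open>2^N\<close> against the series at 1/2.\<close>
  proof (rule that[of "2 ^ N * S"])
    show "2 ^ N * S \<ge> 0" using \<open>S \<ge> 0\<close> by simp
    fix z w :: complex assume z: "cmod z \<le> \<rho>" and w: "cmod w \<le> 1/2"
    have s: "(\<lambda>k. ((- z) gchoose k) * w ^ k) sums (1 + w) powr (- z)"
      by (rule gen_binomial_complex) (use w in simp)
    have le: "cmod (((- z) gchoose (k + N)) * w ^ (k + N)) \<le> (2 ^ N * cmod w ^ N) * (b (k + N) * (1/2) ^ (k + N))" for k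
    proof -
      have "cmod w ^ (k + N) \<le> cmod w ^ N * (1/2) ^ k"
        using power_mono[OF w, of k] by (simp add: power_add mult.commute mult_left_mono)
      then have "cmod (((- z) gchoose (k + N)) * w ^ (k + N)) \<le> b (k + N) * (cmod w ^ N * (1/2) ^ k)"
        unfolding norm_mult norm_power using norm_gbinomial_le[OF z, of "k + N"] b0[of "k + N"]
        by (intro mult_mono) (simp_all add: b_def)
      also have "\<dots> = (2 ^ N * cmod w ^ N) * (b (k + N) * (1/2) ^ (k + N))"
        by (simp add: power_add field_simps)
      finally show ?thesis .
    qed
    have "(1 + w) powr (- z) - (\<Sum>k<N. ((- z) gchoose k) * w ^ k) = (\<Sum>k. ((- z) gchoose (k + N)) * w ^ (k + N))"
      using suminf_minus_initial_segment[OF sums_summable[OF s], of N] s by (simp add: sums_iff)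
    also have "cmod \<dots> \<le> (\<Sum>k. (2 ^ N * cmod w ^ N) * (b (k + N) * (1/2) ^ (k + N)))"
    proof (rule norm_suminf_le)
      show "summable (\<lambda>k. (2 ^ N * cmod w ^ N) * (b (k + N) * (1/2) ^ (k + N)))"
        by (intro summable_mult summable_ignore_initial_segment sb)
    qed (rule le)
    also have "\<dots> = (2 ^ N * cmod w ^ N) * (\<Sum>k. b (k + N) * (1/2) ^ (k + N))"
      by (intro suminf_mult summable_ignore_initial_segment sb)
    also have "\<dots> \<le> (2 ^ N * cmod w ^ N) * S"
      using suminf_minus_initial_segment[OF sb, of N] b0
      by (intro mult_left_mono) (simp_all add: S_def sum_nonneg)
    finally show "cmod ((1 + w) powr (- z) - (\<Sum>k<N. ((- z) gchoose k) * w ^ k)) \<le> 2 ^ N * S * cmod w ^ N"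
      by (simp add: ac_simps)
  qed
qed

text \<open>The Taylor remainder of \<open>m^(-z)\<close> around \<open>n\<close>, except that the
  powers are those of \<open>p - q\<close>, the factor that \<open>\<delta>\<close> produces, and
  not of \<open>m - n\<close>. The two can differ when an eigenvalue is 0.\<close>

definition taylor_rem :: "nat \<Rightarrow> complex \<Rightarrow> real \<Rightarrow> real \<Rightarrow> real \<Rightarrow> real \<Rightarrow> complex" where
  "taylor_rem N z p m q n = of_real m powr (- z)
     - (\<Sum>k<N. ((- z) gchoose k) * of_real (p - q) ^ k * of_real n powr (- z - of_nat k))"

lemma norm_powr_real: "m > 0 \<Longrightarrow> cmod (complex_of_real m powr z) = m powr Re z"
  by (simp add: norm_powr_real_powr)

text \<open>For \<open>q \<ge> -1\<close> the power grows at most linearly in \<open>m\<close>; for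
  small \<open>m\<close> it is controlled by the lower bound \<open>m0\<close>.\<close>

lemma powr_le_affine:
  fixes m m0 :: real
  assumes "0 < m0" "m0 \<le> m" "m0 \<le> 1" "-1 \<le> q" "q \<le> B" "B \<ge> 0"
  shows "m powr (- q) \<le> m0 powr (- B) * (1 + m)"
proof -
  have m0B: "m0 powr (- B) \<ge> 1"
    using assms powr_mono'[of "- B" 0 m0] by simp
  show ?thesis
  proof (cases "m \<ge> 1")
    case True
    then have "m powr (- q) \<le> m powr 1" using assms by (intro powr_mono) auto
    also have "\<dots> \<le> 1 * (1 + m)" using True by simp
    also have "\<dots> \<le> m0 powr (- B) * (1 + m)" using m0B True by (intro mult_right_mono) auto
    finally show ?thesis .
  next
    case False
    then have "m powr (- q) \<le> m powr (- B)" using assms by (intro powr_mono') auto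
    also have "\<dots> \<le> m0 powr (- B)" using assms by (intro powr_mono2') auto
    also have "\<dots> \<le> m0 powr (- B) * (1 + m)" using assms by simp
    finally show ?thesis .
  qed
qed

text \<open>In the application, \<open>p\<close> is an eigenvalue of \<open>|D|\<close> and \<open>m\<close> the same eigenvalue with \<open>c\<close> in place
  of \<open>0\<close>. If \<open>p\<close> is close to \<open>q\<close>, the binomial series applies; otherwise \<open>|p - q|\<close> dominates \<open>m\<close> and
  \<open>n\<close>, and a crude estimate suffices. The second case covers the pairs in which exactly one of \<open>p\<close>, \<open>q\<close>
  is \<open>0\<close>; if both are, the remainder vanishes.\<close>

lemma taylor_rem_bound:
  fixes s :: nat and m0 c \<rho> :: real
  assumes m0: "0 < m0" "m0 \<le> 1" and c: "c > 0"
  defines "N \<equiv> 2 * s + 1"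
  obtains C M where "C \<ge> 0"
    "\<And>z p m q n. cmod z \<le> \<rho> \<Longrightarrow> Re z \<ge> -1 \<Longrightarrow> (p = 0 \<and> m = c) \<or> (p = m \<and> m \<ge> m0) \<Longrightarrow>
      (q = 0 \<and> n = c) \<or> (q = n \<and> n \<ge> m0) \<Longrightarrow> m \<ge> m0 \<Longrightarrow> n \<ge> m0 \<Longrightarrow>
      cmod (taylor_rem N z p m q n) \<le> C * (1 + \<bar>p - q\<bar>) ^ M / (m ^ s * n ^ s)"
proof (cases "\<rho> \<ge> 0")
  case False
  then have "\<not> cmod z \<le> \<rho>" for z using norm_ge_zero[of z] by linarith
  then show ?thesis using that[of 0] by (meson order_refl)
next
  case True
  obtain C1 where C1: "C1 \<ge> 0" "\<And>z w. cmod z \<le> \<rho> \<Longrightarrow> cmod w \<le> 1/2 \<Longrightarrow>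
    cmod ((1 + w) powr (- z) - (\<Sum>k<N. ((- z) gchoose k) * w ^ k)) \<le> C1 * cmod w ^ N"
    using binomial_remainder[of \<rho> N] by blast
  define b where "b k = pochhammer \<rho> k / fact k" for k
  have b0: "b k \<ge> 0" for k using True by (simp add: b_def pochhammer_ge_0)
  \<comment> \<open>The 1/3 serves positive eigenvalues whose distance exceeds half of
    \<open>n\<close>. The quotient \<open>m0 / c\<close> serves pairs with exactly one zero
    eigenvalue, where \<open>c\<close> has to be compared with a distance of at least
    \<open>m0\<close>.\<close>
  define \<kappa> where "\<kappa> = min (1/3) (m0 / c)"
  have \<kappa>: "0 < \<kappa>" "\<kappa> \<le> 1/3" "\<kappa> * c \<le> m0" using m0 c by (auto simp: \<kappa>_def min_def field_simps)
  define G where "G = m0 powr (- (\<rho> + N))"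
  have G: "G > 0" using m0 by (simp add: G_def)
  define A1 where "A1 = C1 * m0 powr (- (\<rho> + 1)) * (3/2) ^ s"
  define A2 where "A2 = (1 + (\<Sum>k<N. b k)) * (G / \<kappa>) / \<kappa> ^ (2 * s)"
  \<comment> \<open>\<open>N\<close> powers of \<open>1 + d\<close> for the Taylor terms, one for
    the linear growth of the power, and \<open>2 * s\<close> to make up the denominator.\<close>
  define M where "M = N + 1 + 2 * s"
  have A: "A1 \<ge> 0" "A2 \<ge> 0" using C1 \<kappa> G b0 by (auto simp: A1_def A2_def sum_nonneg)
  show ?thesis
  proof (rule that[of "A1 + A2" M])
    show "A1 + A2 \<ge> 0" using A by simp
    fix z :: complex and p m q n :: real
    assume z: "cmod z \<le> \<rho>" "Re z \<ge> -1" and pm: "(p = 0 \<and> m = c) \<or> (p = m \<and> m \<ge> m0)"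
      and qn: "(q = 0 \<and> n = c) \<or> (q = n \<and> n \<ge> m0)" and mm: "m \<ge> m0" "n \<ge> m0"
    have Rez: "Re z \<le> \<rho>" using z(1) complex_Re_le_cmod[of z] by linarith
    define d where "d = \<bar>p - q\<bar>"
    have d0: "d \<ge> 0" by (simp add: d_def)
    have pos: "m > 0" "n > 0" using mm m0 by auto
    have den: "m ^ s * n ^ s > 0" using pos by simp
    consider (zero) "p = 0" "q = 0" "m = n" | (near) "p = m" "q = n" "d \<le> n / 2"
      | (far) "\<kappa> * m \<le> d" "\<kappa> * n \<le> d"
    proof -
      consider (a) "p = 0" "m = c" "q = 0" "n = c" | (b) "p = 0" "m = c" "q = n" | (c) "q = 0" "n = c" "p = m"
        | (d) "p = m" "q = n" using pm qn by blast
      then show ?thesis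
      proof cases
        case a then show ?thesis using zero by simp
      next
        case b
        then have "d = n" using pos by (simp add: d_def)
        then show ?thesis using far b \<kappa> mm pos by (simp add: mult_left_le_one_le)
      next
        case c
        then have "d = m" using pos by (simp add: d_def)
        then show ?thesis using far c \<kappa> mm pos by (simp add: mult_left_le_one_le)
      next
        case d
        show ?thesis
        proof (cases "d \<le> n / 2")
          case True then show ?thesis using near d by simp
        next
          case False
          then have "n \<le> 3 * d" "m \<le> 3 * d" using d pos unfolding d_def by (auto simp: abs_if split: if_splits)
          moreover have "\<kappa> * n \<le> 1/3 * n" "\<kappa> * m \<le> 1/3 * m" using \<kappa> pos by (intro mult_right_mono; simp)+
          ultimately show ?thesis using far by linarith
        qed
      qed
    qed
    then have "cmod (taylor_rem N z p m q n) \<le> (A1 + A2) * (1 + d) ^ M / (m ^ s * n ^ s)"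
    proof cases
      case zero
      have "(\<Sum>k<N. ((- z) gchoose k) * of_real (p - q) ^ k * of_real n powr (- z - of_nat k))
          = (\<Sum>k<N. if k = 0 then of_real n powr (- z) else 0)"
        using zero by (intro sum.cong) auto
      also have "\<dots> = of_real n powr (- z)" by (simp add: N_def)
      finally have sum_eq: "(\<Sum>k<N. ((- z) gchoose k) * of_real (p - q) ^ k * of_real n powr (- z - of_nat k))
          = of_real n powr (- z)" .
      then have "taylor_rem N z p m q n = 0" by (simp only: taylor_rem_def zero(3) sum_eq diff_self)
      then show ?thesis using A den d0 by simp
    next
      case near
      \<comment> \<open>Here \<open>p - q = m - n\<close>, so that factoring out
        \<open>n^(-z)\<close> leaves the remainder of the binomial series in the relative
        distance.\<close>
      define w where "w = (m - n) / n"
      have wd: "\<bar>w\<bar> = d / n" using near pos by (simp add: w_def d_def)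
      have w: "\<bar>w\<bar> \<le> 1/2" using near pos by (simp add: wd field_simps)
      have mn: "m = n * (1 + w)" using pos by (simp add: w_def field_simps)
      have e1: "complex_of_real m powr (- z) = of_real n powr (- z) * (1 + of_real w) powr (- z)"
      proof -
        have "complex_of_real m = of_real n * of_real (1 + w)" by (simp only: mn of_real_mult)
        also have "\<dots> powr (- z) = of_real n powr (- z) * of_real (1 + w) powr (- z)"
          by (rule powr_times_real) (use pos w in auto)
        finally show ?thesis by simp
      qed
      have e2: "((- z) gchoose k) * of_real (p - q) ^ k * of_real n powr (- z - of_nat k)
          = of_real n powr (- z) * (((- z) gchoose k) * of_real w ^ k)" for k
      proof -
        have "complex_of_real n powr (- z - of_nat k) = of_real n powr (- z) / of_real n ^ k"
          using pos by (simp add: powr_diff powr_nat)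
        then show ?thesis
          using near by (simp add: w_def power_divide)
      qed
      have "taylor_rem N z p m q n = of_real n powr (- z) *
          ((1 + of_real w) powr (- z) - (\<Sum>k<N. ((- z) gchoose k) * of_real w ^ k))"
        unfolding taylor_rem_def e1 e2 sum_distrib_left[symmetric] by (simp add: algebra_simps)
      then have "cmod (taylor_rem N z p m q n) = n powr (- Re z) *
          cmod ((1 + of_real w) powr (- z) - (\<Sum>k<N. ((- z) gchoose k) * of_real w ^ k))"
        using pos by (simp add: norm_mult norm_powr_real)
      also have "\<dots> \<le> n powr (- Re z) * (C1 * \<bar>w\<bar> ^ N)"
        using C1(2)[OF z(1), of "of_real w"] w by (intro mult_left_mono) auto
      also have "\<dots> = C1 * (n powr (- Re z) / n ^ N) * d ^ N"
        by (simp add: wd power_divide)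
      \<comment> \<open>This is what \<open>N = 2 * s + 1\<close> is for: one power of
        \<open>n\<close> compensates the growth permitted by \<open>Re z \<ge> -1\<close>, and
        \<open>2 * s\<close> powers remain for the summation over pairs.\<close>
      also have "n powr (- Re z) / n ^ N = n powr (- (Re z + 1)) / n ^ (2 * s)"
      proof -
        have "n powr (- (Re z + 1)) = n powr (- Re z) / n"
          using pos powr_diff[of n "- Re z" 1] by simp
        then show ?thesis by (simp add: N_def)
      qed
      also have "C1 * (n powr (- (Re z + 1)) / n ^ (2 * s)) * d ^ N
          \<le> C1 * (m0 powr (- (\<rho> + 1)) * ((3/2) ^ s / (m ^ s * n ^ s))) * (1 + d) ^ M"
      proof (intro mult_mono mult_left_mono)
        have a: "n powr (- (Re z + 1)) \<le> m0 powr (- (\<rho> + 1))"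
        proof -
          have "n powr (- (Re z + 1)) \<le> m0 powr (- (Re z + 1))"
            using z mm m0 by (intro powr_mono2') auto
          also have "\<dots> \<le> m0 powr (- (\<rho> + 1))" using Rez m0 by (intro powr_mono') auto
          finally show ?thesis .
        qed
        have "m ^ s \<le> (3/2 * n) ^ s"
        proof (rule power_mono)
          have "m - n \<le> d" using near by (simp add: d_def)
          then show "m \<le> 3/2 * n" using near by linarith
        qed (use pos in simp)
        then have "m ^ s * n ^ s \<le> (3/2 * n) ^ s * n ^ s" using pos by (intro mult_right_mono) auto
        also have "\<dots> = (3/2) ^ s * n ^ (2 * s)"
          by (simp only: power_mult_distrib mult_2 power_add mult.assoc)
        finally have "m ^ s * n ^ s \<le> (3/2) ^ s * n ^ (2 * s)" .
        then have "1 / n ^ (2 * s) \<le> (3/2) ^ s / (m ^ s * n ^ s)"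
          using pos den by (simp add: field_simps)
        then show "n powr (- (Re z + 1)) / n ^ (2 * s) \<le> m0 powr (- (\<rho> + 1)) * ((3/2) ^ s / (m ^ s * n ^ s))"
          using mult_mono[OF a, of "1 / n ^ (2 * s)" "(3/2) ^ s / (m ^ s * n ^ s)"] pos by simp
        have "d ^ N \<le> (1 + d) ^ N" using d0 by (intro power_mono) auto
        also have "\<dots> \<le> (1 + d) ^ M" using d0 by (intro power_increasing) (auto simp: M_def)
        finally show "d ^ N \<le> (1 + d) ^ M" .
      qed (use C1 d0 den in auto)
      also have "\<dots> = A1 * (1 + d) ^ M / (m ^ s * n ^ s)" by (simp add: A1_def)
      also have "\<dots> \<le> (A1 + A2) * (1 + d) ^ M / (m ^ s * n ^ s)"
        using A d0 den by (intro divide_right_mono mult_right_mono) auto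
      finally show ?thesis .
    next
      case far
      have aff: "x powr (- Re z - real k) \<le> G * ((1 + d) / \<kappa>)"
        if x: "m0 \<le> x" "\<kappa> * x \<le> d" and k: "k \<le> N" for x k
      proof -
        have "x powr (- (Re z + real k)) \<le> G * (1 + x)"
          unfolding G_def using x k m0 z Rez True by (intro powr_le_affine) auto
        also have "\<dots> \<le> G * ((1 + d) / \<kappa>)"
        proof (intro mult_left_mono)
          have "(1 + x) * \<kappa> \<le> 1 + d" using x \<kappa> by (simp add: algebra_simps)
          then show "1 + x \<le> (1 + d) / \<kappa>" using \<kappa> by (simp add: field_simps)
        qed (use G in simp)
        finally show ?thesis by simp
      qed
      have "cmod (taylor_rem N z p m q n) \<le> cmod (of_real m powr (- z))
          + (\<Sum>k<N. cmod (((- z) gchoose k) * of_real (p - q) ^ k * of_real n powr (- z - of_nat k)))"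
        unfolding taylor_rem_def by (rule order_trans[OF norm_triangle_ineq4]) (simp add: sum_norm_le norm_sum)
      also have "\<dots> \<le> (1 + d) ^ N * (G * ((1 + d) / \<kappa>)) + (\<Sum>k<N. b k * ((1 + d) ^ N * (G * ((1 + d) / \<kappa>))))"
      proof (intro add_mono sum_mono)
        have "m powr (- Re z) \<le> 1 * (G * ((1 + d) / \<kappa>))" using aff[of m 0] mm far by simp
        also have "\<dots> \<le> (1 + d) ^ N * (G * ((1 + d) / \<kappa>))"
          using d0 G \<kappa> by (intro mult_right_mono) auto
        finally show "cmod (of_real m powr (- z)) \<le> (1 + d) ^ N * (G * ((1 + d) / \<kappa>))"
          using pos by (simp add: norm_powr_real)
        fix k assume "k \<in> {..<N}"
        then have k: "k \<le> N" by simp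
        have "cmod (((- z) gchoose k) * of_real (p - q) ^ k * of_real n powr (- z - of_nat k))
            = cmod ((- z) gchoose k) * (d ^ k * n powr (- Re z - real k))"
          using pos by (simp add: norm_mult norm_power norm_powr_real d_def del: of_real_diff)
        also have "\<dots> \<le> b k * ((1 + d) ^ N * (G * ((1 + d) / \<kappa>)))"
        proof (intro mult_mono)
          show "cmod ((- z) gchoose k) \<le> b k" unfolding b_def by (rule norm_gbinomial_le[OF z(1)])
          have "d ^ k \<le> (1 + d) ^ k" using d0 by (intro power_mono) auto
          also have "\<dots> \<le> (1 + d) ^ N" using d0 k by (intro power_increasing) auto
          finally show "d ^ k \<le> (1 + d) ^ N" .
          show "n powr (- Re z - real k) \<le> G * ((1 + d) / \<kappa>)" using aff[of n k] mm far k by simp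
        qed (use d0 G \<kappa> b0 in auto)
        finally show "cmod (((- z) gchoose k) * of_real (p - q) ^ k * of_real n powr (- z - of_nat k))
          \<le> b k * ((1 + d) ^ N * (G * ((1 + d) / \<kappa>)))" .
      qed
      also have "\<dots> = (1 + (\<Sum>k<N. b k)) * (G / \<kappa>) * (1 + d) ^ (N + 1)"
        unfolding sum_distrib_right[symmetric] by (simp add: power_add add_divide_distrib distrib_left distrib_right ac_simps)
      \<comment> \<open>In the far case \<open>\<kappa> m\<close> and \<open>\<kappa> n\<close> are
        at most \<open>d\<close>, so the inserted factor is at least 1.\<close>
      also have "\<dots> \<le> (1 + (\<Sum>k<N. b k)) * (G / \<kappa>) * ((1 + d) ^ (N + 1) * ((1 + d) ^ (2 * s) / (\<kappa> ^ (2 * s) * (m ^ s * n ^ s))))"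
      proof (intro mult_left_mono)
        have "\<kappa> ^ (2 * s) * (m ^ s * n ^ s) = (\<kappa> * m) ^ s * (\<kappa> * n) ^ s"
          by (simp only: power_mult_distrib mult_2 power_add) (simp only: ac_simps)
        also have "\<dots> \<le> (1 + d) ^ s * (1 + d) ^ s"
          using far d0 \<kappa> pos by (intro mult_mono power_mono) auto
        also have "\<dots> = (1 + d) ^ (2 * s)" by (simp add: mult_2 power_add)
        finally have "1 \<le> (1 + d) ^ (2 * s) / (\<kappa> ^ (2 * s) * (m ^ s * n ^ s))"
          using den \<kappa>(1) by (subst le_divide_eq_1_pos) (auto simp: mult_pos_pos)
        then show "(1 + d) ^ (N + 1) \<le> (1 + d) ^ (N + 1) * ((1 + d) ^ (2 * s) / (\<kappa> ^ (2 * s) * (m ^ s * n ^ s)))"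
          using mult_left_mono[OF _ zero_le_power[of "1 + d" "N + 1"]] d0 by (metis add_nonneg_nonneg mult.right_neutral zero_le_one)
      qed (use b0 G \<kappa> in \<open>auto simp: sum_nonneg\<close>)
      also have "\<dots> = A2 * (1 + d) ^ M / (m ^ s * n ^ s)"
        by (simp add: A2_def M_def power_add)
      also have "\<dots> \<le> (A1 + A2) * (1 + d) ^ M / (m ^ s * n ^ s)"
        using A d0 den by (intro divide_right_mono mult_right_mono) auto
      finally show ?thesis .
    qed
    then show "cmod (taylor_rem N z p m q n) \<le> (A1 + A2) * (1 + \<bar>p - q\<bar>) ^ M / (m ^ s * n ^ s)"
      by (simp add: d_def)
  qed
qed

subsection \<open>Zeta functions as Dirichlet series\<close>

lemma has_sum_minus:
  fixes f g :: "'i \<Rightarrow> 'b::real_normed_vector"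
  assumes "(f has_sum a) A" "(g has_sum b) A"
  shows "((\<lambda>x. f x - g x) has_sum (a - b)) A"
  using has_sum_add[OF assms(1) has_sum_bounded_linear[OF bounded_linear_minus[OF bounded_linear_ident] assms(2)]]
  by simp

text \<open>\<open>|D|^(-s)\<close> has finite trace. Convergence is obtained below by sacrificing
  powers of \<open>1 / m\<close>; the lower bound \<open>m0\<close> lets excess negative powers be
  replaced by constants.\<close>

locale summable_eigenbasis = eigenbasis W D F c E lam eps
  for W :: "'h::complex_hilbert_space set" and D F :: "'h \<Rightarrow> 'h" and c :: real
    and E :: "'h set" and lam eps :: "'h \<Rightarrow> real" +
  fixes s :: nat and m0 :: real
  assumes m_summable: "(\<lambda>e. 1 / m e ^ s) summable_on E"
    and m0: "0 < m0" "m0 \<le> 1" and m0_le: "e \<in> E \<Longrightarrow> m0 \<le> m e"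
begin

definition Z :: "('h \<Rightarrow> complex) \<Rightarrow> complex \<Rightarrow> complex" where
  "Z d z = (\<Sum>\<^sub>\<infinity>e\<in>E. d e * of_real (m e) powr (- z))"

abbreviation dg :: "('h \<Rightarrow> 'h) \<Rightarrow> 'h \<Rightarrow> complex" where
  "dg T \<equiv> (\<lambda>e. cinner e (T e))"

lemma dg_bound: "bounded_clinear T \<Longrightarrow> e \<in> E \<Longrightarrow> cmod (dg T e) \<le> onorm T"
  by (rule matrix_bound)

lemma m_powr_le_1:
  assumes "e \<in> E" "Re z \<ge> 0"
  shows "cmod (of_real (m e) powr (- z)) \<le> m0 powr (- Re z)"
  using assms m_pos[of e] m0 m0_le[OF assms(1)] by (simp add: norm_powr_real powr_mono2')

lemma m_powr_le:
  assumes "e \<in> E" "Re z \<ge> real k"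
  shows "cmod (of_real (m e) powr (- z)) \<le> m0 powr (- (Re z - real k)) * (1 / m e ^ k)"
proof -
  have "m e powr (- Re z) = m e powr (- (Re z - real k)) * m e powr (- real k)"
    by (simp add: powr_add[symmetric])
  also have "m e powr (- real k) = 1 / m e ^ k"
    using m_pos[of e] by (simp add: powr_minus powr_realpow divide_inverse)
  also have "m e powr (- (Re z - real k)) * (1 / m e ^ k) \<le> m0 powr (- (Re z - real k)) * (1 / m e ^ k)"
    using assms m0 m0_le[OF assms(1)] m_pos[of e] by (intro mult_right_mono powr_mono2') auto
  finally show ?thesis using m_pos[of e] by (simp add: norm_powr_real)
qed

lemma Z_summable:
  assumes d: "\<And>e. e \<in> E \<Longrightarrow> cmod (d e) \<le> K" and z: "Re z \<ge> real s"
  shows "(\<lambda>e. cmod (d e * of_real (m e) powr (- z))) summable_on E"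
proof (rule Infinite_Sum.abs_summable_on_comparison_test')
  show "(\<lambda>e. (K * m0 powr (- (Re z - real s))) * (1 / m e ^ s)) summable_on E"
    by (intro summable_on_cmult_right m_summable)
  show "cmod (d e * of_real (m e) powr (- z)) \<le> (K * m0 powr (- (Re z - real s))) * (1 / m e ^ s)"
    if e: "e \<in> E" for e
    unfolding norm_mult mult.assoc using order_trans[OF norm_ge_zero d[OF e]]
    by (intro mult_mono m_powr_le[OF e z] d[OF e]) auto
qed

lemma Z_has_sum:
  assumes "\<And>e. e \<in> E \<Longrightarrow> cmod (d e) \<le> K" "Re z \<ge> real s"
  shows "((\<lambda>e. d e * of_real (m e) powr (- z)) has_sum Z d z) E"
  unfolding Z_def by (rule has_sum_infsum[OF Infinite_Sum.abs_summable_summable[OF Z_summable[OF assms]]])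

lemma Z_cong: "(\<And>e. e \<in> E \<Longrightarrow> d e = d' e) \<Longrightarrow> Z d z = Z d' z"
  by (simp add: Z_def cong: infsum_cong)

lemma Z_add:
  assumes "\<And>e. e \<in> E \<Longrightarrow> cmod (d e) \<le> K" "\<And>e. e \<in> E \<Longrightarrow> cmod (d' e) \<le> K'" "Re z \<ge> real s"
  shows "Z (\<lambda>e. d e + d' e) z = Z d z + Z d' z"
proof -
  have "((\<lambda>e. (d e + d' e) * of_real (m e) powr (- z)) has_sum (Z d z + Z d' z)) E"
    unfolding distrib_right by (rule has_sum_add[OF Z_has_sum[OF assms(1,3)] Z_has_sum[OF assms(2,3)]])
  then show ?thesis unfolding Z_def by (rule infsumI)
qed

lemma Z_cmult: "Z (\<lambda>e. a * d e) z = a * Z d z"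
  by (simp add: Z_def mult.assoc infsum_cmult_right')

lemma cinner_absD_powr:
  assumes "Re w \<le> 0" "e \<in> E"
  shows "cinner e (absD_powr W D c w x) = of_real (m e) powr w * cinner e x"
proof -
  have "x \<in> fcalc_dom W D (\<lambda>l. of_real (if l = 0 then c else \<bar>l\<bar>) powr w)"
  proof (rule fcalc_dom_bounded)
    show "cmod (of_real (if lam e = 0 then c else \<bar>lam e\<bar>) powr w) \<le> m0 powr (Re w)" if "e \<in> E" for e
      using m_powr_le_1[OF that, of "- w"] assms(1) by (simp add: m_def)
  qed
  from cinner_fcalc[OF this assms(2)] show ?thesis
    by (simp add: absD_powr_def m_def)
qed

lemma m_powr_bounded: "Re w \<le> 0 \<Longrightarrow> e \<in> E \<Longrightarrow> cmod (of_real (m e) powr w) \<le> m0 powr Re w"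
  using m_powr_le_1[of e "- w"] by simp

lemma absD_powr_diag: "Re w \<le> 0 \<Longrightarrow> absD_powr W D c w x = diag_op (\<lambda>e. of_real (m e) powr w) x"
  by (rule diag_op_eqI[OF m_powr_bounded cinner_absD_powr])

lemma absD_powr_add:
  assumes "Re w \<le> 0" "Re v \<le> 0"
  shows "absD_powr W D c w (absD_powr W D c v x) = absD_powr W D c (w + v) x"
  by (rule onb_eqI[OF onb]) (use assms in \<open>simp add: cinner_absD_powr powr_add\<close>)

text \<open>The expansion in \<open>E\<close> is itself a nuclear decomposition of \<open>T\<close>
  composed with a summable diagonal operator.\<close>

lemma op_trace_diag:
  assumes T: "bounded_clinear T" and g: "\<And>e. e \<in> E \<Longrightarrow> cmod (g e) \<le> K" "(\<lambda>e. cmod (g e)) summable_on E"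
  shows "((\<lambda>e. cinner e x *\<^sub>C g e *\<^sub>C T e) has_sum T (diag_op g x)) E"
    and "(\<lambda>e. norm (g e *\<^sub>C T e)) summable_on E"
proof -
  have bT: "bounded_linear T" using T by (simp add: bounded_clinear_def)
  show "((\<lambda>e. cinner e x *\<^sub>C g e *\<^sub>C T e) has_sum T (diag_op g x)) E"
    using has_sum_bounded_linear[OF bT diag_op_has_sum(1)[OF g(1)]]
    by (simp add: bounded_clinear_scaleC[OF T])
  show "(\<lambda>e. norm (g e *\<^sub>C T e)) summable_on E"
  proof (rule Infinite_Sum.abs_summable_on_comparison_test'[OF summable_on_cmult_left[OF g(2), of "onorm T"]])
    show "norm (g e *\<^sub>C T e) \<le> cmod (g e) * onorm T" if "e \<in> E" for e
      using bounded_clinear_bound[OF T, of e] that by (simp add: norm_scaleC E_norm mult_left_mono)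
  qed
qed

lemma zeta_eq_Z:
  assumes T: "bounded_clinear T" and z: "Re z \<ge> real s"
  shows "zeta W D c T z = Z (dg T) z"
proof -
  have w: "Re (- z) \<le> 0" using z by simp
  have g: "(\<lambda>e. cmod (of_real (m e) powr (- z))) summable_on E"
    using Z_summable[of "\<lambda>_. 1" 1 z] z by simp
  note ot = op_trace_diag[OF T m_powr_bounded[OF w] g]
  have "op_trace (T \<circ> absD_powr W D c (- z)) = (\<Sum>\<^sub>\<infinity>e\<in>E. cinner e (of_real (m e) powr (- z) *\<^sub>C T e))"
    by (rule op_trace_basis[OF _ ot(2)]) (simp only: comp_def absD_powr_diag[OF w] ot(1))
  then show ?thesis by (simp add: zeta_def Z_def cinner_simps mult.commute)
qed

lemma zeta_shift:
  assumes z: "Re z \<ge> 0"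
  shows "zeta W D c (T \<circ> absD_powr W D c (- of_nat k)) z = zeta W D c T (z + of_nat k)"
proof -
  have "absD_powr W D c (- of_nat k) (absD_powr W D c (- z) x) = absD_powr W D c (- (z + of_nat k)) x" for x
    using z by (subst absD_powr_add) (simp_all add: add.commute)
  then show ?thesis by (simp add: zeta_def comp_def)
qed

text \<open>Each basis vector of the kernel contributes the same amount \<open>1 / c ^ s\<close> to
  a convergent series.\<close>

lemma finite_kernel: "finite {e\<in>E. lam e = 0}"
proof (rule ccontr)
  assume inf: "infinite {e\<in>E. lam e = 0}"
  define S where "S = (\<Sum>\<^sub>\<infinity>e\<in>E. 1 / m e ^ s)"
  obtain A where A: "finite A" "card A = nat \<lceil>S * c ^ s\<rceil> + 1" "A \<subseteq> {e\<in>E. lam e = 0}"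
    using infinite_arbitrarily_large[OF inf] by blast
  have "real (card A) * (1 / c ^ s) = (\<Sum>e\<in>A. 1 / m e ^ s)"
    using A(3) by (simp add: m_def subset_iff)
  also have "\<dots> \<le> S"
    unfolding S_def using A m_pos by (intro finite_sum_le_infsum m_summable) (auto simp: less_imp_le)
  finally have "real (card A) \<le> S * c ^ s"
    using c by (simp add: field_simps)
  then show False using A(2) by linarith
qed

text \<open>\<open>p^j m^(-j)\<close> is 1 off the kernel and, as \<open>j \<ge> 1\<close>, 0 on it.
  The correction is a finite sum and entire in \<open>z\<close>, so residues do not notice
  it.\<close>

lemma Z_p_power:
  assumes d: "\<And>e. e \<in> E \<Longrightarrow> cmod (d e) \<le> K" and z: "Re z \<ge> real s" and j: "j \<ge> 1"
  shows "((\<lambda>e. d e * of_real (p e) ^ j * of_real (m e) powr (- (z + of_nat j))) has_sum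
    (Z d z - (\<Sum>e\<in>{e\<in>E. lam e = 0}. d e) * of_real c powr (- z))) E"
proof -
  let ?k = "\<lambda>e. if lam e = 0 then d e * of_real c powr (- z) else 0"
  have "(?k has_sum (\<Sum>e\<in>{e\<in>E. lam e = 0}. ?k e)) E"
    by (rule has_sum_finite_neutralI[OF finite_kernel]) auto
  also have "(\<Sum>e\<in>{e\<in>E. lam e = 0}. ?k e) = (\<Sum>e\<in>{e\<in>E. lam e = 0}. d e) * of_real c powr (- z)"
    unfolding sum_distrib_right by (rule sum.cong) auto
  finally have k: "(?k has_sum (\<Sum>e\<in>{e\<in>E. lam e = 0}. d e) * of_real c powr (- z)) E" .
  have eq: "d e * of_real (p e) ^ j * of_real (m e) powr (- (z + of_nat j)) = d e * of_real (m e) powr (- z) - ?k e" for e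
  proof (cases "lam e = 0")
    case True
    then show ?thesis using j by (simp add: p_def m_def)
  next
    case False
    then have "complex_of_real (p e) ^ j = of_real (m e) powr of_nat j"
      using m_pos[of e] by (simp add: p_def m_def powr_nat)
    then have "complex_of_real (p e) ^ j * of_real (m e) powr (- (z + of_nat j))
        = of_real (m e) powr (of_nat j + (- (z + of_nat j)))"
      by (simp only: powr_add)
    also have "of_nat j + (- (z + of_nat j)) = - z" by simp
    finally show ?thesis using False by (simp only: mult.assoc if_False diff_zero)
  qed
  show ?thesis
    unfolding eq by (rule has_sum_minus[OF Z_has_sum[OF d z] k])
qed

subsection \<open>Iterated commutators with the square of the Dirac operator\<close>

lemma diag_op_in_W:
  assumes "\<And>e. e \<in> E \<Longrightarrow> cmod (g e) \<le> K" "\<And>e. e \<in> E \<Longrightarrow> cmod (of_real (p e) * g e) \<le> K'"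
  shows "diag_op g x \<in> W" "D (diag_op g x) = diag_op (\<lambda>e. of_real (lam e) * g e) x"
proof -
  have "cmod (of_real (lam e) * g e) \<le> K'" if "e \<in> E" for e
    using assms(2)[OF that] by (simp add: p_def norm_mult)
  then have "cinner e (diag_op (\<lambda>e. of_real (lam e) * g e) x) = of_real (lam e) * cinner e (diag_op g x)"
    if "e \<in> E" for e
    using that assms(1) by (simp add: diag_op_has_sum(2)[where K = K'] diag_op_has_sum(2)[where K = K])
  from W_memI[OF this]
  show "diag_op g x \<in> W" "D (diag_op g x) = diag_op (\<lambda>e. of_real (lam e) * g e) x" by auto
qed

lemma lam_sq: "complex_of_real (lam e) * (of_real (lam e) * a) = of_real (p e) ^ 2 * a"
  by (simp add: p_def power2_eq_square abs_mult_self_eq flip: of_real_mult mult.assoc)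

lemma D_D_diag_op:
  assumes "\<And>e. e \<in> E \<Longrightarrow> cmod (g e) \<le> K" "\<And>e. e \<in> E \<Longrightarrow> cmod (of_real (p e) * g e) \<le> K'"
    "\<And>e. e \<in> E \<Longrightarrow> cmod (of_real (p e) ^ 2 * g e) \<le> K''"
  shows "D (D (diag_op g x)) = diag_op (\<lambda>e. of_real (p e) ^ 2 * g e) x"
proof -
  have "D (D (diag_op g x)) = D (diag_op (\<lambda>e. of_real (lam e) * g e) x)"
    by (simp only: diag_op_in_W(2)[OF assms(1,2)])
  also have "\<dots> = diag_op (\<lambda>e. of_real (lam e) * (of_real (lam e) * g e)) x"
  proof (rule diag_op_in_W(2))
    show "cmod (of_real (lam e) * g e) \<le> K'" if "e \<in> E" for e
      using assms(2)[OF that] by (simp add: p_def norm_mult)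
    show "cmod (of_real (p e) * (of_real (lam e) * g e)) \<le> K''" if "e \<in> E" for e
      using assms(3)[OF that] by (simp add: p_def norm_mult power2_eq_square mult.assoc)
  qed
  finally show ?thesis by (simp only: lam_sq)
qed

text \<open>The relation \<open>|D| T = T |D| + T'\<close> at a vector on which the right-hand side
  makes sense, tested against a basis vector, so that \<open>|D|\<close> on the left appears only
  through its eigenvalue.\<close>

lemma der_diag_op:
  assumes T: "der T T'" and e: "e \<in> E"
    and g: "\<And>e. e \<in> E \<Longrightarrow> cmod (g e) \<le> K" "\<And>e. e \<in> E \<Longrightarrow> cmod (of_real (p e) * g e) \<le> K'"
  shows "cinner e (T' (diag_op g x) + T (diag_op (\<lambda>e. of_real (p e) * g e) x)) = of_real (p e) * cinner e (T (diag_op g x))"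
proof -
  have b: "bounded_clinear T" "bounded_clinear T'" using T by (auto simp: der_def)
  have "((\<lambda>f. cinner e (T' f) * cinner f (diag_op g x) + cinner e (T f) * cinner f (diag_op (\<lambda>e. of_real (p e) * g e) x))
     has_sum (cinner e (T' (diag_op g x)) + cinner e (T (diag_op (\<lambda>e. of_real (p e) * g e) x)))) E"
    by (rule has_sum_add[OF onb_matrix_product[OF onb b(2)] onb_matrix_product[OF onb b(1)]])
  moreover have "cinner e (T' f) * cinner f (diag_op g x) + cinner e (T f) * cinner f (diag_op (\<lambda>e. of_real (p e) * g e) x)
      = of_real (p e) * (cinner e (T f) * cinner f (diag_op g x))" if f: "f \<in> E" for f
  proof -
    have "cinner f (diag_op g x) = g f * cinner f x"
      by (rule diag_op_has_sum(2)[OF g(1) f])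
    moreover have "cinner f (diag_op (\<lambda>e. of_real (p e) * g e) x) = of_real (p f) * g f * cinner f x"
      by (rule diag_op_has_sum(2)[OF g(2) f])
    ultimately show ?thesis
      by (simp only: derD[OF T e f]) (simp add: algebra_simps)
  qed
  ultimately have "((\<lambda>f. of_real (p e) * (cinner e (T f) * cinner f (diag_op g x)))
     has_sum (cinner e (T' (diag_op g x)) + cinner e (T (diag_op (\<lambda>e. of_real (p e) * g e) x)))) E"
    by (simp cong: has_sum_cong)
  moreover have "((\<lambda>f. of_real (p e) * (cinner e (T f) * cinner f (diag_op g x)))
     has_sum of_real (p e) * cinner e (T (diag_op g x))) E"
    by (rule has_sum_cmult_right[OF onb_matrix_product[OF onb b(1)]])
  ultimately show ?thesis
    using has_sum_unique by (fastforce simp: cinner_add_right)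
qed

text \<open>\<open>D\<close> is used as \<open>F |D|\<close>: then
  \<open>D T u = F (T' u + T |D| u)\<close>, and in the second application the two factors
  \<open>F\<close> cancel. Membership in the domain comes out of the same coordinates.
  \<open>u j x\<close> stands for \<open>|D|^j\<close> applied to \<open>u 0 x\<close>.\<close>

lemma D_D_der:
  assumes T: "der T T'" "der T' T''"
    and g: "\<And>e. e \<in> E \<Longrightarrow> cmod (g e) \<le> K" "\<And>e. e \<in> E \<Longrightarrow> cmod (of_real (p e) * g e) \<le> K'"
      "\<And>e. e \<in> E \<Longrightarrow> cmod (of_real (p e) ^ 2 * g e) \<le> K''"
  defines "u \<equiv> \<lambda>j x. diag_op (\<lambda>e. of_real (p e) ^ j * g e) x"
  shows "T (u 0 x) \<in> W" "D (T (u 0 x)) \<in> W"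
    "D (D (T (u 0 x))) = T (u 2 x) + (T' (u 1 x) + T' (u 1 x)) + T'' (u 0 x)"
proof -
  have g2: "\<And>e. e \<in> E \<Longrightarrow> cmod (of_real (p e) * (of_real (p e) * g e)) \<le> K''"
    using g(3) by (simp add: power2_eq_square mult.assoc)
  have u: "u 0 x = diag_op g x" "u 1 x = diag_op (\<lambda>e. of_real (p e) * g e) x"
    "u 2 x = diag_op (\<lambda>e. of_real (p e) * (of_real (p e) * g e)) x"
    by (simp_all add: u_def power2_eq_square mult.assoc)
  let ?a = "T' (u 0 x) + T (u 1 x)"
  have a: "cinner e ?a = of_real (p e) * cinner e (T (u 0 x))" if "e \<in> E" for e
    unfolding u by (rule der_diag_op[OF T(1) that g(1,2)])
  have "cinner e (F ?a) = of_real (lam e) * cinner e (T (u 0 x))" if "e \<in> E" for e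
    by (simp only: cinner_F[OF that] a[OF that] lam_p[OF that] of_real_mult mult.assoc)
  note TW = W_memI[OF this]
  from TW(1) show "T (u 0 x) \<in> W" .
  have DT: "D (T (u 0 x)) = F ?a" by (rule TW(2))
  let ?b = "T (u 2 x) + (T' (u 1 x) + T' (u 1 x)) + T'' (u 0 x)"
  have "cinner e ?b = of_real (lam e) * cinner e (F ?a)" if e: "e \<in> E" for e
  proof -
    have "of_real (lam e) * cinner e (F ?a) = of_real (p e) * cinner e ?a"
    proof -
      have "complex_of_real (lam e) * (of_real (eps e) * y) = of_real (eps e * eps e) * (of_real (p e) * y)" for y
        by (simp only: lam_p[OF e] of_real_mult ac_simps)
      then show ?thesis by (simp only: cinner_F[OF e] eps_sq[OF e] of_real_1 mult_1)
    qed
    also have "\<dots> = of_real (p e) * cinner e (T' (u 0 x)) + of_real (p e) * cinner e (T (u 1 x))"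
      by (simp only: cinner_add_right distrib_left)
    also have "of_real (p e) * cinner e (T' (u 0 x)) = cinner e (T'' (u 0 x) + T' (u 1 x))"
      unfolding u by (rule der_diag_op[OF T(2) e g(1,2), symmetric])
    also have "of_real (p e) * cinner e (T (u 1 x)) = cinner e (T' (u 1 x) + T (u 2 x))"
      unfolding u by (rule der_diag_op[OF T(1) e g(2) g2, symmetric])
    finally show ?thesis by (simp add: cinner_add_right)
  qed
  from W_memI[OF this] show "D (T (u 0 x)) \<in> W" "D (D (T (u 0 x))) = ?b"
    by (auto simp: DT)
qed

lemma nabla_diag_op:
  assumes T: "der T T'" "der T' T''"
    and g: "\<And>e. e \<in> E \<Longrightarrow> cmod (g e) \<le> K" "\<And>e. e \<in> E \<Longrightarrow> cmod (of_real (p e) * g e) \<le> K'"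
      "\<And>e. e \<in> E \<Longrightarrow> cmod (of_real (p e) ^ 2 * g e) \<le> K''"
  defines "u \<equiv> \<lambda>j x. diag_op (\<lambda>e. of_real (p e) ^ j * g e) x"
  shows "nabla D T (u 0 x) = (T' (u 1 x) + T' (u 1 x)) + T'' (u 0 x)"
proof -
  have "D (D (T (u 0 x))) = T (u 2 x) + (T' (u 1 x) + T' (u 1 x)) + T'' (u 0 x)"
    unfolding u_def by (rule D_D_der(3)[OF T g])
  moreover have "D (D (u 0 x)) = u 2 x"
    using D_D_diag_op[OF g, of x] by (simp add: u_def)
  ultimately show ?thesis by (simp add: nabla_def commutator_def)
qed

text \<open>In operator form the right-hand side is
  \<open>4 \<delta>^2(T) |D|^2 + 4 \<delta>^3(T) |D| + \<delta>^4(T)\<close>. As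
  \<open>nabla D T\<close> is unbounded, the outer commutator is evaluated on vectors, with the
  formula for the inner one at \<open>u 0 x\<close> and at
  \<open>D (D (u 0 x)) = u 2 x\<close>.\<close>

lemma nabla_nabla_diag_op:
  assumes T: "der T T1" "der T1 T2" "der T2 T3" "der T3 T4"
    and g: "\<And>e j. e \<in> E \<Longrightarrow> j \<le> 4 \<Longrightarrow> cmod (of_real (p e) ^ j * g e) \<le> K"
  defines "u \<equiv> \<lambda>j x. diag_op (\<lambda>e. of_real (p e) ^ j * g e) x"
  shows "nabla D (nabla D T) (u 0 x) =
    (T2 (u 2 x) + T2 (u 2 x) + T2 (u 2 x) + T2 (u 2 x))
    + (T3 (u 1 x) + T3 (u 1 x) + T3 (u 1 x) + T3 (u 1 x)) + T4 (u 0 x)"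
proof -
  define gg where "gg i e = of_real (p e) ^ i * g e" for i e
  have ggb: "\<And>e. e \<in> E \<Longrightarrow> cmod (gg i e) \<le> K" "\<And>e. e \<in> E \<Longrightarrow> cmod (of_real (p e) * gg i e) \<le> K"
      "\<And>e. e \<in> E \<Longrightarrow> cmod (of_real (p e) ^ 2 * gg i e) \<le> K" if "i \<le> 2" for i
    using g[of _ i] g[of _ "Suc i"] g[of _ "i + 2"] that
    by (simp_all add: gg_def power_add power2_eq_square mult.assoc mult.left_commute)
  have ugg: "diag_op (\<lambda>e. of_real (p e) ^ j * gg i e) x = u (i + j) x" for i j
    by (simp add: u_def gg_def power_add ac_simps)
  have n: "nabla D T (u i x) = (T1 (u (Suc i) x) + T1 (u (Suc i) x)) + T2 (u i x)" if i: "i \<le> 2" for i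
    using nabla_diag_op[OF T(1,2) ggb[OF i], of x] unfolding ugg by simp
  have n2: "nabla D T (u 2 x) = (T1 (u 3 x) + T1 (u 3 x)) + T2 (u 2 x)"
    using n[of 2] by (simp add: numeral_3_eq_3 numeral_2_eq_2)
  have DDu: "D (D (u 0 x)) = u 2 x"
    using D_D_diag_op[OF ggb[of 0], of x] by (simp add: u_def gg_def)
  have a: "T1 (u 1 x) \<in> W" "D (T1 (u 1 x)) \<in> W"
    "D (D (T1 (u 1 x))) = T1 (u 3 x) + (T2 (u 2 x) + T2 (u 2 x)) + T3 (u 1 x)"
    using D_D_der[OF T(2,3) ggb[of 1], of x] unfolding ugg by (simp_all add: numeral_2_eq_2 numeral_3_eq_3)
  have b: "T2 (u 0 x) \<in> W" "D (T2 (u 0 x)) \<in> W"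
    "D (D (T2 (u 0 x))) = T2 (u 2 x) + (T3 (u 1 x) + T3 (u 1 x)) + T4 (u 0 x)"
    using D_D_der[OF T(3,4) ggb[of 0], of x] unfolding ugg by (simp_all add: numeral_2_eq_2)
  have "nabla D (nabla D T) (u 0 x) = D (D ((T1 (u 1 x) + T1 (u 1 x)) + T2 (u 0 x))) - nabla D T (u 2 x)"
    by (simp add: nabla_def[of D "nabla D T"] commutator_def n[of 0] DDu)
  also have "D (D ((T1 (u 1 x) + T1 (u 1 x)) + T2 (u 0 x))) = D (D (T1 (u 1 x))) + D (D (T1 (u 1 x))) + D (D (T2 (u 0 x)))"
    using a(1,2) b(1,2) self_adjoint_add[OF sa] by simp
  finally show ?thesis
    by (simp only: a(3) b(3) n2) (simp add: algebra_simps)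
qed

subsection \<open>Moving powers of the modulus past an operator\<close>

lemma summable_pairs: "(\<lambda>(e, f). 1 / (m e ^ s * m f ^ s)) summable_on (E \<times> E)"
proof (rule summable_on_SigmaI)
  show "((\<lambda>f. case (e, f) of (e, f) \<Rightarrow> 1 / (m e ^ s * m f ^ s)) has_sum (1 / m e ^ s) * (\<Sum>\<^sub>\<infinity>f\<in>E. 1 / m f ^ s)) E" for e
    using has_sum_cmult_right[OF has_sum_infsum[OF m_summable], of "1 / m e ^ s"] by simp
  show "(\<lambda>e. (1 / m e ^ s) * (\<Sum>\<^sub>\<infinity>f\<in>E. 1 / m f ^ s)) summable_on E"
    by (intro summable_on_cmult_left m_summable)
qed (use m_pos in \<open>auto simp: less_imp_le\<close>)

text \<open>A form of Peetre's inequality: one weight may be exchanged for the other at the cost of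
  a power of the distance, which rapidly decaying matrix entries can pay.\<close>

lemma m_ratio:
  assumes "e \<in> E" "f \<in> E"
  shows "m e \<le> ((1 + c) / m0 + 1) * (1 + \<bar>p e - p f\<bar>) * m f"
proof -
  have "m e \<le> p e + c" using c by (simp add: m_def p_def)
  also have "\<dots> \<le> m f + \<bar>p e - p f\<bar> + c" using p_le_m[of f] by simp
  also have "\<dots> \<le> (1 + \<bar>p e - p f\<bar>) * m f + (1 + \<bar>p e - p f\<bar>) * (1 + c)"
  proof -
    have "m f \<le> (1 + \<bar>p e - p f\<bar>) * m f" using m_pos[of f] by simp
    moreover have "\<bar>p e - p f\<bar> + c \<le> (1 + \<bar>p e - p f\<bar>) * (1 + c)"
      using c by (simp add: algebra_simps)
    ultimately show ?thesis by linarith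
  qed
  also have "(1 + \<bar>p e - p f\<bar>) * (1 + c) \<le> (1 + \<bar>p e - p f\<bar>) * ((1 + c) / m0 * m f)"
  proof (intro mult_left_mono)
    show "1 + c \<le> (1 + c) / m0 * m f"
      using mult_left_mono[OF m0_le[OF assms(2)], of "1 + c"] m0 c by (simp add: field_simps)
  qed simp
  finally show ?thesis by (simp add: algebra_simps add_divide_distrib)
qed

text \<open>An entry times a power of the eigenvalue difference is an entry of an iterated
  derivative; the binomial theorem combines the bounds by their norms.\<close>

lemma smooth_bound:
  assumes X: "\<And>k. der (X k) (X (Suc k))"
  obtains C where "C \<ge> 0" "\<And>e f. e \<in> E \<Longrightarrow> f \<in> E \<Longrightarrow> cmod (cinner e (X 0 f)) * (1 + \<bar>p e - p f\<bar>) ^ M \<le> C"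
proof
  have bX: "bounded_clinear (X k)" for k using X by (auto simp: der_def)
  have Xk: "cinner e (X k f) = of_real (p e - p f) ^ k * cinner e (X 0 f)" if "e \<in> E" "f \<in> E" for e f k
    by (induction k) (simp_all add: derD[OF X that])
  show "(\<Sum>k\<le>M. of_nat (M choose k) * onorm (X k)) \<ge> 0"
    using bX by (intro sum_nonneg) (auto simp: bounded_clinear_def onorm_pos_le)
  fix e f assume ef: "e \<in> E" "f \<in> E"
  have "cmod (cinner e (X 0 f)) * (1 + \<bar>p e - p f\<bar>) ^ M
      = (\<Sum>k\<le>M. of_nat (M choose k) * (\<bar>p e - p f\<bar> ^ k * cmod (cinner e (X 0 f))))"
    using binomial_ring[of "\<bar>p e - p f\<bar>" 1 M] by (simp add: sum_distrib_left ac_simps)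
  also have "\<dots> = (\<Sum>k\<le>M. of_nat (M choose k) * cmod (cinner e (X k f)))"
  proof -
    have k: "cmod (cinner e (X k f)) = \<bar>p e - p f\<bar> ^ k * cmod (cinner e (X 0 f))" for k
      by (subst Xk[OF ef, of k]) (simp only: norm_mult norm_power norm_of_real)
    show ?thesis by (rule sum.cong[OF refl]) (simp only: k[symmetric])
  qed
  also have "\<dots> \<le> (\<Sum>k\<le>M. of_nat (M choose k) * onorm (X k))"
    by (intro sum_mono mult_left_mono matrix_bound bX ef) auto
  finally show "cmod (cinner e (X 0 f)) * (1 + \<bar>p e - p f\<bar>) ^ M \<le> (\<Sum>k\<le>M. of_nat (M choose k) * onorm (X k))" .
qed

end

lemma has_sum_sum:
  fixes f :: "'k \<Rightarrow> 'i \<Rightarrow> 'b::real_normed_vector"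
  assumes "\<And>k. k \<in> K \<Longrightarrow> (f k has_sum S k) A"
  shows "((\<lambda>x. \<Sum>k\<in>K. f k x) has_sum (\<Sum>k\<in>K. S k)) A"
  using assms by (induction K rule: infinite_finite_induct) (auto intro!: has_sum_add)

lemma holomorphic_on_gbinomial: "(\<lambda>z. (- z) gchoose k) holomorphic_on A"
  unfolding gbinomial_prod_rev by (intro holomorphic_intros) auto

lemma holomorphic_on_const_powr:
  assumes "a > 0" "g holomorphic_on A"
  shows "(\<lambda>z. complex_of_real a powr g z) holomorphic_on A"
  using assms by (intro holomorphic_intros) auto

lemma holomorphic_taylor_rem:
  assumes "m > 0" "n > 0"
  shows "(\<lambda>z. taylor_rem N z p m q n) holomorphic_on A"
  unfolding taylor_rem_def
  by (intro holomorphic_intros holomorphic_on_gbinomial holomorphic_on_const_powr assms)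

text \<open>At \<open>z = 0\<close> all powers are 1 and only the binomial coefficient for
  \<open>k = 0\<close> survives. This keeps the remainder out of the values of zeta functions at
  0.\<close>

lemma taylor_rem_0:
  assumes "m > 0" "n > 0" "N > 0"
  shows "taylor_rem N 0 p m q n = 0"
proof -
  have "(\<Sum>k<N. ((- 0) gchoose k) * of_real (p - q) ^ k * complex_of_real n powr (- 0 - of_nat k))
      = (\<Sum>k<N. if k = 0 then 1 else 0)"
    using assms by (intro sum.cong) (auto simp: gbinomial_0_left)
  then show ?thesis using assms by (simp add: taylor_rem_def)
qed

context summable_eigenbasis
begin

text \<open>In the expansion each weight sits on one index only. Half of it is moved to the other
  index by \<open>m_ratio\<close>, paid for by the decay of \<open>X 0\<close>; what results is
  summable over pairs.\<close>

lemma pair_bound: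
  assumes X: "\<And>k. der (X k) (X (Suc k))" and Y: "bounded_clinear Y"
  obtains C where "C \<ge> 0"
    "\<And>e f. e \<in> E \<Longrightarrow> f \<in> E \<Longrightarrow> cmod (cinner f (Y e) * cinner e (X 0 f)) * \<bar>p e - p f\<bar> ^ j * (1 / m e ^ (2 * s)) \<le> C * (1 / (m e ^ s * m f ^ s))"
    "\<And>e f. e \<in> E \<Longrightarrow> f \<in> E \<Longrightarrow> cmod (cinner f (Y e) * cinner e (X 0 f)) * \<bar>p e - p f\<bar> ^ j * (1 / m f ^ (2 * s)) \<le> C * (1 / (m e ^ s * m f ^ s))"
proof -
  obtain C where C: "C \<ge> 0" "\<And>e f. e \<in> E \<Longrightarrow> f \<in> E \<Longrightarrow> cmod (cinner e (X 0 f)) * (1 + \<bar>p e - p f\<bar>) ^ (j + s) \<le> C"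
    using smooth_bound[of X, OF X] by blast
  define L where "L = (1 + c) / m0 + 1"
  have L: "L \<ge> 0" using c m0 by (simp add: L_def)
  have oY: "onorm Y \<ge> 0" using Y by (simp add: bounded_clinear_def onorm_pos_le)
  have a: "cmod (cinner f (Y e) * cinner e (X 0 f)) * \<bar>p e - p f\<bar> ^ j * (1 + \<bar>p e - p f\<bar>) ^ s \<le> onorm Y * C"
    if ef: "e \<in> E" "f \<in> E" for e f
  proof -
    have "cmod (cinner f (Y e) * cinner e (X 0 f)) * \<bar>p e - p f\<bar> ^ j * (1 + \<bar>p e - p f\<bar>) ^ s
        \<le> cmod (cinner f (Y e) * cinner e (X 0 f)) * (1 + \<bar>p e - p f\<bar>) ^ j * (1 + \<bar>p e - p f\<bar>) ^ s"
      by (intro mult_left_mono mult_right_mono power_mono) auto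
    also have "\<dots> = cmod (cinner f (Y e)) * (cmod (cinner e (X 0 f)) * (1 + \<bar>p e - p f\<bar>) ^ (j + s))"
      by (simp add: norm_mult power_add)
    also have "\<dots> \<le> onorm Y * C"
      by (intro mult_mono matrix_bound[OF Y ef(2,1)] C(2)[OF ef] oY) auto
    finally show ?thesis .
  qed
  have b: "cmod (cinner f (Y e) * cinner e (X 0 f)) * \<bar>p e - p f\<bar> ^ j * (1 / x ^ (2 * s))
      \<le> (onorm Y * C * L ^ s) * (1 / (x ^ s * y ^ s))"
    if ef: "e \<in> E" "f \<in> E" and xy: "0 < x" "0 < y" "y \<le> L * (1 + \<bar>p e - p f\<bar>) * x" for e f x y
  proof -
    have "y ^ s \<le> (L * (1 + \<bar>p e - p f\<bar>) * x) ^ s" using xy by (intro power_mono) auto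
    then have "y ^ s \<le> L ^ s * (1 + \<bar>p e - p f\<bar>) ^ s * x ^ s" by (simp only: power_mult_distrib)
    then have le: "y ^ s / x ^ s \<le> L ^ s * (1 + \<bar>p e - p f\<bar>) ^ s"
      using xy by (simp add: pos_divide_le_eq)
    have "1 / x ^ (2 * s) = (y ^ s / x ^ s) * (1 / (x ^ s * y ^ s))"
      using xy by (simp add: mult_2 power_add)
    also have "\<dots> \<le> L ^ s * (1 + \<bar>p e - p f\<bar>) ^ s * (1 / (x ^ s * y ^ s))"
      using xy by (intro mult_right_mono le) auto
    finally have "1 / x ^ (2 * s) \<le> L ^ s * (1 + \<bar>p e - p f\<bar>) ^ s * (1 / (x ^ s * y ^ s))" .
    then have "cmod (cinner f (Y e) * cinner e (X 0 f)) * \<bar>p e - p f\<bar> ^ j * (1 / x ^ (2 * s))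
      \<le> cmod (cinner f (Y e) * cinner e (X 0 f)) * \<bar>p e - p f\<bar> ^ j * (L ^ s * (1 + \<bar>p e - p f\<bar>) ^ s * (1 / (x ^ s * y ^ s)))"
      by (intro mult_left_mono) auto
    also have "\<dots> = (cmod (cinner f (Y e) * cinner e (X 0 f)) * \<bar>p e - p f\<bar> ^ j * (1 + \<bar>p e - p f\<bar>) ^ s) * (L ^ s * (1 / (x ^ s * y ^ s)))"
      by (simp only: ac_simps)
    also have "\<dots> \<le> onorm Y * C * (L ^ s * (1 / (x ^ s * y ^ s)))"
      using L xy by (intro mult_right_mono a[OF ef]) auto
    finally show ?thesis by (simp only: ac_simps)
  qed
  show ?thesis
  proof (rule that[of "onorm Y * C * L ^ s"])
    show "onorm Y * C * L ^ s \<ge> 0" using oY C L by simp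
    fix e f assume ef: "e \<in> E" "f \<in> E"
    show "cmod (cinner f (Y e) * cinner e (X 0 f)) * \<bar>p e - p f\<bar> ^ j * (1 / m e ^ (2 * s)) \<le> onorm Y * C * L ^ s * (1 / (m e ^ s * m f ^ s))"
      by (rule b[OF ef m_pos m_pos]) (use m_ratio[OF ef(2,1)] in \<open>simp add: L_def abs_minus_commute\<close>)
    show "cmod (cinner f (Y e) * cinner e (X 0 f)) * \<bar>p e - p f\<bar> ^ j * (1 / m f ^ (2 * s)) \<le> onorm Y * C * L ^ s * (1 / (m e ^ s * m f ^ s))"
      using b[OF ef m_pos[of f] m_pos[of e]] m_ratio[OF ef] by (simp add: L_def mult.commute)
  qed
qed

text \<open>Both traces are sums of \<open>\<langle>f, Y e\<rangle> \<langle>e, X f\<rangle>\<close>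
  over pairs, with a weight in \<open>m e\<close> on the left and in \<open>m f\<close> on the
  right; pair by pair the difference is the Taylor remainder. \<open>Re z \<ge> 2 s\<close> makes
  the separate sums absolutely convergent, so that each may be taken in either order.\<close>

lemma expansion:
  assumes X: "\<And>k. der (X k) (X (Suc k))" and Y: "bounded_clinear Y"
  defines "N \<equiv> 2 * s + 1"
  obtains h where "h holomorphic_on {z. Re z > -1}" "h 0 = 0"
    "\<And>z. Re z \<ge> 2 * real s \<Longrightarrow> Z (dg (\<lambda>x. X 0 (Y x))) z
       = (\<Sum>k<N. ((- z) gchoose k) * Z (dg (\<lambda>x. Y (X k x))) (z + of_nat k)) + h z"
proof -
  have bX: "bounded_clinear (X k)" for k using X by (auto simp: der_def)
  define a where "a e f = cinner f (Y e) * cinner e (X 0 f)" for e f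
  define t where "t e f z = taylor_rem N z (p e) (m e) (p f) (m f)" for e f z
  define h where "h z = (\<Sum>\<^sub>\<infinity>ef\<in>E \<times> E. (case ef of (e, f) \<Rightarrow> a e f * t e f z))" for z
  have pm: "(p e = 0 \<and> m e = c) \<or> (p e = m e \<and> m e \<ge> m0)" if "e \<in> E" for e
    using m0_le[OF that] by (simp add: p_def m_def)
  \<comment> \<open>The majorant is uniform on bounded parts of the half-plane; the decay of
    \<open>X 0\<close> absorbs the factor \<open>(1 + \<bar>p e - p f\<bar>) ^ M\<close> of the
    remainder bound.\<close>
  have abnd: "\<exists>B. B summable_on (E \<times> E) \<and> (\<forall>e\<in>E. \<forall>f\<in>E. \<forall>z. cmod z \<le> \<rho> \<longrightarrow> Re z \<ge> -1 \<longrightarrow> cmod (a e f * t e f z) \<le> B (e, f))" for \<rho>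
  proof -
    obtain C M where CM: "C \<ge> 0" "\<And>z p m q n. cmod z \<le> \<rho> \<Longrightarrow> Re z \<ge> -1 \<Longrightarrow> (p = 0 \<and> m = c) \<or> (p = m \<and> m \<ge> m0) \<Longrightarrow>
      (q = 0 \<and> n = c) \<or> (q = n \<and> n \<ge> m0) \<Longrightarrow> m \<ge> m0 \<Longrightarrow> n \<ge> m0 \<Longrightarrow>
      cmod (taylor_rem N z p m q n) \<le> C * (1 + \<bar>p - q\<bar>) ^ M / (m ^ s * n ^ s)"
      using taylor_rem_bound[OF m0 c, where s = s and \<rho> = \<rho>] unfolding N_def by blast
    obtain C' where C': "C' \<ge> 0" "\<And>e f. e \<in> E \<Longrightarrow> f \<in> E \<Longrightarrow> cmod (cinner e (X 0 f)) * (1 + \<bar>p e - p f\<bar>) ^ M \<le> C'"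
      using smooth_bound[of X, OF X] by blast
    have oY: "onorm Y \<ge> 0" using Y by (simp add: bounded_clinear_def onorm_pos_le)
    define K where "K = onorm Y * (C' * C)"
    have "cmod (a e f * t e f z) \<le> K * (1 / (m e ^ s * m f ^ s))"
      if ef: "e \<in> E" "f \<in> E" and z: "cmod z \<le> \<rho>" "Re z \<ge> -1" for e f z
    proof -
      have "cmod (a e f * t e f z) = cmod (cinner f (Y e)) * (cmod (cinner e (X 0 f)) * cmod (t e f z))"
        by (simp add: a_def norm_mult)
      also have "\<dots> \<le> onorm Y * (cmod (cinner e (X 0 f)) * (C * (1 + \<bar>p e - p f\<bar>) ^ M / (m e ^ s * m f ^ s)))"
        unfolding t_def using CM(2)[OF z pm[OF ef(1)] pm[OF ef(2)] m0_le[OF ef(1)] m0_le[OF ef(2)]]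
        by (intro mult_mono matrix_bound[OF Y ef(2,1)] oY mult_left_mono) auto
      also have "\<dots> = onorm Y * ((cmod (cinner e (X 0 f)) * (1 + \<bar>p e - p f\<bar>) ^ M) * (C * (1 / (m e ^ s * m f ^ s))))"
        by simp
      also have "\<dots> \<le> onorm Y * (C' * (C * (1 / (m e ^ s * m f ^ s))))"
        using CM(1) m_pos by (intro mult_left_mono mult_right_mono C'(2)[OF ef] oY) (auto simp: less_imp_le)
      finally show ?thesis by (simp add: K_def)
    qed
    moreover have "(\<lambda>(e, f). K * (1 / (m e ^ s * m f ^ s))) summable_on (E \<times> E)"
      using summable_on_cmult_right[OF summable_pairs, of K] by (simp add: case_prod_unfold)
    ultimately show ?thesis
      by (intro exI[of _ "\<lambda>(e, f). K * (1 / (m e ^ s * m f ^ s))"]) simp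
  qed
  have hol: "h holomorphic_on {z. Re z > -1}"
    unfolding h_def
  proof (rule holomorphic_on_infsum[OF open_Re_gt])
    show "(\<lambda>z. case ef of (e, f) \<Rightarrow> a e f * t e f z) holomorphic_on {z. Re z > -1}" for ef
      by (cases ef) (auto simp: t_def m_pos intro!: holomorphic_intros holomorphic_taylor_rem)
    fix z assume "z \<in> {z. Re z > -1}"
    then have z: "Re z > -1" by simp
    define r where "r = (Re z + 1) / 2"
    have r: "r > 0" using z by (simp add: r_def)
    have w: "Re w > -1 \<and> cmod w \<le> cmod z + r" if "w \<in> cball z r" for w
    proof -
      have "cmod (z - w) \<le> r" using that by (simp add: dist_norm)
      then have "Re z - Re w \<le> r" "cmod w \<le> cmod z + r"
        using complex_Re_le_cmod[of "z - w"] norm_triangle_sub[of w z] by (auto simp: norm_minus_commute)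
      then show ?thesis using z by (simp add: r_def field_simps)
    qed
    obtain B where B: "B summable_on (E \<times> E)" "\<And>e f z'. e \<in> E \<Longrightarrow> f \<in> E \<Longrightarrow> cmod z' \<le> cmod z + r \<Longrightarrow> Re z' \<ge> -1 \<Longrightarrow>
        cmod (a e f * t e f z') \<le> B (e, f)"
      using abnd[of "cmod z + r"] by blast
    show "\<exists>r>0. \<exists>B. cball z r \<subseteq> {z. Re z > -1} \<and> B summable_on E \<times> E \<and>
        (\<forall>ef\<in>E \<times> E. \<forall>w\<in>cball z r. cmod (case ef of (e, f) \<Rightarrow> a e f * t e f w) \<le> B ef)"
      using r B w by (intro exI[of _ r] exI[of _ B] conjI) (auto simp: less_imp_le)
  qed
  have h0: "h 0 = 0"
    unfolding h_def by (rule infsum_0) (auto simp: t_def taylor_rem_0 m_pos N_def)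
  have main: "Z (dg (\<lambda>x. X 0 (Y x))) z = (\<Sum>k<N. ((- z) gchoose k) * Z (dg (\<lambda>x. Y (X k x))) (z + of_nat k)) + h z"
    if z: "Re z \<ge> 2 * real s" for z
  proof -
    define w where "w = (\<lambda>(e, f). a e f * of_real (m e) powr (- z))"
    define v where "v k = (\<lambda>(e, f). a e f * of_real (p e - p f) ^ k * of_real (m f) powr (- z - of_nat k))" for k
    have "w summable_on (E \<times> E)"
    proof -
      obtain C where C: "C \<ge> 0" "\<And>e f. e \<in> E \<Longrightarrow> f \<in> E \<Longrightarrow>
        cmod (cinner f (Y e) * cinner e (X 0 f)) * \<bar>p e - p f\<bar> ^ 0 * (1 / m e ^ (2 * s)) \<le> C * (1 / (m e ^ s * m f ^ s))"
        using pair_bound[where X = X and j = 0, OF X Y] by metis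
      define q where "q = m0 powr (- (Re z - real (2 * s)))"
      have "cmod (w ef) \<le> q * C * (case ef of (e, f) \<Rightarrow> 1 / (m e ^ s * m f ^ s))" if efE: "ef \<in> E \<times> E" for ef
      proof -
        obtain e f where ef: "ef = (e, f)" "e \<in> E" "f \<in> E" using efE by auto
        have "cmod (w ef) \<le> cmod (a e f) * (q * (1 / m e ^ (2 * s)))"
          unfolding q_def w_def ef(1) prod.case norm_mult[of "a e f"]
          using z by (intro mult_left_mono m_powr_le ef) auto
        also have "\<dots> = q * (cmod (a e f) * \<bar>p e - p f\<bar> ^ 0 * (1 / m e ^ (2 * s)))" by simp
        also have "\<dots> \<le> q * (C * (1 / (m e ^ s * m f ^ s)))"
          unfolding a_def by (intro mult_left_mono C(2) ef) (simp add: q_def)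
        finally show ?thesis by (simp add: ef)
      qed
      then show ?thesis
        by (intro Infinite_Sum.abs_summable_summable[OF Infinite_Sum.abs_summable_on_comparison_test'[OF summable_on_cmult_right[OF summable_pairs, of "q * C"]]])
    qed
    then obtain S where S: "(w has_sum S) (E \<times> E)" by (auto simp: summable_on_def)
    have "((\<lambda>e. dg (\<lambda>x. X 0 (Y x)) e * of_real (m e) powr (- z)) has_sum S) E"
    proof (rule has_sum_SigmaD[OF S])
      show "((\<lambda>f. w (e, f)) has_sum (dg (\<lambda>x. X 0 (Y x)) e * of_real (m e) powr (- z))) E" for e
        using has_sum_cmult_left[OF onb_matrix_product[OF onb bX[of 0], of e "Y e"], of "of_real (m e) powr (- z)"]
        by (simp add: w_def a_def mult.commute[of "cinner _ (Y e)"])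
    qed
    then have ZS: "Z (dg (\<lambda>x. X 0 (Y x))) z = S" unfolding Z_def by (rule infsumI)
    have vS: "(v k has_sum Z (dg (\<lambda>x. Y (X k x))) (z + of_nat k)) (E \<times> E)" for k
    proof -
      have "v k summable_on (E \<times> E)"
      proof -
        obtain C where C: "C \<ge> 0" "\<And>e f. e \<in> E \<Longrightarrow> f \<in> E \<Longrightarrow>
          cmod (cinner f (Y e) * cinner e (X 0 f)) * \<bar>p e - p f\<bar> ^ k * (1 / m f ^ (2 * s)) \<le> C * (1 / (m e ^ s * m f ^ s))"
          using pair_bound[where X = X and j = k, OF X Y] by metis
        define q where "q = m0 powr (- (Re (z + of_nat k) - real (2 * s)))"
        have "cmod (v k ef) \<le> q * C * (case ef of (e, f) \<Rightarrow> 1 / (m e ^ s * m f ^ s))" if efE: "ef \<in> E \<times> E" for ef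
        proof -
          obtain e f where ef: "ef = (e, f)" "e \<in> E" "f \<in> E" using efE by auto
          have "cmod (v k ef) = cmod (a e f) * \<bar>p e - p f\<bar> ^ k * cmod (of_real (m f) powr (- (z + of_nat k)))"
            unfolding v_def ef(1) prod.case norm_mult norm_power norm_of_real by simp
          also have "\<dots> \<le> cmod (a e f) * \<bar>p e - p f\<bar> ^ k * (q * (1 / m f ^ (2 * s)))"
            unfolding q_def using z by (intro mult_left_mono m_powr_le ef) auto
          also have "\<dots> = q * (cmod (a e f) * \<bar>p e - p f\<bar> ^ k * (1 / m f ^ (2 * s)))" by simp
          also have "\<dots> \<le> q * (C * (1 / (m e ^ s * m f ^ s)))"
            unfolding a_def by (intro mult_left_mono C(2) ef) (simp add: q_def)
          finally show ?thesis by (simp add: ef)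
        qed
        then show ?thesis
          by (intro Infinite_Sum.abs_summable_summable[OF Infinite_Sum.abs_summable_on_comparison_test'[OF summable_on_cmult_right[OF summable_pairs, of "q * C"]]])
      qed
      then obtain T where T: "(v k has_sum T) (E \<times> E)" by (auto simp: summable_on_def)
      have Xk: "cinner e (X k f) = of_real (p e - p f) ^ k * cinner e (X 0 f)" if "e \<in> E" "f \<in> E" for e f
      proof (induction k)
        case (Suc k)
        then show ?case by (simp add: derD[OF X that] mult.assoc)
      qed simp
      have "((\<lambda>f. dg (\<lambda>x. Y (X k x)) f * of_real (m f) powr (- (z + of_nat k))) has_sum T) E"
      proof (rule has_sum_SigmaD)
        show "((\<lambda>(f, e). v k (e, f)) has_sum T) (E \<times> E)"
          using T by (subst (asm) has_sum_swap)
        fix f assume f: "f \<in> E"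
        have "((\<lambda>e. cinner f (Y e) * cinner e (X k f) * of_real (m f) powr (- (z + of_nat k))) has_sum
            dg (\<lambda>x. Y (X k x)) f * of_real (m f) powr (- (z + of_nat k))) E"
          by (rule has_sum_cmult_left[OF onb_matrix_product[OF onb Y]])
        then show "((\<lambda>e. case (f, e) of (f, e) \<Rightarrow> v k (e, f)) has_sum
            dg (\<lambda>x. Y (X k x)) f * of_real (m f) powr (- (z + of_nat k))) E"
          by (rule has_sum_cong[THEN iffD1, rotated]) (use f in \<open>simp add: v_def a_def Xk ac_simps\<close>)
      qed
      then have "Z (dg (\<lambda>x. Y (X k x))) (z + of_nat k) = T" unfolding Z_def by (rule infsumI)
      then show ?thesis using T by simp
    qed
    have "((\<lambda>ef. w ef - (\<Sum>k<N. ((- z) gchoose k) * v k ef)) has_sum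
        (S - (\<Sum>k<N. ((- z) gchoose k) * Z (dg (\<lambda>x. Y (X k x))) (z + of_nat k)))) (E \<times> E)"
      by (intro has_sum_minus S has_sum_sum has_sum_cmult_right vS)
    moreover have "w ef - (\<Sum>k<N. ((- z) gchoose k) * v k ef) = (case ef of (e, f) \<Rightarrow> a e f * t e f z)" for ef
      by (cases ef) (simp add: w_def v_def t_def taylor_rem_def right_diff_distrib sum_distrib_left ac_simps)
    ultimately have "h z = S - (\<Sum>k<N. ((- z) gchoose k) * Z (dg (\<lambda>x. Y (X k x))) (z + of_nat k))"
      unfolding h_def by (simp add: infsumI)
    then show ?thesis using ZS by simp
  qed
  show ?thesis by (rule that[OF hol h0 main])
qed

text \<open>For an absolutely summable diagonal the series converges up to the imaginary axis. The
  approach to 0 along the positive reals is enough to identify the value there.\<close>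

lemma Z_l1:
  assumes d: "(\<lambda>e. cmod (d e)) summable_on E"
  shows "Z d holomorphic_on {z. Re z > 0}"
    and "((\<lambda>x. Z d (of_real x)) \<longlongrightarrow> (\<Sum>\<^sub>\<infinity>e\<in>E. d e)) (at_right 0)"
proof -
  show "Z d holomorphic_on {z. Re z > 0}"
    unfolding Z_def
  proof (rule holomorphic_on_infsum[OF open_Re_gt])
    show "(\<lambda>z. d e * of_real (m e) powr (- z)) holomorphic_on {z. Re z > 0}" for e
      by (intro holomorphic_intros holomorphic_on_const_powr m_pos)
    fix z assume "z \<in> {z. Re z > 0}"
    then have z: "Re z > 0" by simp
    define r where "r = Re z / 2"
    have w: "Re w > 0 \<and> Re w \<le> 2 * Re z" if "w \<in> cball z r" for w
    proof -
      have "cmod (z - w) \<le> r" using that by (simp add: dist_norm)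
      then have "\<bar>Re z - Re w\<bar> \<le> r" using abs_Re_le_cmod[of "z - w"] by simp
      then have "Re z - Re w \<le> r" "Re w - Re z \<le> r" by linarith+
      then show ?thesis using z unfolding r_def by linarith
    qed
    have "cmod (d e * of_real (m e) powr (- w)) \<le> cmod (d e) * m0 powr (- (2 * Re z))"
      if "e \<in> E" "w \<in> cball z r" for e w
    proof -
      have "cmod (of_real (m e) powr (- w)) \<le> m0 powr (- Re w)"
        using w[OF that(2)] that(1) by (intro m_powr_le_1) auto
      also have "\<dots> \<le> m0 powr (- (2 * Re z))" using w[OF that(2)] m0 by (intro powr_mono') auto
      finally show ?thesis unfolding norm_mult by (rule mult_left_mono) simp
    qed
    then show "\<exists>r>0. \<exists>B. cball z r \<subseteq> {z. Re z > 0} \<and> B summable_on E \<and>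
        (\<forall>e\<in>E. \<forall>w\<in>cball z r. cmod (d e * of_real (m e) powr (- w)) \<le> B e)"
      using z w by (intro exI[of _ r] exI[of _ "\<lambda>e. cmod (d e) * m0 powr (- (2 * Re z))"] conjI)
        (auto simp: r_def intro!: summable_on_cmult_left d)
  qed
  have "continuous_on {0..1} (\<lambda>x. Z d (of_real x))"
    unfolding Z_def
  proof (rule continuous_on_infsum[where B = "\<lambda>e. cmod (d e) * m0 powr (- 1)"])
    show "(\<lambda>e. cmod (d e) * m0 powr (- 1)) summable_on E" by (intro summable_on_cmult_left d)
    show "cmod (d e * of_real (m e) powr (- of_real x)) \<le> cmod (d e) * m0 powr (- 1)"
      if "e \<in> E" "x \<in> {0..1}" for e x
    proof -
      have "cmod (of_real (m e) powr (- of_real x)) \<le> m0 powr (- x)"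
        using m_powr_le_1[OF that(1), of "of_real x"] that(2) by simp
      also have "\<dots> \<le> m0 powr (- 1)" using that m0 by (intro powr_mono') auto
      finally show ?thesis unfolding norm_mult by (rule mult_left_mono) simp
    qed
    show "continuous_on {0..1} (\<lambda>x. d e * of_real (m e) powr (- complex_of_real x))" for e
      using m_pos[of e] by (intro continuous_intros) auto
  qed
  then have "((\<lambda>x. Z d (of_real x)) \<longlongrightarrow> Z d (of_real 0)) (at 0 within {0..1})"
    unfolding continuous_on by (rule bspec) simp
  moreover have "at 0 within {0..1} = at_right (0::real)"
    by (rule at_within_Icc_at_right) simp
  moreover have "Z d (of_real 0) = (\<Sum>\<^sub>\<infinity>e\<in>E. d e)"
    unfolding Z_def using m_pos by (intro infsum_cong) (simp add: less_imp_neq[symmetric])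
  ultimately show "((\<lambda>x. Z d (of_real x)) \<longlongrightarrow> (\<Sum>\<^sub>\<infinity>e\<in>E. d e)) (at_right 0)"
    by simp
qed

end

subsection \<open>Residue functionals on the algebra\<close>

lemma mero_cont_sum:
  assumes "\<And>k. k \<in> K \<Longrightarrow> mero_cont (g k) (f k)"
  shows "mero_cont (\<lambda>z. \<Sum>k\<in>K. g k z) (\<lambda>z. \<Sum>k\<in>K. f k z)"
  using assms
proof (induction K rule: infinite_finite_induct)
  case (insert k K)
  then show ?case by (simp add: mero_cont_add)
qed (auto intro: mero_cont_entire)

lemma mero_cont_cmult: "mero_cont g f \<Longrightarrow> mero_cont (\<lambda>z. a * g z) (\<lambda>z. a * f z)"
  by (rule mero_cont_mult_entire) auto

lemma mero_cont_minus:
  assumes "mero_cont g f" "mero_cont g' f'"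
  shows "mero_cont (\<lambda>z. g z - g' z) (\<lambda>z. f z - f' z)"
  using mero_cont_add[OF assms(1) mero_cont_cmult[OF assms(2), of "-1"]] by simp

text \<open>\<open>B\<close> abstracts the properties of the generated algebra that the argument
  uses. With \<open>s \<ge> 2\<close> the expansion of length \<open>2 * s + 1\<close> covers the
  orders 1, 2 and 3, at which residues can occur.\<close>

locale dirac_algebra = summable_eigenbasis W D F c E lam eps s m0
  for W :: "'h::complex_hilbert_space set" and D F :: "'h \<Rightarrow> 'h" and c :: real
    and E :: "'h set" and lam eps :: "'h \<Rightarrow> real" and s :: nat and m0 :: real +
  fixes B :: "('h \<Rightarrow> 'h) set" and \<Sigma> :: "complex set"
  assumes s2: "s \<ge> 2"
    and B_der: "b \<in> B \<Longrightarrow> \<exists>b'\<in>B. der b b'"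
    and B_add: "a \<in> B \<Longrightarrow> b \<in> B \<Longrightarrow> (\<lambda>x. a x + b x) \<in> B"
    and B_scale: "b \<in> B \<Longrightarrow> (\<lambda>x. r *\<^sub>C b x) \<in> B"
    and B_comp: "a \<in> B \<Longrightarrow> b \<in> B \<Longrightarrow> a \<circ> b \<in> B"
    and F_B: "F \<in> B"
    and B_cont: "b \<in> B \<Longrightarrow> \<exists>f. f holomorphic_on - \<Sigma> \<and> (\<exists>R. \<forall>z. Re z > R \<longrightarrow> f z = zeta W D c b z)
      \<and> (\<forall>w\<in>\<Sigma>. \<exists>r. ((\<lambda>z. (z - w) * f z) \<longlongrightarrow> r) (at w))"
    and discrete: "\<not> z islimpt \<Sigma>"
    and zero_notin: "0 \<notin> \<Sigma>"
    and Re_le_3: "z \<in> \<Sigma> \<Longrightarrow> Re z \<le> 3"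
begin

lemma B_bounded: "b \<in> B \<Longrightarrow> bounded_clinear b"
  using B_der[of b] by (auto simp: der_def)

lemma B_minus: "a \<in> B \<Longrightarrow> b \<in> B \<Longrightarrow> (\<lambda>x. a x - b x) \<in> B"
  using B_add[OF _ B_scale[of b "-1"], of a] by (simp add: scaleC_minus_left scaleC_one)

text \<open>A total function, so that it can be iterated; on \<open>B\<close> it is determined,
  since a derivative is fixed by its matrix entries.\<close>

definition dB :: "('h \<Rightarrow> 'h) \<Rightarrow> 'h \<Rightarrow> 'h" where
  "dB b = (SOME b'. b' \<in> B \<and> der b b')"

lemma dB: assumes "b \<in> B" shows "dB b \<in> B" "der b (dB b)"
proof -
  have "\<exists>b'. b' \<in> B \<and> der b b'" using B_der[OF assms] by blast
  then have "dB b \<in> B \<and> der b (dB b)" unfolding dB_def by (rule someI_ex)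
  then show "dB b \<in> B" "der b (dB b)" by auto
qed

lemma dB_eqI: "b \<in> B \<Longrightarrow> der b b' \<Longrightarrow> dB b = b'"
  using der_unique[OF dB(2)] .

lemma dB_pow: "b \<in> B \<Longrightarrow> (dB ^^ k) b \<in> B"
  by (induction k) (auto simp: dB)

lemma der_dB_pow: "b \<in> B \<Longrightarrow> der ((dB ^^ k) b) ((dB ^^ Suc k) b)"
  using dB(2)[OF dB_pow] by simp

lemma dB_comp:
  assumes "a \<in> B" "b \<in> B"
  shows "dB (a \<circ> b) = (\<lambda>x. dB a (b x) + a (dB b x))"
  by (rule dB_eqI[OF B_comp[OF assms]]) (use der_comp[OF dB(2) dB(2)] assms in \<open>simp add: comp_def\<close>)

lemma dB_F: "dB F = (\<lambda>x. 0)"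
  by (rule dB_eqI[OF F_B der_F])

lemma dB_comp_F: "b \<in> B \<Longrightarrow> dB (b \<circ> F) = dB b \<circ> F"
  using bounded_clinear_zero[OF B_bounded] by (auto simp: dB_comp F_B dB_F)

lemma dB_F_comp: "b \<in> B \<Longrightarrow> dB (F \<circ> b) = F \<circ> dB b"
  by (auto simp: dB_comp F_B dB_F)

definition ext :: "('h \<Rightarrow> 'h) \<Rightarrow> complex \<Rightarrow> complex" where
  "ext b = (SOME f. f holomorphic_on - \<Sigma> \<and> (\<exists>R. \<forall>z. Re z > R \<longrightarrow> f z = zeta W D c b z)
      \<and> (\<forall>w\<in>\<Sigma>. \<exists>r. ((\<lambda>z. (z - w) * f z) \<longlongrightarrow> r) (at w)))"

lemma ext_props:
  assumes "b \<in> B"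
  shows ext_holomorphic: "ext b holomorphic_on - \<Sigma>"
    and ext_eq: "\<exists>R. \<forall>z. Re z > R \<longrightarrow> ext b z = zeta W D c b z"
    and ext_pole: "w \<in> \<Sigma> \<Longrightarrow> \<exists>r. ((\<lambda>z. (z - w) * ext b z) \<longlongrightarrow> r) (at w)"
  using someI_ex[OF B_cont[OF assms], folded ext_def] by auto

lemma closed_Sigma: "closed \<Sigma>"
  using discrete by (simp add: closed_limpt)

lemma ext_cont:
  assumes b: "b \<in> B"
  shows "mero_cont (zeta W D c b) (ext b)" "mero_cont (Z (dg b)) (ext b)"
proof -
  obtain R where R: "\<And>z. Re z > R \<Longrightarrow> ext b z = zeta W D c b z" using ext_eq[OF b] by blast
  have "ext b holomorphic_on {z. Re z > max R 3}"
    by (rule holomorphic_on_subset[OF ext_holomorphic[OF b]]) (use Re_le_3 in force)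
  then show z: "mero_cont (zeta W D c b) (ext b)"
    unfolding mero_cont_def using R
    by (intro conjI meromorphic_on_simple_poles[OF ext_holomorphic[OF b] discrete ext_pole[OF b]] exI[of _ "max R 3"]) auto
  show "mero_cont (Z (dg b)) (ext b)"
    by (rule mero_cont_cong[OF z, of "real s"]) (simp add: zeta_eq_Z[OF B_bounded[OF b]])
qed

lemma ext_tendsto:
  assumes "b \<in> B" "w \<notin> \<Sigma>"
  shows "(ext b \<longlongrightarrow> ext b w) (at w)"
proof -
  have "isCont (ext b) w"
    using holomorphic_on_imp_continuous_on[OF ext_holomorphic[OF assms(1)]] assms(2) closed_Sigma
    by (auto simp: continuous_on_eq_continuous_at open_Compl)
  then show ?thesis by (simp add: isCont_def)
qed

text \<open>The residue of the zeta function of \<open>b\<close> at \<open>k\<close>, which is that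
  of \<open>b |D|^(-k)\<close> at 0. Moving the point instead of the operator keeps the operator in
  \<open>B\<close>.\<close>

definition I :: "nat \<Rightarrow> ('h \<Rightarrow> 'h) \<Rightarrow> complex" where
  "I k b = Lim (at (of_nat k)) (\<lambda>z. (z - of_nat k) * ext b z)"

lemma simple_zero_tendsto:
  assumes "(f \<longlongrightarrow> l) (at w)"
  shows "((\<lambda>z. (z - w) * f z) \<longlongrightarrow> (0::complex)) (at w)"
proof -
  have "((\<lambda>z. (z - w) * f z) \<longlongrightarrow> (w - w) * l) (at w)" by (intro tendsto_intros assms)
  then show ?thesis by simp
qed

lemma I_tendsto:
  assumes "b \<in> B"
  shows "((\<lambda>z. (z - of_nat k) * ext b z) \<longlongrightarrow> I k b) (at (of_nat k))"
proof -
  obtain r where r: "((\<lambda>z. (z - of_nat k) * ext b z) \<longlongrightarrow> r) (at (of_nat k))"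
    using ext_pole[OF assms] simple_zero_tendsto[OF ext_tendsto[OF assms]] by metis
  then have "I k b = r" unfolding I_def by (intro tendsto_Lim) auto
  then show ?thesis using r by simp
qed

lemma I_eqI:
  assumes "b \<in> B" "mero_cont (Z (dg b)) f" "((\<lambda>z. (z - of_nat k) * f z) \<longlongrightarrow> r) (at (of_nat k))"
  shows "I k b = r"
proof -
  have "eventually (\<lambda>z. (z - of_nat k) * f z = (z - of_nat k) * ext b z) (at (of_nat k))"
    using mero_cont_unique[OF assms(2) ext_cont(2)[OF assms(1)]] by eventually_elim simp
  then have "((\<lambda>z. (z - of_nat k) * ext b z) \<longlongrightarrow> r) (at (of_nat k))"
    using assms(3) by (rule Lim_transform_eventually[rotated])
  then show ?thesis using I_tendsto[OF assms(1)] LIM_unique by blast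
qed

lemma I_regular: "b \<in> B \<Longrightarrow> of_nat k \<notin> \<Sigma> \<Longrightarrow> I k b = 0"
  by (rule I_eqI[OF _ ext_cont(2) simple_zero_tendsto[OF ext_tendsto]])

lemma I_high: "b \<in> B \<Longrightarrow> k \<ge> 4 \<Longrightarrow> I k b = 0"
  by (rule I_regular) (use Re_le_3[of "of_nat k"] in auto)

lemma I_0: "b \<in> B \<Longrightarrow> I 0 b = 0"
  by (rule I_regular) (use zero_notin in auto)

text \<open>The hypothesis relates diagonals, not operators: this is what permits integration by
  parts and moving \<open>F\<close> from one end of a word to the other.\<close>

lemma ext_lincomb:
  assumes b: "a \<in> B" "a' \<in> B" and eq: "\<And>e. e \<in> E \<Longrightarrow> dg b e = r * dg a e + r' * dg a' e"
  shows "mero_cont (Z (dg b)) (\<lambda>z. r * ext a z + r' * ext a' z)"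
proof (rule mero_cont_cong[where R = "real s"])
  show "mero_cont (\<lambda>z. r * Z (dg a) z + r' * Z (dg a') z) (\<lambda>z. r * ext a z + r' * ext a' z)"
    by (intro mero_cont_add mero_cont_cmult ext_cont b)
  fix z assume z: "Re z > real s"
  have bd: "\<And>e. e \<in> E \<Longrightarrow> cmod (q * dg x e) \<le> cmod q * onorm x" if "x \<in> B" for x q
    using dg_bound[OF B_bounded[OF that]] by (simp add: norm_mult mult_left_mono)
  have "Z (\<lambda>e. r * dg a e + r' * dg a' e) z = Z (\<lambda>e. r * dg a e) z + Z (\<lambda>e. r' * dg a' e) z"
    by (rule Z_add[OF bd[OF b(1)] bd[OF b(2)]]) (use z in auto)
  moreover have "Z (dg b) z = Z (\<lambda>e. r * dg a e + r' * dg a' e) z"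
    by (rule Z_cong) (rule eq)
  ultimately show "r * Z (dg a) z + r' * Z (dg a') z = Z (dg b) z"
    by (simp only: Z_cmult)
qed

lemma I_lincomb:
  assumes b: "b \<in> B" "a \<in> B" "a' \<in> B" and eq: "\<And>e. e \<in> E \<Longrightarrow> dg b e = r * dg a e + r' * dg a' e"
  shows "I k b = r * I k a + r' * I k a'"
proof (rule I_eqI[OF b(1) ext_lincomb[OF b(2,3) eq]])
  have "((\<lambda>z. r * ((z - of_nat k) * ext a z) + r' * ((z - of_nat k) * ext a' z)) \<longlongrightarrow> r * I k a + r' * I k a') (at (of_nat k))"
    by (intro tendsto_intros I_tendsto b)
  then show "((\<lambda>z. (z - of_nat k) * (r * ext a z + r' * ext a' z)) \<longlongrightarrow> r * I k a + r' * I k a') (at (of_nat k))"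
    by (simp add: algebra_simps)
qed

lemma ext_0_lincomb:
  assumes b: "b \<in> B" "a \<in> B" "a' \<in> B" and eq: "\<And>e. e \<in> E \<Longrightarrow> dg b e = r * dg a e + r' * dg a' e"
  shows "ext b 0 = r * ext a 0 + r' * ext a' 0"
proof (rule LIM_unique)
  show "(ext b \<longlongrightarrow> ext b 0) (at 0)" by (rule ext_tendsto[OF b(1) zero_notin])
  have "((\<lambda>z. r * ext a z + r' * ext a' z) \<longlongrightarrow> r * ext a 0 + r' * ext a' 0) (at 0)"
    by (intro tendsto_intros ext_tendsto b zero_notin)
  moreover have "eventually (\<lambda>z. r * ext a z + r' * ext a' z = ext b z) (at 0)"
    by (rule mero_cont_unique[OF ext_lincomb[OF b(2,3) eq] ext_cont(2)[OF b(1)]])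
  ultimately show "(ext b \<longlongrightarrow> r * ext a 0 + r' * ext a' 0) (at 0)"
    by (rule Lim_transform_eventually)
qed

lemma I_add: "a \<in> B \<Longrightarrow> b \<in> B \<Longrightarrow> I k (\<lambda>x. a x + b x) = I k a + I k b"
  using I_lincomb[of "\<lambda>x. a x + b x" a b 1 1 k] by (simp add: B_add cinner_add_right)

lemma I_minus: "a \<in> B \<Longrightarrow> b \<in> B \<Longrightarrow> I k (\<lambda>x. a x - b x) = I k a - I k b"
  using I_lincomb[of "\<lambda>x. a x - b x" a b 1 "-1" k] by (simp add: B_minus cinner_diff_right)

lemma I_parts:
  assumes "a \<in> B" "b \<in> B"
  shows "I k (dB a \<circ> b) = - I k (a \<circ> dB b)"
proof -
  have mem: "dB a \<circ> b \<in> B" "a \<circ> dB b \<in> B" using assms by (auto intro: B_comp dB)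
  have "der (a \<circ> b) (\<lambda>x. dB a (b x) + a (dB b x))"
    using dB(2)[OF B_comp[OF assms]] by (simp add: dB_comp[OF assms])
  \<comment> \<open>A diagonal entry of a derivative carries the factor
    \<open>p e - p e\<close>.\<close>
  then have eq: "dg (dB a \<circ> b) e = - 1 * dg (a \<circ> dB b) e + 0 * dg (a \<circ> dB b) e" if "e \<in> E" for e
    using derD[OF _ that that] by (fastforce simp: cinner_add_right add_eq_0_iff2)
  have "I k (dB a \<circ> b) = - 1 * I k (a \<circ> dB b) + 0 * I k (a \<circ> dB b)"
    by (rule I_lincomb[OF mem(1,2,2)]) (rule eq)
  then show ?thesis by simp
qed

text \<open>For \<open>k > 0\<close> the series itself is holomorphic near \<open>k\<close>. At
  \<open>k = 0\<close> it is known to be so only to the right, and the assumption that 0 is not in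
  \<open>\<Sigma>\<close> takes over.\<close>

lemma I_l1:
  assumes b: "b \<in> B" and l1: "(\<lambda>e. cmod (dg b e)) summable_on E"
  shows "I k b = 0"
proof (cases "k = 0")
  case True
  then show ?thesis using I_0[OF b] by simp
next
  case False
  have "eventually (\<lambda>z. ext b z = Z (dg b) z) (at (of_nat k))"
    by (rule mero_cont_eq_holomorphic[OF ext_cont(2)[OF b] Z_l1(1)[OF l1]]) (use False in auto)
  moreover have "(Z (dg b) \<longlongrightarrow> Z (dg b) (of_nat k)) (at (of_nat k))"
  proof -
    have "isCont (Z (dg b)) (of_nat k)"
      using holomorphic_on_imp_continuous_on[OF Z_l1(1)[OF l1]] False
      by (auto simp: continuous_on_eq_continuous_at open_Re_gt)
    then show ?thesis by (simp add: isCont_def)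
  qed
  ultimately have "(ext b \<longlongrightarrow> Z (dg b) (of_nat k)) (at (of_nat k))"
    using tendsto_cong by fastforce
  from simple_zero_tendsto[OF this] show ?thesis
    by (rule I_eqI[OF b ext_cont(2)[OF b]])
qed

text \<open>Continuation and series agree at small positive reals, and both are continuous from the
  right at 0.\<close>

lemma ext_0_l1:
  assumes b: "b \<in> B" and l1: "(\<lambda>e. cmod (dg b e)) summable_on E"
  shows "ext b 0 = (\<Sum>\<^sub>\<infinity>e\<in>E. dg b e)"
proof -
  obtain \<epsilon> where \<epsilon>: "\<epsilon> > 0" "ball 0 \<epsilon> \<subseteq> - \<Sigma>"
    using closed_Sigma zero_notin by (metis ComplI open_Compl openE)
  have eq: "ext b (of_real x) = Z (dg b) (of_real x)" if x: "0 < x" "x < \<epsilon>" for x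
  proof -
    have "of_real x \<in> ball (0::complex) \<epsilon>" using x by simp
    then have "(ext b \<longlongrightarrow> ext b (of_real x)) (at (of_real x))"
      using \<epsilon>(2) by (intro ext_tendsto[OF b]) blast
    moreover have "isCont (Z (dg b)) (of_real x)"
      using holomorphic_on_imp_continuous_on[OF Z_l1(1)[OF l1]] x
      by (auto simp: continuous_on_eq_continuous_at open_Re_gt)
    moreover have "eventually (\<lambda>z. ext b z = Z (dg b) z) (at (of_real x))"
      by (rule mero_cont_eq_holomorphic[OF ext_cont(2)[OF b] Z_l1(1)[OF l1]]) (use x in auto)
    ultimately show ?thesis
      using tendsto_cong[of "ext b" "Z (dg b)"] by (simp add: isCont_def) (metis LIM_unique)
  qed
  have "((\<lambda>x. ext b (of_real x)) \<longlongrightarrow> ext b 0) (at_right 0)"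
  proof -
    have "isCont (ext b) (of_real 0)"
      using ext_tendsto[OF b zero_notin] by (simp add: isCont_def)
    from isCont_tendsto_compose[OF this tendsto_of_real[OF tendsto_ident_at]]
    show ?thesis by simp
  qed
  moreover have "eventually (\<lambda>x. ext b (of_real x) = Z (dg b) (of_real x)) (at_right 0)"
    using \<epsilon>(1) by (auto simp: eventually_at_right_field eq)
  ultimately have "((\<lambda>x. Z (dg b) (of_real x)) \<longlongrightarrow> ext b 0) (at_right 0)"
    by (rule Lim_transform_eventually)
  then show ?thesis using Z_l1(2)[OF l1] tendsto_unique trivial_limit_at_right_real by blast
qed

lemma ext_expansion:
  assumes X: "X \<in> B" and Y: "Y \<in> B"
  shows "\<exists>h. h holomorphic_on {z. Re z > -1} \<and> h 0 = 0 \<and> (\<forall>w. Re w > -1 \<longrightarrow>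
    eventually (\<lambda>z. ext (X \<circ> Y) z
       = (\<Sum>k<2 * s + 1. ((- z) gchoose k) * ext (Y \<circ> (dB ^^ k) X) (z + of_nat k)) + h z) (at w))"
proof -
  obtain h where h: "h holomorphic_on {z. Re z > -1}" "h 0 = 0"
    "\<And>z. Re z \<ge> 2 * real s \<Longrightarrow> Z (dg (\<lambda>x. X (Y x))) z
       = (\<Sum>k<2 * s + 1. ((- z) gchoose k) * Z (dg (\<lambda>x. Y ((dB ^^ k) X x))) (z + of_nat k)) + h z"
    using expansion[of "\<lambda>k. (dB ^^ k) X" Y, OF der_dB_pow[OF X] B_bounded[OF Y]] by auto
  define f where "f z = ext (X \<circ> Y) z - (\<Sum>k<2 * s + 1. ((- z) gchoose k) * ext (Y \<circ> (dB ^^ k) X) (z + of_nat k))" for z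
  define g where "g z = Z (dg (X \<circ> Y)) z - (\<Sum>k<2 * s + 1. ((- z) gchoose k) * Z (dg (Y \<circ> (dB ^^ k) X)) (z + of_nat k))" for z
  have "mero_cont g f"
    unfolding g_def f_def
    by (intro mero_cont_minus mero_cont_sum mero_cont_mult_entire mero_cont_shift ext_cont B_comp dB_pow X Y
        holomorphic_on_gbinomial)
  then have "eventually (\<lambda>z. f z = h z) (at w)" if "Re w > -1" for w
    by (rule mero_cont_eq_holomorphic[OF _ h(1), where R = "2 * real s"]) (use that h(3) in \<open>auto simp: g_def\<close>)
  then have "eventually (\<lambda>z. ext (X \<circ> Y) z
       = (\<Sum>k<2 * s + 1. ((- z) gchoose k) * ext (Y \<circ> (dB ^^ k) X) (z + of_nat k)) + h z) (at w)" if "Re w > -1" for w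
    using that by (auto simp: f_def algebra_simps)
  with h(1,2) show ?thesis by blast
qed

lemma I_trace:
  assumes X: "X \<in> B" and Y: "Y \<in> B"
  shows "I 3 (X \<circ> Y) = I 3 (Y \<circ> X)"
proof -
  obtain h where h: "h holomorphic_on {z. Re z > -1}" "h 0 = 0"
    "\<forall>w. Re w > -1 \<longrightarrow> eventually (\<lambda>z. ext (X \<circ> Y) z
       = (\<Sum>k<2 * s + 1. ((- z) gchoose k) * ext (Y \<circ> (dB ^^ k) X) (z + of_nat k)) + h z) (at w)"
    using ext_expansion[OF X Y] by (elim exE conjE)
  define G where "G k z = ((- z) gchoose k) * ext (Y \<circ> (dB ^^ k) X) (z + of_nat k)" for k z
  have YX: "Y \<circ> (dB ^^ k) X \<in> B" for k by (intro B_comp dB_pow X Y)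
  have G: "((\<lambda>z. (z - of_nat 3) * G k z) \<longlongrightarrow> (if k = 0 then I 3 (Y \<circ> X) else 0)) (at (of_nat 3))" for k
  proof (cases "k = 0")
    case True
    then show ?thesis using I_tendsto[OF YX[of 0], of 3] by (simp add: G_def)
  next
    case False
    have w: "(of_nat 3 + of_nat k :: complex) \<notin> \<Sigma>" using Re_le_3[of "of_nat 3 + of_nat k"] False by auto
    have "isCont (ext (Y \<circ> (dB ^^ k) X)) (of_nat 3 + of_nat k)"
      using ext_tendsto[OF YX w] by (simp add: isCont_def)
    then have "isCont (\<lambda>z. ext (Y \<circ> (dB ^^ k) X) (z + of_nat k)) (of_nat 3)"
      by (rule isCont_o2[where f = "\<lambda>z. z + of_nat k", rotated]) (intro continuous_intros)
    moreover have "isCont (\<lambda>z. (- z) gchoose k) (of_nat 3 :: complex)"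
      using holomorphic_on_imp_continuous_on[OF holomorphic_on_gbinomial[of k UNIV]]
      by (simp add: continuous_on_eq_continuous_at)
    ultimately have "isCont (G k) (of_nat 3)"
      unfolding G_def by (intro continuous_intros)
    then have "(G k \<longlongrightarrow> G k (of_nat 3)) (at (of_nat 3))" by (simp add: isCont_def)
    from simple_zero_tendsto[OF this] show ?thesis using False by simp
  qed
  have hc: "(h \<longlongrightarrow> h (of_nat 3)) (at (of_nat 3))"
    using holomorphic_on_imp_continuous_on[OF h(1)]
    by (auto simp: continuous_on_eq_continuous_at open_Re_gt isCont_def)
  have "((\<lambda>z. (\<Sum>k<2 * s + 1. (z - of_nat 3) * G k z) + (z - of_nat 3) * h z) \<longlongrightarrow>
      (\<Sum>k<2 * s + 1. if k = 0 then I 3 (Y \<circ> X) else 0) + 0) (at (of_nat 3))"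
    by (intro tendsto_add tendsto_sum G simple_zero_tendsto[OF hc])
  also have "(\<Sum>k<2 * s + 1. if k = 0 then I 3 (Y \<circ> X) else 0) + 0 = I 3 (Y \<circ> X)" by simp
  finally have lim: "((\<lambda>z. (\<Sum>k<2 * s + 1. (z - of_nat 3) * G k z) + (z - of_nat 3) * h z) \<longlongrightarrow> I 3 (Y \<circ> X)) (at (of_nat 3))" .
  have "eventually (\<lambda>z. (\<Sum>k<2 * s + 1. (z - of_nat 3) * G k z) + (z - of_nat 3) * h z
      = (z - of_nat 3) * ext (X \<circ> Y) z) (at (of_nat 3))"
    using h(3)[rule_format, of "of_nat 3"]
    by (simp, elim eventually_mono) (simp add: G_def sum_distrib_left algebra_simps)
  from Lim_transform_eventually[OF lim this] show ?thesis
    by (intro I_eqI[OF B_comp[OF X Y] ext_cont(2)[OF B_comp[OF X Y]]])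
qed

text \<open>The binomial coefficient has a simple zero at 0, and this is its slope. It supplies the
  coefficients -1, 1/2 and -1/3 of the residues in the expansion at 0.\<close>

lemma gbinomial_quotient_tendsto:
  "((\<lambda>z. ((- z) gchoose Suc j) / z) \<longlongrightarrow> (-1) ^ Suc j / of_nat (Suc j)) (at (0::complex))"
proof -
  have "((\<lambda>z::complex. (-1) ^ Suc j * (\<Prod>i<j. z + 1 + of_nat i) / fact (Suc j)) \<longlongrightarrow>
      (-1) ^ Suc j * (\<Prod>i<j. 0 + 1 + of_nat i) / fact (Suc j)) (at 0)"
    by (intro tendsto_intros) (rule fact_nonzero)
  also have "(\<Prod>i<j. 0 + 1 + of_nat i :: complex) = fact j"
    by (simp add: fact_prod_Suc lessThan_atLeast0 flip: of_nat_prod of_nat_Suc)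
  also have "(-1) ^ Suc j * fact j / fact (Suc j) = ((-1) ^ Suc j / of_nat (Suc j) :: complex)"
    by (simp add: divide_simps del: of_nat_Suc)
  finally have lim: "((\<lambda>z::complex. (-1) ^ Suc j * (\<Prod>i<j. z + 1 + of_nat i) / fact (Suc j)) \<longlongrightarrow>
      (-1) ^ Suc j / of_nat (Suc j)) (at 0)" .
  have poch: "pochhammer z (Suc j) = z * (\<Prod>i<j. z + 1 + of_nat i)" for z :: complex
    by (subst pochhammer_rec) (simp add: pochhammer_prod atLeast0LessThan)
  have "eventually (\<lambda>z::complex. (-1) ^ Suc j * (\<Prod>i<j. z + 1 + of_nat i) / fact (Suc j) = ((- z) gchoose Suc j) / z) (at 0)"
    unfolding eventually_at_filter
    by (intro always_eventually allI impI)
      (simp add: gbinomial_pochhammer poch del: fact_Suc)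
  from Lim_transform_eventually[OF lim this] show ?thesis .
qed

lemma ext_0_expansion:
  assumes X: "X \<in> B" and Y: "Y \<in> B"
  shows "ext (X \<circ> Y) 0 = ext (Y \<circ> X) 0 - I 1 (Y \<circ> dB X) + 1/2 * I 2 (Y \<circ> dB (dB X)) - 1/3 * I 3 (Y \<circ> dB (dB (dB X)))"
proof -
  obtain h where h: "h holomorphic_on {z. Re z > -1}" "h 0 = 0"
    "\<forall>w. Re w > -1 \<longrightarrow> eventually (\<lambda>z. ext (X \<circ> Y) z
       = (\<Sum>k<2 * s + 1. ((- z) gchoose k) * ext (Y \<circ> (dB ^^ k) X) (z + of_nat k)) + h z) (at w)"
    using ext_expansion[OF X Y] by (elim exE conjE)
  define G where "G k z = ((- z) gchoose k) * ext (Y \<circ> (dB ^^ k) X) (z + of_nat k)" for k z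
  define L where "L k = (if k = 0 then ext (Y \<circ> X) 0 else (-1) ^ k / of_nat k * I k (Y \<circ> (dB ^^ k) X))" for k
  have YX: "Y \<circ> (dB ^^ k) X \<in> B" for k by (intro B_comp dB_pow X Y)
  have G: "(G k \<longlongrightarrow> L k) (at 0)" for k
  proof (cases k)
    case 0
    have "G 0 = ext (Y \<circ> X)" by (simp add: G_def fun_eq_iff)
    then show ?thesis using ext_tendsto[OF YX[of 0] zero_notin] 0 by (simp add: L_def)
  next
    case (Suc j)
    have "((\<lambda>z. ((- z) gchoose k) / z * (((of_nat k + z) - of_nat k) * ext (Y \<circ> (dB ^^ k) X) (of_nat k + z))) \<longlongrightarrow>
        (-1) ^ k / of_nat k * I k (Y \<circ> (dB ^^ k) X)) (at 0)"
      unfolding Suc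
      by (intro tendsto_mult gbinomial_quotient_tendsto LIM_offset_zero[OF I_tendsto[OF YX]])
    moreover have "eventually (\<lambda>z. ((- z) gchoose k) / z * (((of_nat k + z) - of_nat k) * ext (Y \<circ> (dB ^^ k) X) (of_nat k + z)) = G k z) (at 0)"
      unfolding eventually_at_filter by (intro always_eventually allI impI) (simp add: G_def add.commute)
    ultimately show ?thesis
      using Lim_transform_eventually Suc by (fastforce simp: L_def)
  qed
  have "(h \<longlongrightarrow> h 0) (at 0)"
    using holomorphic_on_imp_continuous_on[OF h(1)]
    by (auto simp: continuous_on_eq_continuous_at open_Re_gt isCont_def)
  then have hc: "(h \<longlongrightarrow> 0) (at 0)" by (simp only: h(2))
  have "((\<lambda>z. (\<Sum>k<2 * s + 1. G k z) + h z) \<longlongrightarrow> (\<Sum>k<2 * s + 1. L k) + 0) (at 0)"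
    by (intro tendsto_add tendsto_sum G hc)
  moreover have "eventually (\<lambda>z. (\<Sum>k<2 * s + 1. G k z) + h z = ext (X \<circ> Y) z) (at 0)"
    using h(3)[rule_format, of 0] by (simp, elim eventually_mono) (simp add: G_def)
  ultimately have "(ext (X \<circ> Y) \<longlongrightarrow> (\<Sum>k<2 * s + 1. L k) + 0) (at 0)"
    by (rule Lim_transform_eventually)
  then have "ext (X \<circ> Y) 0 = (\<Sum>k<2 * s + 1. L k)"
    using LIM_unique[OF ext_tendsto[OF B_comp[OF X Y] zero_notin]] by simp
  \<comment> \<open>From order 4 on the residues are taken to the right of the dimension
    spectrum.\<close>
  also have "\<dots> = (\<Sum>k<4. L k)"
    by (rule sum.mono_neutral_right) (use s2 I_high[OF YX] in \<open>auto simp: L_def\<close>)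
  also have "\<dots> = ext (Y \<circ> X) 0 - I 1 (Y \<circ> dB X) + 1/2 * I 2 (Y \<circ> dB (dB X)) - 1/3 * I 3 (Y \<circ> dB (dB (dB X)))"
    by (simp add: L_def eval_nat_numeral)
  finally show ?thesis .
qed

end

subsection \<open>The cochains\<close>

context dirac_algebra
begin

lemma ncint_I:
  assumes b: "b \<in> B"
  shows "ncint W D c (b \<circ> absD_powr W D c (- of_nat k)) = I k b"
  unfolding ncint_def
proof (rule residue_mero_ext)
  show "mero_cont (zeta W D c (b \<circ> absD_powr W D c (- of_nat k))) (\<lambda>z. ext b (z + of_nat k))"
    by (rule mero_cont_cong[OF mero_cont_shift[OF ext_cont(1)[OF b]], where R = 0])
      (simp add: zeta_shift)
  show "((\<lambda>z. z * ext b (z + of_nat k)) \<longlongrightarrow> I k b) (at 0)"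
    using LIM_offset_zero[OF I_tendsto[OF b, of k]] by (simp add: add.commute)
qed

lemma p_powr_le:
  assumes "j \<le> n"
  shows "cmod (of_real (p e) ^ j * of_real (m e) powr (- (z + of_nat n))) \<le> cmod (of_real (m e) powr (- (z + of_nat (n - j))))"
proof -
  have "cmod (of_real (p e) ^ j * of_real (m e) powr (- (z + of_nat n))) = p e ^ j * m e powr (- (Re z + real n))"
    using m_pos[of e] p_nonneg[of e] by (simp add: norm_mult norm_power norm_powr_real)
  also have "\<dots> \<le> m e ^ j * m e powr (- (Re z + real n))"
    by (intro mult_right_mono power_mono p_le_m p_nonneg) auto
  also have "\<dots> = m e powr (real j + (- (Re z + real n)))"
    using m_pos[of e] by (simp only: powr_add powr_realpow)
  also have "real j + (- (Re z + real n)) = - (Re z + real (n - j))" using assms by simp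
  finally show ?thesis using m_pos[of e] by (simp add: norm_powr_real)
qed

lemma p_powr_bound:
  assumes "j \<le> n" "e \<in> E" "Re z \<ge> 0"
  shows "cmod (of_real (p e) ^ j * of_real (m e) powr (- (z + of_nat n))) \<le> m0 powr (- (Re z + real n))"
proof -
  have "cmod (of_real (p e) ^ j * of_real (m e) powr (- (z + of_nat n))) \<le> m0 powr (- Re (z + of_nat (n - j)))"
    using order_trans[OF p_powr_le[OF assms(1)] m_powr_le_1[OF assms(2)]] assms(3) by simp
  also have "\<dots> \<le> m0 powr (- (Re z + real n))"
    using m0 by (intro powr_mono') auto
  finally show ?thesis .
qed

text \<open>For unbounded \<open>P\<close>, such as words with \<open>nabla\<close>, the operator
  \<open>P |D|^(-n)\<close> is handled through bounded constituents: it is a combination of the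
  \<open>b j |D|^(j-n)\<close>, where the factor \<open>|D|^j\<close> with \<open>j \<ge> 1\<close>
  vanishes on the kernel.\<close>

lemma ncint_lincomb:
  assumes b: "\<And>j. b j \<in> B" and J: "J \<le> n"
    and P: "\<And>z x. Re z \<ge> 0 \<Longrightarrow> P (absD_powr W D c (- of_nat n) (absD_powr W D c (- z) x))
      = (\<Sum>j\<le>J. \<kappa> j *\<^sub>C b j (diag_op (\<lambda>e. of_real (p e) ^ j * of_real (m e) powr (- (z + of_nat n))) x))"
  shows "ncint W D c (P \<circ> absD_powr W D c (- of_nat n)) = (\<Sum>j\<le>J. \<kappa> j * I (n - j) (b j))"
  unfolding ncint_def
proof (rule residue_mero_ext)
  \<comment> \<open>The diagonal sum over the kernel, which \<open>ext\<close> counts although the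
    factor \<open>p^j\<close> kills it. For \<open>j = 0\<close> the factor is 1 and nothing has to
    be corrected.\<close>
  define K where "K j = (if j = 0 then 0 else \<Sum>e\<in>{e\<in>E. lam e = 0}. dg (b j) e)" for j
  define f where "f z = (\<Sum>j\<le>J. \<kappa> j * (ext (b j) (z + of_nat (n - j)) - K j * of_real c powr (- (z + of_nat (n - j)))))" for z
  show "mero_cont (zeta W D c (P \<circ> absD_powr W D c (- of_nat n))) f"
  proof (rule mero_cont_cong[where R = "real s"])
    show "mero_cont (\<lambda>z. \<Sum>j\<le>J. \<kappa> j * (Z (dg (b j)) (z + of_nat (n - j)) - K j * of_real c powr (- (z + of_nat (n - j))))) f"
      unfolding f_def using c
      by (intro mero_cont_sum mero_cont_cmult mero_cont_minus mero_cont_shift ext_cont b mero_cont_entire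
          holomorphic_on_const_powr holomorphic_intros)
    fix z assume z: "Re z > real s"
    define g where "g j e = of_real (p e) ^ j * complex_of_real (m e) powr (- (z + of_nat n))" for j e
    have g_le: "cmod (g j e) \<le> cmod (of_real (m e) powr (- (z + of_nat (n - j))))" if "j \<le> J" for j e
      unfolding g_def using that J by (intro p_powr_le) simp
    have g1: "cmod (g j e) \<le> m0 powr (- Re (z + of_nat (n - j)))" if "j \<le> J" "e \<in> E" for j e
      using order_trans[OF g_le[OF that(1)] m_powr_le_1[OF that(2)]] z by simp
    have g2: "(\<lambda>e. cmod (g j e)) summable_on E" if "j \<le> J" for j
    proof (rule Infinite_Sum.abs_summable_on_comparison_test')
      show "(\<lambda>e. cmod (of_real (m e) powr (- (z + of_nat (n - j))))) summable_on E"
        using Z_summable[of "\<lambda>_. 1" 1 "z + of_nat (n - j)"] z by simp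
    qed (use g_le[OF that] in simp)
    have tr: "((\<lambda>e. g j e * dg (b j) e) has_sum (Z (dg (b j)) (z + of_nat (n - j)) - K j * of_real c powr (- (z + of_nat (n - j))))) E"
      if j: "j \<le> J" for j
    proof (cases "j = 0")
      case True
      have "((\<lambda>e. dg (b j) e * of_real (m e) powr (- (z + of_nat n))) has_sum Z (dg (b j)) (z + of_nat n)) E"
        by (rule Z_has_sum[OF dg_bound[OF B_bounded[OF b]]]) (use z in auto)
      then show ?thesis using True by (simp add: g_def K_def mult.commute)
    next
      case False
      have "(z + of_nat (n - j)) + of_nat j = z + of_nat n" using j J by (simp add: of_nat_diff)
      moreover have "((\<lambda>e. dg (b j) e * of_real (p e) ^ j * of_real (m e) powr (- ((z + of_nat (n - j)) + of_nat j))) has_sum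
          (Z (dg (b j)) (z + of_nat (n - j)) - (\<Sum>e\<in>{e\<in>E. lam e = 0}. dg (b j) e) * of_real c powr (- (z + of_nat (n - j))))) E"
        by (rule Z_p_power[OF dg_bound[OF B_bounded[OF b]]]) (use z False in auto)
      ultimately show ?thesis using False by (simp only: g_def K_def if_False ac_simps)
    qed
    define v where "v e = (\<Sum>j\<le>J. \<kappa> j *\<^sub>C g j e *\<^sub>C b j e)" for e
    have "zeta W D c (P \<circ> absD_powr W D c (- of_nat n)) z = (\<Sum>\<^sub>\<infinity>e\<in>E. cinner e (v e))"
      unfolding zeta_def
    proof (rule op_trace_basis)
      fix x
      have "((\<lambda>e. \<Sum>j\<le>J. \<kappa> j *\<^sub>C cinner e x *\<^sub>C g j e *\<^sub>C b j e) has_sum (\<Sum>j\<le>J. \<kappa> j *\<^sub>C b j (diag_op (g j) x))) E"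
        by (intro has_sum_sum has_sum_bounded_linear[OF bounded_linear_scaleC] op_trace_diag(1)[OF B_bounded[OF b] g1 g2]) auto
      moreover have "(\<Sum>j\<le>J. \<kappa> j *\<^sub>C cinner e x *\<^sub>C g j e *\<^sub>C b j e) = cinner e x *\<^sub>C v e" for e
        by (simp add: v_def scaleC_sum_right scaleC_scaleC mult.left_commute)
      moreover have "(P \<circ> absD_powr W D c (- of_nat n) \<circ> absD_powr W D c (- z)) x = (\<Sum>j\<le>J. \<kappa> j *\<^sub>C b j (diag_op (g j) x))"
      proof -
        have gd: "g j = (\<lambda>e. of_real (p e) ^ j * complex_of_real (m e) powr (- (z + of_nat n)))" for j
          by (simp add: fun_eq_iff g_def)
        have "Re z \<ge> 0" using z by (meson less_imp_le of_nat_0_le_iff order_trans)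
        from P[OF this, of x] show ?thesis by (simp only: comp_apply gd)
      qed
      ultimately show "((\<lambda>e. cinner e x *\<^sub>C v e) has_sum (P \<circ> absD_powr W D c (- of_nat n) \<circ> absD_powr W D c (- z)) x) E"
        by simp
    next
      have "(\<lambda>e. \<Sum>j\<le>J. cmod (\<kappa> j) * norm (g j e *\<^sub>C b j e)) summable_on E"
      proof -
        have "((\<lambda>e. norm (g j e *\<^sub>C b j e)) has_sum (\<Sum>\<^sub>\<infinity>e\<in>E. norm (g j e *\<^sub>C b j e))) E" if "j \<le> J" for j
          by (rule has_sum_infsum[OF op_trace_diag(2)[OF B_bounded[OF b] g1 g2]]) (use that in auto)
        then have "((\<lambda>e. \<Sum>j\<le>J. cmod (\<kappa> j) * norm (g j e *\<^sub>C b j e)) has_sum (\<Sum>j\<le>J. cmod (\<kappa> j) * (\<Sum>\<^sub>\<infinity>e\<in>E. norm (g j e *\<^sub>C b j e)))) E"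
          by (intro has_sum_sum has_sum_cmult_right) auto
        then show ?thesis by (auto simp: summable_on_def)
      qed
      then show "(\<lambda>e. norm (v e)) summable_on E"
      proof (rule Infinite_Sum.abs_summable_on_comparison_test')
        show "norm (v e) \<le> (\<Sum>j\<le>J. cmod (\<kappa> j) * norm (g j e *\<^sub>C b j e))" for e
          unfolding v_def by (rule order_trans[OF norm_sum]) (simp add: norm_scaleC)
      qed
    qed
    also have "\<dots> = (\<Sum>j\<le>J. \<kappa> j * (Z (dg (b j)) (z + of_nat (n - j)) - K j * of_real c powr (- (z + of_nat (n - j)))))"
    proof (rule infsumI)
      have "((\<lambda>e. \<Sum>j\<le>J. \<kappa> j * (g j e * dg (b j) e)) has_sum
          (\<Sum>j\<le>J. \<kappa> j * (Z (dg (b j)) (z + of_nat (n - j)) - K j * of_real c powr (- (z + of_nat (n - j)))))) E"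
        by (intro has_sum_sum has_sum_cmult_right tr) auto
      then show "((\<lambda>e. cinner e (v e)) has_sum
          (\<Sum>j\<le>J. \<kappa> j * (Z (dg (b j)) (z + of_nat (n - j)) - K j * of_real c powr (- (z + of_nat (n - j)))))) E"
        by (simp add: v_def cinner_sum_right cinner_scaleC_right)
    qed
    finally show "(\<Sum>j\<le>J. \<kappa> j * (Z (dg (b j)) (z + of_nat (n - j)) - K j * of_real c powr (- (z + of_nat (n - j)))))
        = zeta W D c (P \<circ> absD_powr W D c (- of_nat n)) z" by (rule sym)
  qed
  have lim1: "((\<lambda>z. z * ext (b j) (z + of_nat (n - j))) \<longlongrightarrow> I (n - j) (b j)) (at 0)" for j
    using LIM_offset_zero[OF I_tendsto[OF b, of "n - j" j]] by (simp add: add.commute)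
  have lim2: "((\<lambda>z. (z - 0) * (K j * of_real c powr (- (z + of_nat (n - j))))) \<longlongrightarrow> 0) (at 0)" for j
    by (rule simple_zero_tendsto[where l = "K j * of_real c powr (- (0 + of_nat (n - j)))"])
      (use c in \<open>intro tendsto_intros; simp\<close>)
  have "((\<lambda>z. \<Sum>j\<le>J. \<kappa> j * (z * ext (b j) (z + of_nat (n - j)) - (z - 0) * (K j * of_real c powr (- (z + of_nat (n - j))))))
      \<longlongrightarrow> (\<Sum>j\<le>J. \<kappa> j * (I (n - j) (b j) - 0))) (at 0)"
    by (intro tendsto_intros lim1 lim2)
  then show "((\<lambda>z. z * f z) \<longlongrightarrow> (\<Sum>j\<le>J. \<kappa> j * I (n - j) (b j))) (at 0)"
    by (simp add: f_def sum_distrib_left right_diff_distrib mult.left_commute)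
qed

text \<open>Equality under the residue at \<open>3\<close>. By the trace property, multiplying from one side only
  suffices to get a two-sided congruence.\<close>

definition equiv3 :: "('h \<Rightarrow> 'h) \<Rightarrow> ('h \<Rightarrow> 'h) \<Rightarrow> bool"  (infix "\<simeq>" 50) where
  "a \<simeq> b \<longleftrightarrow> a \<in> B \<and> b \<in> B \<and> (\<forall>X\<in>B. I 3 (X \<circ> a) = I 3 (X \<circ> b))"

lemma equiv3_refl: "a \<in> B \<Longrightarrow> a \<simeq> a"
  by (simp add: equiv3_def)

lemma equiv3_trans: "a \<simeq> b \<Longrightarrow> b \<simeq> b' \<Longrightarrow> a \<simeq> b'"
  by (simp add: equiv3_def)

lemma equiv3_I: "a \<simeq> b \<Longrightarrow> X \<in> B \<Longrightarrow> I 3 (X \<circ> a) = I 3 (X \<circ> b)"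
  by (simp add: equiv3_def)

lemma equiv3_comp:
  assumes "a \<simeq> a'" "b \<simeq> b'"
  shows "a \<circ> b \<simeq> a' \<circ> b'"
  unfolding equiv3_def
proof (intro conjI ballI)
  have mem: "a \<in> B" "a' \<in> B" "b \<in> B" "b' \<in> B" using assms by (auto simp: equiv3_def)
  then show "a \<circ> b \<in> B" "a' \<circ> b' \<in> B" by (auto intro: B_comp)
  fix X assume X: "X \<in> B"
  have "I 3 (X \<circ> (a \<circ> b)) = I 3 ((X \<circ> a) \<circ> b)" by (simp only: comp_assoc)
  also have "\<dots> = I 3 ((X \<circ> a) \<circ> b')" by (intro equiv3_I assms B_comp X mem)
  also have "\<dots> = I 3 (b' \<circ> (X \<circ> a))" by (intro I_trace B_comp X mem)
  also have "\<dots> = I 3 ((b' \<circ> X) \<circ> a)" by (simp only: comp_assoc)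
  also have "\<dots> = I 3 ((b' \<circ> X) \<circ> a')" by (intro equiv3_I assms B_comp X mem)
  also have "\<dots> = I 3 (b' \<circ> (X \<circ> a'))" by (simp only: comp_assoc)
  also have "\<dots> = I 3 ((X \<circ> a') \<circ> b')" by (intro I_trace B_comp X mem)
  also have "\<dots> = I 3 (X \<circ> (a' \<circ> b'))" by (simp only: comp_assoc)
  finally show "I 3 (X \<circ> (a \<circ> b)) = I 3 (X \<circ> (a' \<circ> b'))" .
qed

lemma equiv3_dB:
  assumes "a \<simeq> b"
  shows "dB a \<simeq> dB b"
  unfolding equiv3_def
proof (intro conjI ballI)
  have mem: "a \<in> B" "b \<in> B" using assms by (auto simp: equiv3_def)
  then show "dB a \<in> B" "dB b \<in> B" by (auto intro: dB)
  fix X assume X: "X \<in> B"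
  have "I 3 (dB X \<circ> a) = I 3 (dB X \<circ> b)" by (rule equiv3_I[OF assms dB(1)[OF X]])
  then show "I 3 (X \<circ> dB a) = I 3 (X \<circ> dB b)"
    unfolding I_parts[OF X mem(1)] I_parts[OF X mem(2)] by simp
qed

text \<open>The operators \<open>a\<close> and \<open>[D, a]\<close>, for \<open>a\<close> in the algebra of the spectral triple.\<close>

definition dirac_pair :: "('h \<Rightarrow> 'h) \<Rightarrow> ('h \<Rightarrow> 'h) \<Rightarrow> bool" where
  "dirac_pair a da \<longleftrightarrow> a \<in> B \<and> da \<in> B \<and> trace_class (commutator F a)
    \<and> (\<forall>e\<in>E. \<forall>f\<in>E. cinner e (da f) = of_real (lam e - lam f) * cinner e (a f))"

lemma dirac_pairD: "dirac_pair a da \<Longrightarrow> a \<in> B" "dirac_pair a da \<Longrightarrow> da \<in> B"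
  by (simp_all add: dirac_pair_def)

lemma commutator_F_B: assumes "a \<in> B" shows "commutator F a \<in> B"
proof -
  have "commutator F a = (\<lambda>x. (F \<circ> a) x - (a \<circ> F) x)"
    by (simp add: fun_eq_iff commutator_def)
  then show ?thesis
    by (simp only: B_minus B_comp F_B assms)
qed

text \<open>Unordered summation of complex numbers is absolute, so the convergent trace in the
  eigenbasis already makes the diagonal absolutely summable.\<close>

lemma commutator_F_l1:
  assumes a: "dirac_pair a da" and X: "X \<in> B"
  shows "(\<lambda>e. cmod (dg (X \<circ> commutator F a) e)) summable_on E"
    and "(\<Sum>\<^sub>\<infinity>e\<in>E. dg (X \<circ> commutator F a) e) = op_trace (X \<circ> commutator F a)"
proof -
  have h: "(dg (X \<circ> commutator F a) has_sum op_trace (X \<circ> commutator F a)) E"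
    using trace_class_has_sum[OF _ B_bounded[OF X] onb] a by (simp add: dirac_pair_def)
  then show "(\<Sum>\<^sub>\<infinity>e\<in>E. dg (X \<circ> commutator F a) e) = op_trace (X \<circ> commutator F a)"
    by (rule infsumI)
  show "(\<lambda>e. cmod (dg (X \<circ> commutator F a) e)) summable_on E"
    by (rule summable_on_iff_abs_summable_on_complex[THEN iffD1, OF has_sum_imp_summable[OF h]])
qed

lemma I_commutator_F:
  assumes "dirac_pair a da" "X \<in> B"
  shows "I k (X \<circ> commutator F a) = 0"
  by (rule I_l1[OF B_comp[OF assms(2) commutator_F_B[OF dirac_pairD(1)[OF assms(1)]]] commutator_F_l1(1)[OF assms]])

lemma F_commutes:
  assumes "dirac_pair a da"
  shows "F \<circ> a \<simeq> a \<circ> F"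
  unfolding equiv3_def
proof (intro conjI ballI)
  note a = dirac_pairD(1)[OF assms]
  show "F \<circ> a \<in> B" "a \<circ> F \<in> B" by (auto intro: B_comp F_B a)
  fix X assume X: "X \<in> B"
  have "I 3 (\<lambda>x. (X \<circ> (F \<circ> a)) x - (X \<circ> (a \<circ> F)) x) = I 3 (X \<circ> (F \<circ> a)) - I 3 (X \<circ> (a \<circ> F))"
    by (intro I_minus B_comp X F_B a)
  moreover have "(\<lambda>x. (X \<circ> (F \<circ> a)) x - (X \<circ> (a \<circ> F)) x) = X \<circ> commutator F a"
    by (simp add: fun_eq_iff commutator_def bounded_clinear_diff[OF B_bounded[OF X]])
  ultimately show "I 3 (X \<circ> (F \<circ> a)) = I 3 (X \<circ> (a \<circ> F))"
    using I_commutator_F[OF assms X] by simp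
qed

lemma F_commutes_dB: "b \<in> B \<Longrightarrow> F \<circ> b \<simeq> b \<circ> F \<Longrightarrow> F \<circ> dB b \<simeq> dB b \<circ> F"
  using equiv3_dB[of "F \<circ> b" "b \<circ> F"] by (simp add: dB_F_comp dB_comp_F)

lemma F_commutes_dB_pow:
  assumes "dirac_pair a da"
  shows "F \<circ> (dB ^^ k) a \<simeq> (dB ^^ k) a \<circ> F"
  using assms by (induction k) (auto simp: F_commutes F_commutes_dB dB_pow dirac_pairD)

definition alpha :: "('h \<Rightarrow> 'h) \<Rightarrow> ('h \<Rightarrow> 'h) \<Rightarrow> 'h \<Rightarrow> 'h" where
  "alpha a da = (\<lambda>x. da x - (F \<circ> dB a) x)"

lemma alpha_B: "dirac_pair a da \<Longrightarrow> alpha a da \<in> B"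
  unfolding alpha_def by (intro B_minus B_comp F_B dB) (auto simp: dirac_pair_def)

text \<open>Stated on basis vectors, where the unbounded factor \<open>|D|\<close> is a number. It
  rests on \<open>lam e - lam f - eps e * (p e - p f) = (eps e - eps f) * p f\<close>.\<close>

lemma alpha_basis:
  assumes a: "dirac_pair a da" and f: "f \<in> E"
  shows "alpha a da f = of_real (p f) *\<^sub>C commutator F a f"
proof (rule onb_eqI[OF onb])
  fix e assume e: "e \<in> E"
  have "cinner e (alpha a da f) = of_real (lam e - lam f) * cinner e (a f) - of_real (eps e) * (of_real (p e - p f) * cinner e (a f))"
    using a e f by (simp only: alpha_def comp_def cinner_diff_right cinner_F[OF e]
        derD[OF dB(2)[OF dirac_pairD(1)[OF a]] e f]) (simp add: dirac_pair_def)
  also have "\<dots> = of_real (p f) * (of_real (eps e) * cinner e (a f) - of_real (eps f) * cinner e (a f))"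
    by (simp add: lam_p[OF e] lam_p[OF f] algebra_simps)
  also have "\<dots> = cinner e (of_real (p f) *\<^sub>C commutator F a f)"
    using bounded_clinear_scaleR[OF B_bounded[OF dirac_pairD(1)[OF a]]]
    by (simp add: commutator_def cinner_simps cinner_F[OF e] F_eig[OF f])
  finally show "cinner e (alpha a da f) = cinner e (of_real (p f) *\<^sub>C commutator F a f)" .
qed

text \<open>The factor \<open>|D|\<close> shifts the argument by 1, up to an entire kernel term: a
  residue at \<open>k + 1\<close> is one at \<open>k\<close> of a word with \<open>[F, a]\<close>.
  For the residue at 1 this leads to the point 0, where \<open>0 \<notin> \<Sigma>\<close>
  enters.\<close>

lemma I_alpha:
  assumes a: "dirac_pair a da" and X: "X \<in> B"
  shows "I (Suc k) (X \<circ> alpha a da) = 0"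
proof -
  define b where "b = X \<circ> commutator F a"
  have b: "b \<in> B" unfolding b_def by (intro B_comp X commutator_F_B dirac_pairD(1)[OF a])
  have Xa: "X \<circ> alpha a da \<in> B" by (intro B_comp X alpha_B[OF a])
  define K where "K = (\<Sum>e\<in>{e\<in>E. lam e = 0}. dg b e)"
  define f where "f z = ext b (z + (- 1)) - K * of_real c powr (- (z + (- 1)))" for z
  have dgX: "dg (X \<circ> alpha a da) e = dg b e * of_real (p e) ^ 1" if "e \<in> E" for e
    using alpha_basis[OF a that] by (simp add: b_def bounded_clinear_scaleC[OF B_bounded[OF X]] cinner_simps)
  show ?thesis
  proof (rule I_eqI[OF Xa])
    show "mero_cont (Z (dg (X \<circ> alpha a da))) f"
    proof (rule mero_cont_cong[where R = "real s + 1"])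
      show "mero_cont (\<lambda>z. Z (dg b) (z + (- 1)) - K * of_real c powr (- (z + (- 1)))) f"
        unfolding f_def using c
        by (intro mero_cont_cmult mero_cont_minus mero_cont_shift ext_cont b mero_cont_entire
            holomorphic_on_const_powr holomorphic_intros)
      fix z assume z: "Re z > real s + 1"
      have "((\<lambda>e. dg b e * of_real (p e) ^ 1 * of_real (m e) powr (- ((z + (- 1)) + of_nat 1))) has_sum
          (Z (dg b) (z + (- 1)) - K * of_real c powr (- (z + (- 1))))) E"
        unfolding K_def by (rule Z_p_power[OF dg_bound[OF B_bounded[OF b]]]) (use z in auto)
      from infsumI[OF this]
      show "Z (dg b) (z + (- 1)) - K * of_real c powr (- (z + (- 1))) = Z (dg (X \<circ> alpha a da)) z"
        unfolding Z_def using dgX by (simp cong: infsum_cong)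
    qed
    have sh: "filterlim (\<lambda>z. z + (- 1) :: complex) (at (of_nat k)) (at (of_nat (Suc k)))"
      by (intro filterlim_atI tendsto_eq_intros refl) (auto simp: eventually_at_filter algebra_simps)
    have "((\<lambda>z. (z + (- 1) - of_nat k) * ext b (z + (- 1))) \<longlongrightarrow> I k b) (at (of_nat (Suc k)))"
      by (rule filterlim_compose[OF I_tendsto[OF b] sh])
    moreover have "I k b = 0" unfolding b_def by (rule I_commutator_F[OF a X])
    moreover have "((\<lambda>z. K * complex_of_real c powr (- (z + (- 1)))) \<longlongrightarrow> K * of_real c powr (- (of_nat (Suc k) + (- 1)))) (at (of_nat (Suc k)))"
      using c by (intro tendsto_intros) auto
    from simple_zero_tendsto[OF this]
    have "((\<lambda>z. (z - of_nat (Suc k)) * (K * complex_of_real c powr (- (z + (- 1))))) \<longlongrightarrow> 0) (at (of_nat (Suc k)))" .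
    ultimately have "((\<lambda>z. (z + (- 1) - of_nat k) * ext b (z + (- 1)) - (z - of_nat (Suc k)) * (K * complex_of_real c powr (- (z + (- 1))))) \<longlongrightarrow> 0 - 0) (at (of_nat (Suc k)))"
      by (intro tendsto_diff) auto
    then show "((\<lambda>z. (z - of_nat (Suc k)) * f z) \<longlongrightarrow> 0) (at (of_nat (Suc k)))"
      by (simp add: f_def algebra_simps)
  qed
qed

lemma dirac_equiv:
  assumes a: "dirac_pair a da"
  shows "da \<simeq> F \<circ> dB a"
  unfolding equiv3_def
proof (intro conjI ballI)
  show "da \<in> B" "F \<circ> dB a \<in> B" using a by (auto intro!: B_comp F_B dB simp: dirac_pair_def)
  fix X assume X: "X \<in> B"
  have "I 3 (\<lambda>x. (X \<circ> da) x - (X \<circ> (F \<circ> dB a)) x) = I 3 (X \<circ> da) - I 3 (X \<circ> (F \<circ> dB a))"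
    by (intro I_minus B_comp X F_B dB) (use a in \<open>simp_all add: dirac_pair_def\<close>)
  moreover have "(\<lambda>x. (X \<circ> da) x - (X \<circ> (F \<circ> dB a)) x) = X \<circ> alpha a da"
    by (simp add: fun_eq_iff alpha_def bounded_clinear_diff[OF B_bounded[OF X]])
  ultimately show "I 3 (X \<circ> da) = I 3 (X \<circ> (F \<circ> dB a))"
    using I_alpha[OF a X, of 2] by (simp add: numeral_3_eq_3)
qed

text \<open>Valid also at 1 and 2, where no trace property is at hand: the derivatives are moved to
  \<open>X\<close> by parts, \<open>da\<close> is replaced at the end of the word, and the
  derivatives are moved back past \<open>F\<close>, whose derivative is 0.\<close>

lemma dB_pow_da:
  assumes a: "dirac_pair a da" and X: "X \<in> B"
  shows "I (Suc k) (X \<circ> (dB ^^ j) da) = I (Suc k) (X \<circ> F \<circ> (dB ^^ Suc j) a)"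
  using X
proof (induction j arbitrary: X)
  case 0
  have m: "I (Suc k) (\<lambda>x. (X \<circ> da) x - (X \<circ> F \<circ> dB a) x) = I (Suc k) (X \<circ> da) - I (Suc k) (X \<circ> F \<circ> dB a)"
    by (intro I_minus B_comp 0 F_B dB) (use a in \<open>simp_all add: dirac_pair_def\<close>)
  have f: "(\<lambda>x. (X \<circ> da) x - (X \<circ> F \<circ> dB a) x) = X \<circ> alpha a da"
    by (simp add: fun_eq_iff alpha_def bounded_clinear_diff[OF B_bounded[OF 0]])
  from m have "I (Suc k) (X \<circ> da) = I (Suc k) (X \<circ> F \<circ> dB a)"
    unfolding f I_alpha[OF a 0] by (simp only: eq_iff_diff_eq_0[of "I (Suc k) (X \<circ> da)"])
  moreover have "(dB ^^ 0) da = da" "(dB ^^ Suc 0) a = dB a" by simp_all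
  ultimately show ?case by (simp only:)
next
  case (Suc j)
  have mem: "(dB ^^ j) da \<in> B" "(dB ^^ Suc j) a \<in> B" using a by (auto intro!: dB_pow dB simp: dirac_pair_def)
  have "I (Suc k) (X \<circ> (dB ^^ Suc j) da) = - I (Suc k) (dB X \<circ> (dB ^^ j) da)"
  proof -
    have "(dB ^^ Suc j) da = dB ((dB ^^ j) da)" by simp
    then show ?thesis by (simp only: I_parts[OF Suc.prems mem(1)] minus_minus)
  qed
  also have "\<dots> = - I (Suc k) (dB X \<circ> F \<circ> (dB ^^ Suc j) a)" by (simp only: Suc.IH[OF dB(1)[OF Suc.prems]])
  also have "\<dots> = - I (Suc k) (dB (X \<circ> F) \<circ> (dB ^^ Suc j) a)" by (simp only: dB_comp_F[OF Suc.prems])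
  also have "\<dots> = I (Suc k) (X \<circ> F \<circ> dB ((dB ^^ Suc j) a))"
    by (simp only: I_parts[OF B_comp[OF Suc.prems F_B] mem(2)] minus_minus)
  also have "dB ((dB ^^ Suc j) a) = (dB ^^ Suc (Suc j)) a" by simp
  finally show ?case .
qed

end

context dirac_algebra
begin

section \<open>Evaluation of the local cocycle and of the coboundaries\<close>

lemma absD_powr_absD_powr:
  assumes "Re z \<ge> 0"
  shows "absD_powr W D c (- of_nat n) (absD_powr W D c (- z) x)
    = diag_op (\<lambda>e. of_real (p e) ^ 0 * of_real (m e) powr (- (z + of_nat n))) x"
proof -
  have "absD_powr W D c (- of_nat n) (absD_powr W D c (- z) x) = absD_powr W D c (- of_nat n + - z) x"
    by (rule absD_powr_add) (use assms in auto)
  also have "- of_nat n + - z = - (z + of_nat n)" by simp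
  also have "absD_powr W D c (- (z + of_nat n)) x = diag_op (\<lambda>e. of_real (m e) powr (- (z + of_nat n))) x"
    by (rule absD_powr_diag) (use assms in auto)
  finally show ?thesis by simp
qed

lemma scaleC_2: "2 *\<^sub>C x = x + (x::'h)"
  using scaleC_add_left[of 1 1 x] by (simp add: scaleC_one)

lemma scaleC_4: "4 *\<^sub>C x = x + x + x + (x::'h)"
  using scaleC_add_left[of 2 2 x] by (simp add: scaleC_2 add.assoc)

lemma ncint_nabla:
  assumes a: "a \<in> B" and T: "T \<in> B"
  shows "ncint W D c (a \<circ> nabla D T \<circ> absD_powr W D c (- 3)) = 2 * I 2 (a \<circ> dB T) + I 3 (a \<circ> dB (dB T))"
proof -
  define b where "b j = (if j = 0 then a \<circ> dB (dB T) else a \<circ> dB T)" for j :: nat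
  define \<kappa> where "\<kappa> j = (if j = 0 then 1 else 2 :: complex)" for j :: nat
  note T' = dB[OF T] note T'' = dB[OF T'(1)]
  have "ncint W D c ((a \<circ> nabla D T) \<circ> absD_powr W D c (- of_nat 3)) = (\<Sum>j\<le>1. \<kappa> j * I (3 - j) (b j))"
  proof (rule ncint_lincomb)
    show "b j \<in> B" for j using a T' T'' by (auto simp: b_def intro: B_comp)
    fix z x assume z: "Re z \<ge> (0::real)"
    define g where "g e = complex_of_real (m e) powr (- (z + of_nat 3))" for e
    define u where "u j = diag_op (\<lambda>e. of_real (p e) ^ j * g e) x" for j
    note bd = p_powr_bound[where n = 3, OF _ _ z, folded g_def]
    have "nabla D T (u 0) = (dB T (u 1) + dB T (u 1)) + dB (dB T) (u 0)"
      unfolding u_def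
      by (rule nabla_diag_op[OF T'(2) T''(2)]) (use bd[of 0] bd[of 1] bd[of 2] in simp_all)
    then have "a (nabla D T (u 0)) = (\<Sum>j\<le>1. \<kappa> j *\<^sub>C b j (u j))"
      by (simp add: bounded_clinear_add[OF B_bounded[OF a]] b_def \<kappa>_def scaleC_one scaleC_2)
    then show "(a \<circ> nabla D T) (absD_powr W D c (- of_nat 3) (absD_powr W D c (- z) x))
      = (\<Sum>j\<le>1. \<kappa> j *\<^sub>C b j (diag_op (\<lambda>e. of_real (p e) ^ j * of_real (m e) powr (- (z + of_nat 3))) x))"
      by (simp only: comp_apply absD_powr_absD_powr[OF z] u_def g_def)
  qed simp
  then show ?thesis by (simp add: b_def \<kappa>_def)
qed

lemma ncint_nabla_nabla:
  assumes a: "a \<in> B" and T: "T \<in> B"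
  shows "ncint W D c (a \<circ> nabla D (nabla D T) \<circ> absD_powr W D c (- 5)) = 4 * I 3 (a \<circ> dB (dB T))"
proof -
  define b where "b j = (if j = 0 then a \<circ> dB (dB (dB (dB T))) else if j = 1 then a \<circ> dB (dB (dB T)) else a \<circ> dB (dB T))" for j :: nat
  define \<kappa> where "\<kappa> j = (if j = 0 then 1 else 4 :: complex)" for j :: nat
  note T1 = dB[OF T] note T2 = dB[OF T1(1)] note T3 = dB[OF T2(1)] note T4 = dB[OF T3(1)]
  have bB: "b j \<in> B" for j using a T2 T3 T4 by (auto simp: b_def intro: B_comp)
  have "ncint W D c ((a \<circ> nabla D (nabla D T)) \<circ> absD_powr W D c (- of_nat 5)) = (\<Sum>j\<le>2. \<kappa> j * I (5 - j) (b j))"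
  proof (rule ncint_lincomb)
    fix z x assume z: "Re z \<ge> (0::real)"
    define g where "g e = complex_of_real (m e) powr (- (z + of_nat 5))" for e
    define u where "u j = diag_op (\<lambda>e. of_real (p e) ^ j * g e) x" for j
    have "nabla D (nabla D T) (u 0) =
      (dB (dB T) (u 2) + dB (dB T) (u 2) + dB (dB T) (u 2) + dB (dB T) (u 2))
      + (dB (dB (dB T)) (u 1) + dB (dB (dB T)) (u 1) + dB (dB (dB T)) (u 1) + dB (dB (dB T)) (u 1))
      + dB (dB (dB (dB T))) (u 0)"
      unfolding u_def
    proof (rule nabla_nabla_diag_op[OF T1(2) T2(2) T3(2) T4(2)])
      show "cmod (of_real (p e) ^ j * g e) \<le> m0 powr (- (Re z + real 5))" if "e \<in> E" "j \<le> 4" for e j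
        unfolding g_def using that z by (intro p_powr_bound) auto
    qed
    then have "a (nabla D (nabla D T) (u 0)) = (\<Sum>j\<le>2. \<kappa> j *\<^sub>C b j (u j))"
      by (simp add: bounded_clinear_add[OF B_bounded[OF a]] b_def \<kappa>_def scaleC_one scaleC_4 numeral_2_eq_2 algebra_simps)
    then show "(a \<circ> nabla D (nabla D T)) (absD_powr W D c (- of_nat 5) (absD_powr W D c (- z) x))
      = (\<Sum>j\<le>2. \<kappa> j *\<^sub>C b j (diag_op (\<lambda>e. of_real (p e) ^ j * of_real (m e) powr (- (z + of_nat 5))) x))"
      by (simp only: comp_apply absD_powr_absD_powr[OF z] u_def g_def)
  qed (use bB in auto)
  also have "\<dots> = \<kappa> 0 * I 5 (b 0) + \<kappa> 1 * I 4 (b 1) + \<kappa> 2 * I 3 (b 2)"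
    by (simp add: numeral_2_eq_2)
  \<comment> \<open>The residues at 5 and 4 vanish by the bound on the dimension spectrum.\<close>
  also have "\<dots> = 4 * I 3 (a \<circ> dB (dB T))"
    using I_high[OF bB, of 5 0] I_high[OF bB, of 4 1] by (simp add: \<kappa>_def) (simp add: b_def)
  finally show ?thesis by simp
qed

lemma local_character_1:
  assumes a: "dirac_pair a da" and X: "X \<in> B"
  shows "ncint W D c (X \<circ> da \<circ> absD_powr W D c (- 1))
      - 1/4 * ncint W D c (X \<circ> nabla D da \<circ> absD_powr W D c (- 3))
      + 1/8 * ncint W D c (X \<circ> nabla D (nabla D da) \<circ> absD_powr W D c (- 5))
    = I 1 (X \<circ> F \<circ> dB a) - 1/2 * I 2 (X \<circ> F \<circ> dB (dB a)) + 1/4 * I 3 (X \<circ> F \<circ> dB (dB (dB a)))"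
proof -
  note da = dirac_pairD(2)[OF a]
  have "ncint W D c (X \<circ> da \<circ> absD_powr W D c (- 1)) = I 1 (X \<circ> da)"
    using ncint_I[OF B_comp[OF X da], of 1] by simp
  moreover have "I 1 (X \<circ> da) = I 1 (X \<circ> F \<circ> dB a)"
    using dB_pow_da[OF a X, of 0 0] by simp
  moreover have "I 2 (X \<circ> dB da) = I 2 (X \<circ> F \<circ> dB (dB a))"
    using dB_pow_da[OF a X, of 1 1] by (simp add: numeral_2_eq_2)
  moreover have "I 3 (X \<circ> dB (dB da)) = I 3 (X \<circ> F \<circ> dB (dB (dB a)))"
    using dB_pow_da[OF a X, of 2 2] by (simp add: numeral_3_eq_3 numeral_2_eq_2)
  ultimately show ?thesis
    by (simp add: ncint_nabla[OF X da] ncint_nabla_nabla[OF X da] field_simps)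
qed

lemma zeta_value0_ext: "b \<in> B \<Longrightarrow> zeta_value0 W D c b = ext b 0"
  unfolding zeta_value0_def by (rule value_mero_ext[OF ext_cont(1) ext_tendsto[OF _ zero_notin]])

text \<open>On the diagonal \<open>F X a\<close> may be replaced by
  \<open>X a F = X F a - X [F, a]\<close>, whose last term has a trace, and \<open>F a X\<close> by
  \<open>a (X F)\<close>, to which the expansion applies. The values for \<open>X F a\<close>
  cancel.\<close>

lemma coboundary_phi0:
  assumes a: "dirac_pair a da" and X: "X \<in> B"
  shows "zeta_value0 W D c (F \<circ> (X \<circ> a)) - zeta_value0 W D c (F \<circ> (a \<circ> X))
    = - op_trace (X \<circ> commutator F a)
      + I 1 (X \<circ> F \<circ> dB a) - 1/2 * I 2 (X \<circ> F \<circ> dB (dB a)) + 1/3 * I 3 (X \<circ> F \<circ> dB (dB (dB a)))"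
proof -
  note aB = dirac_pairD(1)[OF a]
  have Xt: "X \<circ> commutator F a \<in> B" by (intro B_comp X commutator_F_B aB)
  have dgF: "dg (F \<circ> b) e = of_real (eps e) * dg b e" "dg (b \<circ> F) e = of_real (eps e) * dg b e" if "b \<in> B" "e \<in> E" for b e
    using bounded_clinear_scaleR[OF B_bounded[OF that(1)]] that(2)
    by (simp_all add: cinner_F F_eig cinner_scaleR_right)
  have "ext (F \<circ> (X \<circ> a)) 0 = 1 * ext (X \<circ> F \<circ> a) 0 + (- 1) * ext (X \<circ> commutator F a) 0"
  proof (rule ext_0_lincomb)
    fix e assume e: "e \<in> E"
    have "dg (F \<circ> (X \<circ> a)) e = dg (X \<circ> a \<circ> F) e" using dgF[OF B_comp[OF X aB] e] by simp
    also have "\<dots> = 1 * dg (X \<circ> F \<circ> a) e + (- 1) * dg (X \<circ> commutator F a) e"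
      by (simp add: commutator_def bounded_clinear_diff[OF B_bounded[OF X]] cinner_diff_right)
    finally show "dg (F \<circ> (X \<circ> a)) e = 1 * dg (X \<circ> F \<circ> a) e + (- 1) * dg (X \<circ> commutator F a) e" .
  qed (intro B_comp F_B X aB Xt)+
  moreover have "ext (X \<circ> commutator F a) 0 = op_trace (X \<circ> commutator F a)"
    by (rule trans[OF ext_0_l1[OF Xt commutator_F_l1(1)[OF a X]] commutator_F_l1(2)[OF a X]])
  moreover have "ext (F \<circ> (a \<circ> X)) 0 = ext (a \<circ> (X \<circ> F)) 0"
  proof -
    have "ext (F \<circ> (a \<circ> X)) 0 = 1 * ext (a \<circ> (X \<circ> F)) 0 + 0 * ext (a \<circ> (X \<circ> F)) 0"
    proof (rule ext_0_lincomb)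
      fix e assume e: "e \<in> E"
      show "dg (F \<circ> (a \<circ> X)) e = 1 * dg (a \<circ> (X \<circ> F)) e + 0 * dg (a \<circ> (X \<circ> F)) e"
        using dgF[OF B_comp[OF aB X] e] by simp
    qed (intro B_comp F_B X aB)+
    then show ?thesis by simp
  qed
  moreover have "ext (a \<circ> (X \<circ> F)) 0 = ext ((X \<circ> F) \<circ> a) 0
      - I 1 ((X \<circ> F) \<circ> dB a) + 1/2 * I 2 ((X \<circ> F) \<circ> dB (dB a)) - 1/3 * I 3 ((X \<circ> F) \<circ> dB (dB (dB a)))"
    by (rule ext_0_expansion[OF aB B_comp[OF X F_B]])
  moreover have "F \<circ> (X \<circ> a) \<in> B" "F \<circ> (a \<circ> X) \<in> B" by (intro B_comp F_B X aB)+
  ultimately show ?thesis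
    by (simp only: zeta_value0_ext) simp
qed

lemma I_parts_F:
  assumes "a \<in> B" "b \<in> B"
  shows "I k (dB a \<circ> b \<circ> F) = - I k (a \<circ> dB b \<circ> F)"
  using I_parts[OF assms(1) B_comp[OF assms(2) F_B], of k] by (simp only: dB_comp_F[OF assms(2)] comp_assoc)

text \<open>These are the two terms of \<open>B \<phi>\<^sub>2\<close>. One is integrated by parts
  directly, the other is first rotated by the trace property; their signs come out opposite, so they
  add up in the antisymmetric sum.\<close>

lemma boundary_phi2:
  assumes a: "dirac_pair a da" and a': "dirac_pair a' da'"
  shows "I 3 (dB a \<circ> dB (dB a') \<circ> F) = - I 3 (a \<circ> F \<circ> dB (dB (dB a')))"
    and "I 3 (dB a' \<circ> dB (dB a) \<circ> F) = I 3 (a \<circ> F \<circ> dB (dB (dB a')))"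
proof -
  note aB = dirac_pairD(1)[OF a] note aB' = dirac_pairD(1)[OF a']
  have "F \<circ> dB (dB (dB a')) \<simeq> dB (dB (dB a')) \<circ> F"
    using F_commutes_dB_pow[OF a', of 3] by (simp add: numeral_3_eq_3)
  from equiv3_I[OF this aB]
  show 1: "I 3 (dB a \<circ> dB (dB a') \<circ> F) = - I 3 (a \<circ> F \<circ> dB (dB (dB a')))"
    using I_parts_F[OF aB dB(1)[OF dB(1)[OF aB']], of 3] by (simp only: comp_assoc)
  have c: "F \<circ> dB a' \<simeq> dB a' \<circ> F"
    using F_commutes_dB_pow[OF a', of 1] by simp
  have "I 3 (dB a' \<circ> dB (dB a) \<circ> F) = I 3 (dB a' \<circ> (dB (dB a) \<circ> F))" by (simp only: comp_assoc)
  also have "\<dots> = I 3 ((dB (dB a) \<circ> F) \<circ> dB a')"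
    by (intro I_trace B_comp F_B dB aB aB')
  also have "\<dots> = I 3 (dB (dB a) \<circ> (F \<circ> dB a'))" by (simp only: comp_assoc)
  also have "\<dots> = I 3 (dB (dB a) \<circ> (dB a' \<circ> F))"
    by (rule equiv3_I[OF c]) (intro dB aB)
  also have "\<dots> = - I 3 (dB a \<circ> dB (dB a') \<circ> F)"
    using I_parts_F[of "dB a" "dB a'" 3] dB(1) aB aB' by (simp only: comp_assoc)
  finally show "I 3 (dB a' \<circ> dB (dB a) \<circ> F) = I 3 (a \<circ> F \<circ> dB (dB (dB a')))"
    using 1 by simp
qed

lemma local_character_3:
  assumes X: "X \<in> B" and a1: "dirac_pair a1 da1" and a2: "dirac_pair a2 da2" and a3: "dirac_pair a3 da3"
  shows "I 3 (X \<circ> da1 \<circ> da2 \<circ> da3) = I 3 (X \<circ> dB a1 \<circ> dB a2 \<circ> dB a3 \<circ> F)"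
proof -
  note mem = dB(1)[OF dirac_pairD(1)[OF a1]] dB(1)[OF dirac_pairD(1)[OF a2]] dB(1)[OF dirac_pairD(1)[OF a3]]
  have com: "F \<circ> dB a \<simeq> dB a \<circ> F" if "dirac_pair a da" for a da
    using F_commutes_dB_pow[OF that, of 1] by simp
  have FF': "F \<circ> (F \<circ> b) = b" for b by (simp add: fun_eq_iff FF)
  have "da1 \<circ> (da2 \<circ> da3) \<simeq> (F \<circ> dB a1) \<circ> ((F \<circ> dB a2) \<circ> (F \<circ> dB a3))"
    by (intro equiv3_comp dirac_equiv a1 a2 a3)
  \<comment> \<open>The commutations are arranged so that two of the three factors \<open>F\<close>
    become adjacent and cancel, while the third ends on the right.\<close>
  also have "(F \<circ> dB a1) \<circ> ((F \<circ> dB a2) \<circ> (F \<circ> dB a3)) \<simeq> (dB a1 \<circ> F) \<circ> ((F \<circ> dB a2) \<circ> (dB a3 \<circ> F))"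
    by (intro equiv3_comp com[OF a1] com[OF a3] equiv3_refl B_comp F_B mem)
  finally (equiv3_trans) have "da1 \<circ> (da2 \<circ> da3) \<simeq> dB a1 \<circ> (dB a2 \<circ> (dB a3 \<circ> F))"
    by (simp only: comp_assoc FF')
  from equiv3_I[OF this X] show ?thesis by (simp only: comp_assoc)
qed

text \<open>By the Leibniz rule everything cancels in pairs except the mixed term
  \<open>dB a2 \<circ> dB a3\<close> of the second derivative of \<open>a2 \<circ> a3\<close>, which
  occurs twice. This factor 2 takes 1/24 to 1/12.\<close>

lemma coboundary_phi2:
  assumes X: "X \<in> B" and a1: "dirac_pair a1 da1" and a2: "dirac_pair a2 da2" and a3: "dirac_pair a3 da3"
  shows "I 3 ((X \<circ> a1) \<circ> dB a2 \<circ> dB (dB a3) \<circ> F) - I 3 (X \<circ> dB (a1 \<circ> a2) \<circ> dB (dB a3) \<circ> F)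
      + I 3 (X \<circ> dB a1 \<circ> dB (dB (a2 \<circ> a3)) \<circ> F) - I 3 ((a3 \<circ> X) \<circ> dB a1 \<circ> dB (dB a2) \<circ> F)
    = 2 * I 3 (X \<circ> dB a1 \<circ> dB a2 \<circ> dB a3 \<circ> F)"
proof -
  note aB = dirac_pairD(1)[OF a1] dirac_pairD(1)[OF a2] dirac_pairD(1)[OF a3]
  note d1 = dB(1)[OF aB(1)] dB(1)[OF aB(2)] dB(1)[OF aB(3)]
  note d2 = dB(1)[OF d1(1)] dB(1)[OF d1(2)] dB(1)[OF d1(3)]
  define P where "P = X \<circ> a1 \<circ> dB a2 \<circ> dB (dB a3) \<circ> F"
  define Q where "Q = X \<circ> dB a1 \<circ> a2 \<circ> dB (dB a3) \<circ> F"
  define R where "R = X \<circ> dB a1 \<circ> dB a2 \<circ> dB a3 \<circ> F"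
  define S where "S = X \<circ> dB a1 \<circ> dB (dB a2) \<circ> a3 \<circ> F"
  have mem: "P \<in> B" "Q \<in> B" "R \<in> B" "S \<in> B"
    unfolding P_def Q_def R_def S_def by (intro B_comp X F_B aB d1 d2)+
  have "X \<circ> dB (a1 \<circ> a2) \<circ> dB (dB a3) \<circ> F = (\<lambda>x. Q x + P x)"
    by (simp add: fun_eq_iff dB_comp[OF aB(1,2)] P_def Q_def bounded_clinear_add[OF B_bounded[OF X]])
  then have 1: "I 3 (X \<circ> dB (a1 \<circ> a2) \<circ> dB (dB a3) \<circ> F) = I 3 Q + I 3 P"
    by (simp only: I_add[OF mem(2,1)])
  have dd: "dB (dB (a2 \<circ> a3)) = (\<lambda>x. (dB (dB a2) (a3 x) + dB a2 (dB a3 x)) + (dB a2 (dB a3 x) + a2 (dB (dB a3) x)))"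
  proof (rule dB_eqI[OF dB(1)[OF B_comp[OF aB(2,3)]]])
    show "der (dB (a2 \<circ> a3)) (\<lambda>x. (dB (dB a2) (a3 x) + dB a2 (dB a3 x)) + (dB a2 (dB a3 x) + a2 (dB (dB a3) x)))"
      unfolding dB_comp[OF aB(2,3)] by (intro der_add der_comp dB(2) aB d1)
  qed
  have XX: "bounded_clinear (\<lambda>x. X (dB a1 x))"
    by (rule bounded_clinear_compose[OF B_bounded[OF X] B_bounded[OF d1(1)]])
  have "X \<circ> dB a1 \<circ> dB (dB (a2 \<circ> a3)) \<circ> F = (\<lambda>x. (S x + R x) + (R x + Q x))"
    by (simp add: fun_eq_iff dd P_def Q_def R_def S_def bounded_clinear_add[OF XX])
  then have 2: "I 3 (X \<circ> dB a1 \<circ> dB (dB (a2 \<circ> a3)) \<circ> F) = (I 3 S + I 3 R) + (I 3 R + I 3 Q)"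
    by (simp only: I_add B_add mem)
  have "I 3 ((a3 \<circ> X) \<circ> dB a1 \<circ> dB (dB a2) \<circ> F) = I 3 (a3 \<circ> (X \<circ> dB a1 \<circ> dB (dB a2) \<circ> F))"
    by (simp only: comp_assoc)
  also have "\<dots> = I 3 ((X \<circ> dB a1 \<circ> dB (dB a2) \<circ> F) \<circ> a3)"
    by (intro I_trace B_comp X F_B aB d1 d2)
  also have "\<dots> = I 3 ((X \<circ> dB a1 \<circ> dB (dB a2)) \<circ> (F \<circ> a3))" by (simp only: comp_assoc)
  also have "\<dots> = I 3 ((X \<circ> dB a1 \<circ> dB (dB a2)) \<circ> (a3 \<circ> F))"
    by (rule equiv3_I[OF F_commutes[OF a3]]) (intro B_comp X d1 d2)
  also have "\<dots> = I 3 S" by (simp only: S_def comp_assoc)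
  finally have 3: "I 3 ((a3 \<circ> X) \<circ> dB a1 \<circ> dB (dB a2) \<circ> F) = I 3 S" .
  have 0: "I 3 ((X \<circ> a1) \<circ> dB a2 \<circ> dB (dB a3) \<circ> F) = I 3 P" by (simp only: P_def)
  show ?thesis unfolding 0 1 2 3 by (simp add: R_def)
qed

end

section \<open>From the spectral triple to the abstract algebra\<close>

lemma delta_pow_bounded_comm:
  "T \<in> Dom_\<delta> W D (Suc k) \<Longrightarrow> bounded_comm (absD_dom W D) (absD W D) ((\<delta> W D ^^ k) T)"
proof (induction k arbitrary: T)
  case (Suc k)
  then have "\<delta> W D T \<in> Dom_\<delta> W D (Suc k)" by simp
  from Suc.IH[OF this] show ?case by (simp only: funpow_Suc_right comp_apply)
qed simp

lemma (in eigenbasis) alg_B_der: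
  assumes reg: "regular \<pi> W D" and b: "b \<in> alg_B \<pi> W D F"
  shows "\<exists>b'\<in>alg_B \<pi> W D F. der b b'"
  using b
proof induction
  case (1 k a)
  have "\<pi> a \<in> Dom_\<delta> W D (Suc k)" using reg unfolding regular_def by blast
  from der_delta[OF delta_pow_bounded_comm[OF this]]
  have "der ((\<delta> W D ^^ k) (\<pi> a)) ((\<delta> W D ^^ Suc k) (\<pi> a))" by simp
  then show ?case using alg_B.intros(1) by blast
next
  case (2 k a)
  have "comm_ext W D (\<pi> a) \<in> Dom_\<delta> W D (Suc k)" using reg unfolding regular_def by blast
  from der_delta[OF delta_pow_bounded_comm[OF this]]
  have "der ((\<delta> W D ^^ k) (comm_ext W D (\<pi> a))) ((\<delta> W D ^^ Suc k) (comm_ext W D (\<pi> a)))" by simp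
  then show ?case using alg_B.intros(2) by blast
next
  case 3
  have "(\<lambda>x. 0 *\<^sub>C F x) \<in> alg_B \<pi> W D F" by (intro alg_B.intros)
  then have "(\<lambda>x. 0) \<in> alg_B \<pi> W D F" by simp
  then show ?case using der_F by blast
next
  case (4 S T)
  then obtain S' T' where "S' \<in> alg_B \<pi> W D F" "der S S'" "T' \<in> alg_B \<pi> W D F" "der T T'" by blast
  then show ?case using der_add alg_B.intros(4) by blast
next
  case (5 S r)
  then obtain S' where "S' \<in> alg_B \<pi> W D F" "der S S'" by blast
  then show ?case using der_scale alg_B.intros(5) by blast
next
  case (6 S T)
  then obtain S' T' where ST: "S' \<in> alg_B \<pi> W D F" "der S S'" "T' \<in> alg_B \<pi> W D F" "der T T'" by blast
  have "(\<lambda>x. (S' \<circ> T) x + (S \<circ> T') x) \<in> alg_B \<pi> W D F"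
    using ST 6 by (intro alg_B.intros(4,6))
  moreover have "der (S \<circ> T) (\<lambda>x. (S' \<circ> T) x + (S \<circ> T') x)"
    using der_comp[OF ST(2,4)] by (simp add: comp_def)
  ultimately show ?case by blast
qed

text \<open>A finite trace at one exponent yields both facts. For the lower bound, the single term
  \<open>1 / m e ^ s\<close> is at most the whole sum, and for \<open>m e < 1\<close> the power
  \<open>m e ^ s\<close> is at most \<open>m e\<close>.\<close>

lemma (in eigenbasis) summable_from_trace_class:
  fixes s :: nat
  assumes s: "s > 0" and T: "trace_class (absD_powr W D c (- of_nat s))"
  shows "(\<lambda>e. 1 / m e ^ s) summable_on E" and "\<exists>m0>0. m0 \<le> 1 \<and> (\<forall>e\<in>E. m0 \<le> m e)"
proof -
  have "((\<lambda>e. cinner e (absD_powr W D c (- of_nat s) e)) has_sum op_trace ((\<lambda>x. x) \<circ> absD_powr W D c (- of_nat s))) E"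
    using trace_class_has_sum[OF T bounded_clinear_id onb] .
  then have "(\<lambda>e. cinner e (absD_powr W D c (- of_nat s) e)) summable_on E"
    by (rule has_sum_imp_summable)
  moreover have "cinner e (absD_powr W D c (- of_nat s) e) = of_real (1 / m e ^ s)" if e: "e \<in> E" for e
  proof -
    have "absD_powr W D c (- of_nat s) e = (of_real (m e) powr (- of_nat s)) *\<^sub>C e"
      unfolding absD_powr_def by (subst fcalc_basis[OF e]) (simp add: m_def)
    then show ?thesis
      using m_pos[of e] e on by (simp add: cinner_scaleC_right orthonormal_cinner powr_minus powr_nat divide_inverse)
  qed
  ultimately have "(\<lambda>e. complex_of_real (1 / m e ^ s)) summable_on E"
    by (simp cong: summable_on_cong)
  then have "(\<lambda>e. Re (complex_of_real (1 / m e ^ s))) summable_on E" by (rule summable_on_Re)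
  then show sm: "(\<lambda>e. 1 / m e ^ s) summable_on E" by simp
  define S where "S = (\<Sum>\<^sub>\<infinity>e\<in>E. 1 / m e ^ s)"
  have S0: "S \<ge> 0" unfolding S_def using m_pos by (intro infsum_nonneg) (auto simp: less_imp_le)
  have "1 / (S + 1) \<le> m e" if e: "e \<in> E" and m1: "m e < 1" for e
  proof -
    have "(\<Sum>f\<in>{e}. 1 / m f ^ s) \<le> S"
      unfolding S_def using m_pos e by (intro finite_sum_le_infsum sm) (auto simp: less_imp_le)
    then have "1 \<le> S * m e ^ s" using m_pos[of e] by (simp add: field_simps)
    also have "\<dots> \<le> (S + 1) * m e"
    proof (intro mult_mono)
      show "m e ^ s \<le> m e"
        using power_decreasing[of 1 s "m e"] s m1 m_pos[of e] by simp
    qed (use S0 m_pos[of e] in auto)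
    finally show ?thesis using S0 by (simp add: field_simps)
  qed
  then have "\<forall>e\<in>E. 1 / (S + 1) \<le> m e"
    using S0 by (metis divide_le_eq_1_pos le_add_same_cancel2 less_add_same_cancel2 linorder_not_less add_pos_nonneg add.commute order_trans zero_less_one)
  then show "\<exists>m0>0. m0 \<le> 1 \<and> (\<forall>e\<in>E. m0 \<le> m e)"
    using S0 by (intro exI[of _ "1 / (S + 1)"]) auto
qed

text \<open>The unit has derivative 0. This removes the terms of \<open>connes_B0\<close> in which 1
  is the last argument.\<close>

lemma (in dirac_algebra) I_zero:
  assumes "a \<in> B" and id: "(\<lambda>x. x) \<in> B"
  shows "I k (a \<circ> dB (dB (\<lambda>x. x)) \<circ> F) = 0"
proof -
  have z: "dB (\<lambda>x. x) = (\<lambda>x. 0)" by (rule dB_eqI[OF id der_id])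
  then have zB: "(\<lambda>x. 0) \<in> B" using dB(1)[OF id] by simp
  have zz: "dB (\<lambda>x. 0) = (\<lambda>x. 0)" by (rule dB_eqI[OF zB der_zero])
  have "a \<circ> dB (dB (\<lambda>x. x)) \<circ> F = (\<lambda>x. 0)"
    by (simp add: z zz fun_eq_iff bounded_clinear_zero[OF B_bounded[OF assms(1)]])
  then show ?thesis using I_lincomb[OF zB zB zB, of 0 0 k] by simp
qed

theorem proposition2:
  fixes \<pi> :: "'a::complex_star_algebra \<Rightarrow> 'h::complex_hilbert_space \<Rightarrow> 'h"
    and W :: "'h set" and D F :: "'h \<Rightarrow> 'h" and c :: real and \<Sigma> :: "complex set"
  assumes "spectral_triple \<pi> W D"
    and "regular \<pi> W D"
    and "is_sign W D F"
    and "c > 0"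
    and "discrete_simple_dimension_spectrum \<pi> W D F c \<Sigma>"
    and "0 \<notin> \<Sigma>"
    and "\<Sigma> \<subseteq> {z. Re z \<le> 3}"
    and "\<And>a. trace_class (commutator F (\<pi> a))"
  shows "(\<forall>a0 a1. \<phi>\<^sub>1 \<pi> W D c [a0, a1] =
            \<tau>\<^sub>1 \<pi> F [a0, a1] + hochschild_b (\<phi>\<^sub>0 \<pi> W D F c) [a0, a1]
            + connes_B (\<phi>\<^sub>2 \<pi> W D F c) [a0, a1])
       \<and> (\<forall>a0 a1 a2 a3. \<phi>\<^sub>3 \<pi> W D c [a0, a1, a2, a3] =
            hochschild_b (\<phi>\<^sub>2 \<pi> W D F c) [a0, a1, a2, a3])"
proof -
  interpret st: spectral_triple \<pi> W D by fact
  have rep: "\<pi> (a * b) = \<pi> a \<circ> \<pi> b" "\<pi> 1 = (\<lambda>x. x)" for a b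
    using st.representation by (auto simp: star_representation_def fun_eq_iff)
  obtain E lam eps where E: "is_onb E" "\<And>e. e \<in> E \<Longrightarrow> e \<in> W \<and> D e = lam e *\<^sub>R e"
    "\<And>e. e \<in> E \<Longrightarrow> F e = eps e *\<^sub>R e" "\<And>e. e \<in> E \<Longrightarrow> eps e * eps e = (1::real)"
    "\<And>e. e \<in> E \<Longrightarrow> lam e = eps e * \<bar>lam e\<bar>"
    using joint_eigenbasis[OF st.self_adjoint st.compact_resolvent assms(3)] by blast
  interpret eb: eigenbasis W D F c E lam eps
    by unfold_locales (use E st.self_adjoint assms(3,4) in \<open>simp_all add: is_sign_def\<close>)
  define B where "B = alg_B \<pi> W D F"
  have piB: "\<pi> a \<in> B" and dpiB: "comm_ext W D (\<pi> a) \<in> B" for a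
  proof -
    have "(\<delta> W D ^^ 0) (\<pi> a) \<in> B" "(\<delta> W D ^^ 0) (comm_ext W D (\<pi> a)) \<in> B"
      unfolding B_def by (rule alg_B.intros(1), rule alg_B.intros(2))
    then show "\<pi> a \<in> B" "comm_ext W D (\<pi> a) \<in> B" by simp_all
  qed
  note dsds = assms(5)[unfolded discrete_simple_dimension_spectrum_def, folded B_def]
  \<comment> \<open>Applied to the unit of the algebra, the hypothesis on the dimension spectrum
    provides trace class powers of \<open>|D|\<close> far to the right.\<close>
  obtain f where "zeta_extension W D c (\<pi> 1) \<Sigma> f" using dsds piB by blast
  then obtain R where R: "\<And>z. Re z > R \<Longrightarrow> trace_class (absD_powr W D c (- z))"
    unfolding zeta_extension_def rep(2) by (auto simp: comp_def)
  define s where "s = nat \<lceil>max R 2\<rceil> + 1"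
  have s: "real s > R" "s \<ge> 2" unfolding s_def by linarith+
  have tc: "trace_class (absD_powr W D c (- of_nat s))" using R[of "of_nat s"] s by simp
  have "s > 0" using s by simp
  note sm = eb.summable_from_trace_class[OF this tc]
  obtain m0 where m0: "m0 > 0" "m0 \<le> 1" "\<And>e. e \<in> E \<Longrightarrow> m0 \<le> eb.m e" using sm(2) by blast
  interpret da: dirac_algebra W D F c E lam eps s m0 B \<Sigma>
  proof unfold_locales
    fix b assume b: "b \<in> B"
    show "\<exists>b'\<in>B. eb.der b b'"
      using eb.alg_B_der[OF assms(2)] b unfolding B_def .
    show "(\<lambda>x. r *\<^sub>C b x) \<in> B" for r using b unfolding B_def by (rule alg_B.intros(5))
    obtain f where f: "zeta_extension W D c b \<Sigma> f" "\<forall>w\<in>\<Sigma>. \<exists>r. ((\<lambda>z. (z - w) * f z) \<longlongrightarrow> r) (at w)"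
      using dsds b by blast
    then show "\<exists>f. f holomorphic_on - \<Sigma> \<and> (\<exists>R. \<forall>z. Re z > R \<longrightarrow> f z = zeta W D c b z)
      \<and> (\<forall>w\<in>\<Sigma>. \<exists>r. ((\<lambda>z. (z - w) * f z) \<longlongrightarrow> r) (at w))"
      unfolding zeta_extension_def by blast
  next
    show "F \<in> B" unfolding B_def by (rule alg_B.intros(3))
    show "\<And>a b. a \<in> B \<Longrightarrow> b \<in> B \<Longrightarrow> (\<lambda>x. a x + b x) \<in> B" unfolding B_def by (rule alg_B.intros(4))
    show "\<And>a b. a \<in> B \<Longrightarrow> b \<in> B \<Longrightarrow> a \<circ> b \<in> B" unfolding B_def by (rule alg_B.intros(6))
  qed (use sm(1) m0 s assms(6,7) dsds in auto)
  have pair: "da.dirac_pair (\<pi> a) (comm_ext W D (\<pi> a))" for a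
    unfolding da.dirac_pair_def using piB dpiB assms(8) eb.cinner_comm_ext(2)[OF st.bounded_comm] by blast
  have delta: "\<delta> W D (\<pi> a) = da.dB (\<pi> a)" "\<delta> W D (da.dB (\<pi> a)) = da.dB (da.dB (\<pi> a))" for a
  proof -
    have dom: "\<pi> a \<in> Dom_\<delta> W D 2" using assms(2) unfolding regular_def by blast
    then have "bounded_comm (absD_dom W D) (absD W D) (\<pi> a)"
      and 2: "bounded_comm (absD_dom W D) (absD W D) (\<delta> W D (\<pi> a))" by (simp_all add: numeral_2_eq_2)
    from da.dB_eqI[OF piB eb.der_delta[OF this(1)]] show 1: "\<delta> W D (\<pi> a) = da.dB (\<pi> a)" by simp
    from da.dB_eqI[OF da.dB(1)[OF piB] eb.der_delta[OF 2[unfolded 1]]]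
    show "\<delta> W D (da.dB (\<pi> a)) = da.dB (da.dB (\<pi> a))" by simp
  qed
  have dBB: "da.dB (\<pi> a) \<in> B" "da.dB (da.dB (\<pi> a)) \<in> B" for a
    using da.dB(1) piB by auto
  have phi2: "\<phi>\<^sub>2 \<pi> W D F c [x, y, z] = 1/24 * da.I 3 (\<pi> x \<circ> da.dB (\<pi> y) \<circ> da.dB (da.dB (\<pi> z)) \<circ> F)" for x y z
    using da.ncint_I[of "\<pi> x \<circ> da.dB (\<pi> y) \<circ> da.dB (da.dB (\<pi> z)) \<circ> F" 3]
      da.B_comp[OF da.B_comp[OF da.B_comp[OF piB dBB(1)] dBB(2)] da.F_B]
    by (simp add: \<phi>\<^sub>2_def delta)
  have first: "\<phi>\<^sub>1 \<pi> W D c [a0, a1] = \<tau>\<^sub>1 \<pi> F [a0, a1] + hochschild_b (\<phi>\<^sub>0 \<pi> W D F c) [a0, a1]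
      + connes_B (\<phi>\<^sub>2 \<pi> W D F c) [a0, a1]" for a0 a1
  proof -
    define J where "J = da.I 3 (\<pi> a0 \<circ> F \<circ> da.dB (da.dB (da.dB (\<pi> a1))))"
    define J2 where "J2 = da.I 1 (\<pi> a0 \<circ> F \<circ> da.dB (\<pi> a1)) - 1/2 * da.I 2 (\<pi> a0 \<circ> F \<circ> da.dB (da.dB (\<pi> a1)))"
    have "\<phi>\<^sub>1 \<pi> W D c [a0, a1] = J2 + 1/4 * J"
      using da.local_character_1[OF pair[of a1] piB[of a0]] by (simp add: \<phi>\<^sub>1_def Let_def J_def J2_def)
    moreover have "hochschild_b (\<phi>\<^sub>0 \<pi> W D F c) [a0, a1] = - \<tau>\<^sub>1 \<pi> F [a0, a1] + J2 + 1/3 * J"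
      using da.coboundary_phi0[OF pair[of a1] piB[of a0]]
      by (simp add: hochschild_b_def \<phi>\<^sub>0_def \<tau>\<^sub>1_def rep J_def J2_def)
    moreover have "connes_B (\<phi>\<^sub>2 \<pi> W D F c) [a0, a1] = - 1/12 * J"
    proof -
      have z: "\<phi>\<^sub>2 \<pi> W D F c [x, y, 1] = 0" for x y
        using da.I_zero[OF da.B_comp[OF piB[of x] dBB(1)[of y]] piB[of 1, unfolded rep(2)], of 3]
        by (simp only: phi2 rep(2) mult_zero_right)
      have o: "\<phi>\<^sub>2 \<pi> W D F c [1, x, y] = 1/24 * da.I 3 (da.dB (\<pi> x) \<circ> da.dB (da.dB (\<pi> y)) \<circ> F)" for x y
        by (simp add: phi2 rep(2) comp_def)
      \<comment> \<open>The cyclic sum over two arguments is antisymmetric, and \<open>z\<close>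
        removes the parts with 1 at the end.\<close>
      have "connes_B (\<phi>\<^sub>2 \<pi> W D F c) [a0, a1] = \<phi>\<^sub>2 \<pi> W D F c [1, a0, a1] - \<phi>\<^sub>2 \<pi> W D F c [1, a1, a0]"
        by (simp add: connes_B_def A_cyc_def connes_B0_def z numeral_2_eq_2)
      then show ?thesis
        unfolding o using da.boundary_phi2[OF pair[of a0] pair[of a1]] by (simp add: J_def)
    qed
    ultimately show ?thesis by simp
  qed
  have second: "\<phi>\<^sub>3 \<pi> W D c [a0, a1, a2, a3] = hochschild_b (\<phi>\<^sub>2 \<pi> W D F c) [a0, a1, a2, a3]" for a0 a1 a2 a3
  proof -
    have b: "\<pi> a0 \<circ> comm_ext W D (\<pi> a1) \<circ> comm_ext W D (\<pi> a2) \<circ> comm_ext W D (\<pi> a3) \<in> B"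
      by (intro da.B_comp piB dpiB)
    have e3: "\<phi>\<^sub>3 \<pi> W D c [a0, a1, a2, a3]
        = 1/12 * da.I 3 (\<pi> a0 \<circ> da.dB (\<pi> a1) \<circ> da.dB (\<pi> a2) \<circ> da.dB (\<pi> a3) \<circ> F)"
      using da.ncint_I[OF b, of 3] da.local_character_3[OF piB[of a0] pair[of a1] pair[of a2] pair[of a3]]
      by (simp add: \<phi>\<^sub>3_def numeral_3_eq_3)
    have "hochschild_b (\<phi>\<^sub>2 \<pi> W D F c) [a0, a1, a2, a3] = \<phi>\<^sub>2 \<pi> W D F c [a0 * a1, a2, a3]
        - \<phi>\<^sub>2 \<pi> W D F c [a0, a1 * a2, a3] + \<phi>\<^sub>2 \<pi> W D F c [a0, a1, a2 * a3] - \<phi>\<^sub>2 \<pi> W D F c [a3 * a0, a1, a2]"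
      by (simp add: hochschild_b_def Let_def numeral_2_eq_2 numeral_3_eq_3)
    also have "\<dots> = 1/24 * (2 * da.I 3 (\<pi> a0 \<circ> da.dB (\<pi> a1) \<circ> da.dB (\<pi> a2) \<circ> da.dB (\<pi> a3) \<circ> F))"
      unfolding phi2 rep(1) da.coboundary_phi2[OF piB[of a0] pair[of a1] pair[of a2] pair[of a3], symmetric] by (simp add: algebra_simps)
    finally show ?thesis unfolding e3 by simp
  qed
  show ?thesis using first second by blast
qed

end
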